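(* Fix $N\ge 1$. For $M\ge N$ let $(Y^{N,M}(t))_{t\ge 0}$ be the Laguerre process, and let $(X^N(t))_{t\ge 0}$ be Hermitian Brownian motion on $\mathcal{H}_N$. Then, as $M\to\infty$, $$\Big(\frac{Y^{N,M}(t)-Mt\,\mathrm{Id}_N}{\sqrt{M}}\Big)_{t\ge 0}\ \longrightarrow\ \big(X^N(t^2)\big)_{t\ge 0}$$ in distribution, in the sense of weak convergence in $\mathcal{C}(\mathbb{R}_+,\mathcal{H}_N)$.
   Context: $\mathcal{H}_N$ denotes the space of $N\times N$ Hermitian complex matrices, $\mathrm{Id}_N$ the $N\times N$ identity matrix, and $\mathcal{C}(\mathbb{R}_+,\mathcal{H}_N)$ the space of continuous functions $\mathbb{R}_+\to\mathcal{H}_N$ with the topology of uniform convergence on compact sets. A standard complex Brownian motion is $(b+\sqrt{-1}\,b')/\sqrt2$ with $b,b'$ independent standard real Brownian motions started at $0$ (so that its squared modulus at time $t$ has expectation $t$). Laguerre process: $Y^{N,M}(t)=A^{N,M}(t)\,(A^{N,M}(t))^{*}$, where $A^{N,M}=(A_{i,j})$ is an $N\times M$ matrix whose entries are independent standard complex Brownian motions and $*$ denotes conjugate transpose. Hermitian Brownian motion: the process $X^N(t)=(X_{i,j}(t))_{1\le i,j\le N}\in\mathcal{H}_N$ where $(X_{i,j})_{1\le i<j\le N}$ are standard complex Brownian motions, $(X_{i,i})_{1\le i\le N}$ are standard real Brownian motions, all of these are independent, and $X_{i,j}=\overline{X_{j,i}}$ for $i>j$. *)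

theory Defs
  imports "HOL-Probability.Probability"
begin

section \<open>Topology of uniform convergence on compact sets\<close>

definition continuous_maps :: "'a::topological_space set \<Rightarrow> 'b::metric_space set \<Rightarrow> ('a \<Rightarrow> 'b) set" where
  "continuous_maps S H = {f \<in> S \<rightarrow>\<^sub>E H. continuous_on S f}"

definition compact_nbhd ::
    "'a::topological_space set \<Rightarrow> 'b::metric_space set \<Rightarrow> ('a \<Rightarrow> 'b) \<Rightarrow> 'a set \<Rightarrow> real \<Rightarrow> ('a \<Rightarrow> 'b) set" where
  "compact_nbhd S H f K e = {g \<in> continuous_maps S H. \<forall>x\<in>K. dist (f x) (g x) < e}"

definition compact_convergence_topology ::
    "'a::topological_space set \<Rightarrow> 'b::metric_space set \<Rightarrow> ('a \<Rightarrow> 'b) topology" where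
  "compact_convergence_topology S H = topology (\<lambda>U. U \<subseteq> continuous_maps S H \<and>
     (\<forall>f\<in>U. \<exists>K e. compact K \<and> K \<subseteq> S \<and> 0 < e \<and> compact_nbhd S H f K e \<subseteq> U))"

lemma openin_compact_convergence_topology:
  "openin (compact_convergence_topology S H) U \<longleftrightarrow> U \<subseteq> continuous_maps S H \<and>
     (\<forall>f\<in>U. \<exists>K e. compact K \<and> K \<subseteq> S \<and> 0 < e \<and> compact_nbhd S H f K e \<subseteq> U)"
proof -
  let ?P = "\<lambda>U. U \<subseteq> continuous_maps S H \<and>
     (\<forall>f\<in>U. \<exists>K e. compact K \<and> K \<subseteq> S \<and> 0 < e \<and> compact_nbhd S H f K e \<subseteq> U)"
  have "istopology ?P"
    unfolding istopology_def
  proof (intro conjI allI impI)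
    fix U V assume U: "?P U" and V: "?P V"
    show "U \<inter> V \<subseteq> continuous_maps S H" using U by blast
    show "\<forall>f\<in>U \<inter> V. \<exists>K e. compact K \<and> K \<subseteq> S \<and> 0 < e \<and> compact_nbhd S H f K e \<subseteq> U \<inter> V"
    proof
      fix f assume "f \<in> U \<inter> V"
      then obtain K e L d where
        K: "compact K" "K \<subseteq> S" "0 < e" "compact_nbhd S H f K e \<subseteq> U" and
        L: "compact L" "L \<subseteq> S" "0 < d" "compact_nbhd S H f L d \<subseteq> V"
        using U V by (meson IntD1 IntD2)
      have "compact_nbhd S H f (K \<union> L) (min e d) \<subseteq> U \<inter> V"
        using K(4) L(4) by (auto simp: compact_nbhd_def)
      then show "\<exists>K e. compact K \<and> K \<subseteq> S \<and> 0 < e \<and> compact_nbhd S H f K e \<subseteq> U \<inter> V"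
        using K L by (intro exI[of _ "K \<union> L"] exI[of _ "min e d"]) auto
    qed
  next
    fix \<U> assume A: "\<forall>U\<in>\<U>. ?P U"
    then show "\<Union>\<U> \<subseteq> continuous_maps S H" by blast
    show "\<forall>f\<in>\<Union>\<U>. \<exists>K e. compact K \<and> K \<subseteq> S \<and> 0 < e \<and> compact_nbhd S H f K e \<subseteq> \<Union>\<U>"
      using A by (meson Union_iff Sup_upper subset_trans)
  qed
  then show ?thesis
    by (simp add: compact_convergence_topology_def)
qed

lemma topspace_compact_convergence_topology:
  "topspace (compact_convergence_topology S H) = continuous_maps S H"
proof
  show "topspace (compact_convergence_topology S H) \<subseteq> continuous_maps S H"
    using openin_compact_convergence_topology openin_topspace by blast
  have "openin (compact_convergence_topology S H) (continuous_maps S H)"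
    by (auto simp: openin_compact_convergence_topology compact_nbhd_def
        intro!: exI[of _ "{}"] exI[of _ "1::real"])
  then show "continuous_maps S H \<subseteq> topspace (compact_convergence_topology S H)"
    by (rule openin_subset)
qed


section \<open>Convergence in distribution of random elements of a topological space\<close>

definition borel_of :: "'a topology \<Rightarrow> 'a measure" where
  "borel_of T = sigma (topspace T) {U. openin T U}"

text \<open>The probability spaces \<open>P n\<close> may differ. Since only the tail of the sequence matters,
  \<open>Z n\<close> need only be a random element of \<open>T\<close> for large \<open>n\<close>.\<close>

definition converges_in_distribution ::
    "'b topology \<Rightarrow> (nat \<Rightarrow> 'a measure) \<Rightarrow> (nat \<Rightarrow> 'a \<Rightarrow> 'b) \<Rightarrow> 'c measure \<Rightarrow> ('c \<Rightarrow> 'b) \<Rightarrow> bool" where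
  "converges_in_distribution T P Z Q W \<longleftrightarrow>
     (\<forall>\<^sub>F n in sequentially. Z n \<in> P n \<rightarrow>\<^sub>M borel_of T) \<and>
     W \<in> Q \<rightarrow>\<^sub>M borel_of T \<and>
     (\<forall>F. continuous_map T euclideanreal F \<and> bounded (F ` topspace T) \<longrightarrow>
        (\<lambda>n. \<integral>\<omega>. F (Z n \<omega>) \<partial>P n) \<longlonglongrightarrow> (\<integral>\<omega>. F (W \<omega>) \<partial>Q))"


section \<open>Brownian motions\<close>

text \<open>The sample path on the time set \<open>[0,\<infinity>)\<close>; values at negative times are irrelevant throughout.\<close>

definition path_of :: "(real \<Rightarrow> 'a \<Rightarrow> 'b) \<Rightarrow> 'a \<Rightarrow> real \<Rightarrow> 'b" where
  "path_of Z \<omega> = (\<lambda>t\<in>{0..}. Z t \<omega>)"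

text \<open>Independence of processes is independence of their paths with respect to the
  \<open>\<sigma>\<close>-algebra generated by the coordinates.\<close>

abbreviation path_algebra :: "(real \<Rightarrow> 'b::topological_space) measure" where
  "path_algebra \<equiv> PiM {0..} (\<lambda>_. borel)"

text \<open>All sample paths are continuous and start at 0, so that processes are random elements of
  the space of continuous functions without passing to a modification.\<close>

definition (in prob_space) std_real_BM :: "(real \<Rightarrow> 'a \<Rightarrow> real) \<Rightarrow> bool" where
  "std_real_BM b \<longleftrightarrow>
     (\<forall>t\<ge>0. random_variable borel (b t)) \<and>
     (\<forall>\<omega>\<in>space M. b 0 \<omega> = 0) \<and>
     (\<forall>\<omega>\<in>space M. continuous_on {0..} (\<lambda>t. b t \<omega>)) \<and>
     (\<forall>s t. 0 \<le> s \<and> s < t \<longrightarrow>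
        distributed M lborel (\<lambda>\<omega>. b t \<omega> - b s \<omega>) (normal_density 0 (sqrt (t - s)))) \<and>
     (\<forall>(n::nat) \<tau>. 0 \<le> \<tau> 0 \<and> strict_mono \<tau> \<longrightarrow>
        indep_vars (\<lambda>_. borel) (\<lambda>i \<omega>. b (\<tau> (Suc i)) \<omega> - b (\<tau> i) \<omega>) {..<n})"

definition (in prob_space) std_complex_BM :: "(real \<Rightarrow> 'a \<Rightarrow> complex) \<Rightarrow> bool" where
  "std_complex_BM z \<longleftrightarrow>
     (\<exists>b b'. std_real_BM b \<and> std_real_BM b' \<and>
        indep_var path_algebra (path_of b) path_algebra (path_of b') \<and>
        (\<forall>t\<ge>0. \<forall>\<omega>\<in>space M.
           z t \<omega> = (complex_of_real (b t \<omega>) + \<i> * complex_of_real (b' t \<omega>)) / complex_of_real (sqrt 2)))"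


section \<open>The matrix-valued processes\<close>

definition hermitian_matrices :: "(complex^'n^'n) set" where
  "hermitian_matrices = {H. \<forall>i j. H $ i $ j = cnj (H $ j $ i)}"

text \<open>The number of columns \<open>m\<close> varies, so an \<open>N \<times> m\<close> matrix is a function whose column index
  ranges over \<open>{..<m}\<close>.\<close>

definition (in prob_space) laguerre_process ::
    "nat \<Rightarrow> (real \<Rightarrow> 'a \<Rightarrow> complex^'n^'n) \<Rightarrow> bool" where
  "laguerre_process m Y \<longleftrightarrow>
     (\<exists>A :: 'n \<Rightarrow> nat \<Rightarrow> real \<Rightarrow> 'a \<Rightarrow> complex.
        (\<forall>i. \<forall>j<m. std_complex_BM (A i j)) \<and>
        indep_vars (\<lambda>_. path_algebra) (\<lambda>(i, j). path_of (A i j)) (UNIV \<times> {..<m}) \<and>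
        (\<forall>t\<ge>0. \<forall>\<omega>\<in>space M. Y t \<omega> = (\<chi> i k. \<Sum>j<m. A i j t \<omega> * cnj (A k j t \<omega>))))"

definition (in prob_space) hermitian_BM ::
    "(real \<Rightarrow> 'a \<Rightarrow> complex^'n::{finite,linorder}^'n::{finite,linorder}) \<Rightarrow> bool" where
  "hermitian_BM X \<longleftrightarrow>
     (\<forall>i j. i < j \<longrightarrow> std_complex_BM (\<lambda>t \<omega>. X t \<omega> $ i $ j)) \<and>
     (\<forall>i. \<exists>b. std_real_BM b \<and> (\<forall>t\<ge>0. \<forall>\<omega>\<in>space M. X t \<omega> $ i $ i = complex_of_real (b t \<omega>))) \<and>
     indep_vars (\<lambda>_. path_algebra) (\<lambda>(i, j). path_of (\<lambda>t \<omega>. X t \<omega> $ i $ j)) {(i, j). i \<le> j} \<and>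
     (\<forall>i j. j < i \<longrightarrow> (\<forall>t\<ge>0. \<forall>\<omega>\<in>space M. X t \<omega> $ i $ j = cnj (X t \<omega> $ j $ i)))"

end

theory Submission
  imports Defs
begin

text \<open>
  Write \<open>a\<^sub>j\<close> for the \<open>j\<close>-th column of the matrix \<open>A\<close>. Then
  \<open>Y(t) - M t Id = \<Sum>\<^sub>j (a\<^sub>j(t) a\<^sub>j(t)\<^sup>* - t Id)\<close> is a sum of \<open>M\<close> independent centered processes
  \<open>\<xi>\<^sub>j\<close>, so the theorem is a central limit theorem in path space. What singles out the limit is a
  covariance: for Gaussian columns, Wick's formula gives
  \<open>E[\<xi>\<^sub>i\<^sub>p(s) \<xi>\<^sub>q\<^sub>r(t)] = \<delta>\<^sub>i\<^sub>r \<delta>\<^sub>p\<^sub>q min(s,t)\<^sup>2\<close>, and \<open>min(s,t)\<^sup>2 = min(s\<^sup>2,t\<^sup>2)\<close> is the covariance of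
  Hermitian Brownian motion at the times \<open>s\<^sup>2\<close> and \<open>t\<^sup>2\<close>.

  The passage from linear functionals to path space rests on approximation. A bounded lower semicontinuous functional \<open>F\<close> is the increasing limit of functionals
  that are Lipschitz for the uniform distance on \<open>[0,n]\<close>, namely of inf-convolutions
  (\<open>lower_envelope_tendsto\<close>). For the indicator of an open set this yields Borel measurability
  (\<open>lsc_measurable\<close>); applied to \<open>F\<close> and \<open>-F\<close> with \<open>F\<close> continuous it reduces weak convergence to
  Lipschitz functionals \<open>G\<close> (\<open>lsc_portmanteau\<close>). Such a \<open>G\<close> is evaluated at the dyadic interpolation
  of the path instead of the path itself; by chaining, the bound
  \<open>E |Z(t) - Z(s)|\<^sup>4 \<le> C (t-s)\<^sup>2\<close> controls the error uniformly in \<open>M\<close>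
  (\<open>expectation_interp_error_le\<close>). What remains is a Lipschitz function \<open>g\<close> of finitely many real
  coordinates. Replacing \<open>g(x)\<close> by \<open>g(R sin(x/R))\<close> costs only \<open>E |x|\<^sup>2 / R\<close>, and the latter function
  is a uniform limit of trigonometric sums by the Stone-Weierstrass theorem, so only
  \<open>E cos(l(Z) + \<theta>)\<close> for linear functionals \<open>l\<close> has to converge (\<open>lipschitz_expectation_tendsto\<close>).
  All this is summed up in \<open>converges_in_distribution_criterion\<close>.

  The cosines converge by comparison of characteristic functions
  (\<open>triangular_array_cos_limit\<close>). The summands \<open>l(\<xi>\<^sub>j)\<close> have mean zero, a variance that depends neither
  on \<open>j\<close> nor on \<open>M\<close>, and bounded fourth moments. The variance comes from \<open>inner_\<xi>_moments\<close> and agrees with that of the limit,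
  computed in \<open>X_linear_combination_gaussian\<close>. The fourth moment bound in \<open>t - s\<close> follows from eighth
  moments of Gaussian increments (\<open>column_increment_moment\<close>) and from the elementary inequality
  \<open>E (\<Sum>\<^sub>j \<eta>\<^sub>j)\<^sup>4 \<le> 3 M\<^sup>2 max E \<eta>\<^sub>j\<^sup>4\<close> for independent centered \<open>\<eta>\<^sub>j\<close>.
\<close>

section \<open>Lipschitz functionals of paths\<close>

text \<open>The Lipschitz property for the uniform distance on \<open>[0,T]\<close>, phrased through upper bounds \<open>r\<close> of that
distance. It concerns all continuous paths, whatever their range, because \<open>G\<close> is also evaluated at
interpolations, whose values may leave the set in which the processes live.\<close>

definition lipschitz_functional :: "real \<Rightarrow> real \<Rightarrow> ((real \<Rightarrow> 'v::metric_space) \<Rightarrow> real) \<Rightarrow> bool" where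
  "lipschitz_functional T L G \<longleftrightarrow>
     (\<forall>f g r. continuous_on {0..T} f \<and> continuous_on {0..T} g \<and> (\<forall>t\<in>{0..T}. dist (f t) (g t) \<le> r)
        \<longrightarrow> \<bar>G f - G g\<bar> \<le> L * r)"

lemma lipschitz_functionalD:
  assumes "lipschitz_functional T L G" "continuous_on {0..T} f" "continuous_on {0..T} g"
    and "\<And>t. t \<in> {0..T} \<Longrightarrow> dist (f t) (g t) \<le> r"
  shows "\<bar>G f - G g\<bar> \<le> L * r"
  using assms unfolding lipschitz_functional_def by blast

text \<open>The inf-convolution of \<open>F\<close> with \<open>n\<close> times the uniform distance on \<open>[0,n]\<close>, cut off at \<open>B\<close>. The
competitor \<open>g\<close> ranges over the paths in \<open>H\<close>, while \<open>f\<close> may be any path; the element \<open>B\<close> keeps the set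
nonempty when \<open>f\<close> has no competitor at finite distance.\<close>

definition lower_envelope ::
    "'v::metric_space set \<Rightarrow> real \<Rightarrow> ((real \<Rightarrow> 'v) \<Rightarrow> real) \<Rightarrow> nat \<Rightarrow> (real \<Rightarrow> 'v) \<Rightarrow> real" where
  "lower_envelope H B F n f = Inf (insert B {F g + real n * r | g r.
     g \<in> continuous_maps {0..} H \<and> (\<forall>t\<in>{0..real n}. dist (f t) (g t) \<le> r)})"

context
  fixes H :: "'v::metric_space set" and F :: "(real \<Rightarrow> 'v) \<Rightarrow> real" and B :: real
  assumes F_bounded: "\<And>g. g \<in> continuous_maps {0..} H \<Longrightarrow> \<bar>F g\<bar> \<le> B"
begin

lemma lower_envelope_candidate_ge:
  assumes "g \<in> continuous_maps {0..} H" "\<forall>t\<in>{0..real n}. dist (f t) (g t) \<le> r"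
  shows "- B \<le> F g + real n * r" "0 \<le> r"
proof -
  have "0 \<le> dist (f 0) (g 0)" by simp
  also have "\<dots> \<le> r" using assms(2) by auto
  finally show "0 \<le> r" .
  then show "- B \<le> F g + real n * r"
    using F_bounded[OF assms(1)] mult_nonneg_nonneg[of "real n" r] by linarith
qed

lemma lower_envelope_bdd_below:
  assumes "0 \<le> B"
  shows "bdd_below (insert B {F g + real n * r | g r.
     g \<in> continuous_maps {0..} H \<and> (\<forall>t\<in>{0..real n}. dist (f t) (g t) \<le> r)})"
  using assms lower_envelope_candidate_ge(1) by (intro bdd_belowI[where m="- B"]) auto

lemma lower_envelope_le_candidate:
  assumes "0 \<le> B" "g \<in> continuous_maps {0..} H" "\<forall>t\<in>{0..real n}. dist (f t) (g t) \<le> r"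
  shows "lower_envelope H B F n f \<le> F g + real n * r"
  unfolding lower_envelope_def
  by (rule cInf_lower) (use assms lower_envelope_bdd_below[OF assms(1), of n f] in auto)

lemma lower_envelope_ge:
  assumes "m \<le> B"
    and "\<And>g r. g \<in> continuous_maps {0..} H \<Longrightarrow> \<forall>t\<in>{0..real n}. dist (f t) (g t) \<le> r \<Longrightarrow> m \<le> F g + real n * r"
  shows "m \<le> lower_envelope H B F n f"
  unfolding lower_envelope_def
  by (rule cInf_greatest) (use assms in auto)

lemma lower_envelope_le_bound:
  assumes "0 \<le> B"
  shows "lower_envelope H B F n f \<le> B"
  unfolding lower_envelope_def
  by (rule cInf_lower) (use lower_envelope_bdd_below[OF assms, of n f] in auto)

lemma lower_envelope_abs_le:
  assumes "0 \<le> B"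
  shows "\<bar>lower_envelope H B F n f\<bar> \<le> B"
proof -
  have "- B \<le> lower_envelope H B F n f"
    by (rule lower_envelope_ge) (use assms lower_envelope_candidate_ge(1) in auto)
  then show ?thesis using lower_envelope_le_bound[OF assms, of n f] by linarith
qed

lemma lower_envelope_le:
  assumes "f \<in> continuous_maps {0..} H"
  shows "lower_envelope H B F n f \<le> F f"
proof -
  have "0 \<le> B" using F_bounded[OF assms] by linarith
  then show ?thesis using lower_envelope_le_candidate[of f n f 0] assms by simp
qed

text \<open>If \<open>f\<close> and \<open>f'\<close> differ by at most \<open>\<rho>\<close>, then a competitor for \<open>f'\<close> at distance \<open>r\<close> is one for \<open>f\<close> at
distance \<open>\<rho> + r\<close>.\<close>

lemma lower_envelope_lipschitz:
  assumes "0 \<le> B"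
  shows "lipschitz_functional (real n) (real n) (lower_envelope H B F n)"
proof -
  have *: "lower_envelope H B F n f - real n * \<rho> \<le> lower_envelope H B F n f'"
    if d: "\<And>t. t \<in> {0..real n} \<Longrightarrow> dist (f t) (f' t) \<le> \<rho>" for f f' :: "real \<Rightarrow> 'v" and \<rho>
  proof (rule lower_envelope_ge)
    have "0 \<le> dist (f 0) (f' 0)" by simp
    also have "\<dots> \<le> \<rho>" using d by auto
    finally show "lower_envelope H B F n f - real n * \<rho> \<le> B"
      using lower_envelope_le_bound[OF assms, of n f] mult_nonneg_nonneg[of "real n" \<rho>] by linarith
  next
    fix g r assume g: "g \<in> continuous_maps {0..} H" and r: "\<forall>t\<in>{0..real n}. dist (f' t) (g t) \<le> r"
    have "dist (f t) (g t) \<le> \<rho> + r" if "t \<in> {0..real n}" for t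
      using d[OF that] r that dist_triangle[of "f t" "g t" "f' t"] by fastforce
    then have "lower_envelope H B F n f \<le> F g + real n * (\<rho> + r)"
      by (intro lower_envelope_le_candidate[OF assms g]) auto
    then show "lower_envelope H B F n f - real n * \<rho> \<le> F g + real n * r"
      by (simp add: algebra_simps)
  qed
  show ?thesis
    unfolding lipschitz_functional_def
  proof (intro allI impI, elim conjE)
    fix f g :: "real \<Rightarrow> 'v" and r
    assume "\<forall>t\<in>{0..real n}. dist (f t) (g t) \<le> r"
    then show "\<bar>lower_envelope H B F n f - lower_envelope H B F n g\<bar> \<le> real n * r"
      using *[of f g r] *[of g f r] by (auto simp: dist_commute abs_le_iff)
  qed
qed

text \<open>Competitors near \<open>f\<close> are controlled by lower semicontinuity; a competitor at distance at least \<open>\<delta>\<close>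
pays \<open>n \<delta>\<close>, which exceeds the range \<open>2 B\<close> of \<open>F\<close> once \<open>n\<close> is large.\<close>

lemma lower_envelope_tendsto:
  assumes f: "f \<in> continuous_maps {0..} H"
    and lsc: "\<And>\<epsilon>. 0 < \<epsilon> \<Longrightarrow> \<exists>m \<delta>. 0 < \<delta> \<and> (\<forall>g\<in>continuous_maps {0..} H.
                (\<forall>t\<in>{0..real m}. dist (f t) (g t) < \<delta>) \<longrightarrow> F f - \<epsilon> \<le> F g)"
  shows "(\<lambda>n. lower_envelope H B F n f) \<longlonglongrightarrow> F f"
proof (rule LIMSEQ_I)
  fix e :: real assume "0 < e"
  then obtain m \<delta> where \<delta>: "0 < \<delta>" and
    near: "\<And>g. g \<in> continuous_maps {0..} H \<Longrightarrow> (\<forall>t\<in>{0..real m}. dist (f t) (g t) < \<delta>) \<Longrightarrow> F f - e/2 \<le> F g"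
    using lsc[of "e/2"] by auto
  obtain n0 :: nat where n0: "2 * B / \<delta> \<le> real n0" using real_arch_simple by blast
  have FB: "\<bar>F f\<bar> \<le> B" by (rule F_bounded[OF f])
  show "\<exists>no. \<forall>n\<ge>no. norm (lower_envelope H B F n f - F f) < e"
  proof (intro exI allI impI)
    fix n assume n: "max n0 m \<le> n"
    have "2 * B \<le> real n0 * \<delta>" using n0 \<delta> by (simp add: divide_le_eq)
    also have "\<dots> \<le> real n * \<delta>" using n \<delta> by simp
    finally have nd: "2 * B \<le> real n * \<delta>" .
    have "F f - e/2 \<le> lower_envelope H B F n f"
    proof (rule lower_envelope_ge)
      show "F f - e/2 \<le> B" using FB \<open>0 < e\<close> by linarith
      fix g r assume g: "g \<in> continuous_maps {0..} H" and r: "\<forall>t\<in>{0..real n}. dist (f t) (g t) \<le> r"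
      show "F f - e/2 \<le> F g + real n * r"
      proof (cases "r < \<delta>")
        case True
        have "F f - e/2 \<le> F g"
        proof (rule near[OF g], intro ballI)
          fix t assume "t \<in> {0..real m}"
          then have "t \<in> {0..real n}" using n by auto
          then show "dist (f t) (g t) < \<delta>" using r True by force
        qed
        then show ?thesis using lower_envelope_candidate_ge(2)[OF g r] mult_nonneg_nonneg[of "real n" r] by linarith
      next
        case False
        then have "real n * \<delta> \<le> real n * r" by (intro mult_left_mono) auto
        then show ?thesis using nd F_bounded[OF g] FB \<open>0 < e\<close> by linarith
      qed
    qed
    with lower_envelope_le[OF f, of n] \<open>0 < e\<close>
    show "norm (lower_envelope H B F n f - F f) < e" by auto
  qed
qed

end

section \<open>Dyadic interpolation\<close>

definition grid :: "real \<Rightarrow> nat \<Rightarrow> nat \<Rightarrow> real" where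
  "grid T k i = T * real i / 2 ^ k"

text \<open>The integer translates of this function are a partition of unity on the real line, so the piecewise
linear interpolation is a weighted sum, visibly continuous in \<open>t\<close> and linear in the nodal values.\<close>

definition tent :: "real \<Rightarrow> real" where
  "tent y = max 0 (1 - \<bar>y\<bar>)"

definition interp :: "real \<Rightarrow> nat \<Rightarrow> (nat \<Rightarrow> 'v::real_normed_vector) \<Rightarrow> real \<Rightarrow> 'v" where
  "interp T k x t = (\<Sum>i\<le>2^k. tent (t * 2^k / T - real i) *\<^sub>R x i)"

lemma grid_in:
  assumes "0 < T" "i \<le> 2 ^ k"
  shows "grid T k i \<in> {0..T}"
proof -
  have "real i \<le> 2 ^ k" using assms(2) by (metis of_nat_le_iff of_nat_numeral of_nat_power)
  then show ?thesis using assms(1) by (simp add: grid_def divide_simps)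
qed

text \<open>The closed form past the right end of the grid is what makes the induction on \<open>m\<close> work; the sum is 1
for \<open>y \<le> m\<close>.\<close>

lemma sum_tent:
  assumes "0 \<le> y"
  shows "(\<Sum>i\<le>m. tent (y - real i)) = max 0 (min 1 (real m + 1 - y))"
proof (induction m)
  case 0
  then show ?case using assms by (auto simp: tent_def)
next
  case (Suc m)
  then show ?case using assms by (auto simp: tent_def max_def min_def)
qed

text \<open>The interpolated value is a convex combination of the values at those nodes that are less than one
mesh away from \<open>t\<close>.\<close>

lemma interp_dist_le:
  assumes T: "0 < T" and t: "t \<in> {0..T}"
    and near: "\<And>i. i \<le> 2^k \<Longrightarrow> \<bar>t - grid T k i\<bar> < T / 2^k \<Longrightarrow> dist y (x i) \<le> r"
  shows "dist y (interp T k x t) \<le> r"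
proof -
  let ?w = "\<lambda>i. tent (t * 2^k / T - real i)"
  have "t * 2^k / T \<le> 2^k" using T t by (simp add: divide_simps)
  then have one: "(\<Sum>i\<le>2^k. ?w i) = 1"
    using T t by (subst sum_tent) auto
  have "dist y (interp T k x t) = norm ((\<Sum>i\<le>2^k. ?w i) *\<^sub>R y - interp T k x t)"
    by (simp add: one dist_norm)
  also have "\<dots> = norm (\<Sum>i\<le>2^k. ?w i *\<^sub>R (y - x i))"
    by (simp add: interp_def scaleR_sum_left sum_subtractf scaleR_diff_right)
  also have "\<dots> \<le> (\<Sum>i\<le>2^k. ?w i * r)"
  proof (rule sum_norm_le)
    fix i assume i: "i \<in> {..2^k::nat}"
    show "norm (?w i *\<^sub>R (y - x i)) \<le> ?w i * r"
    proof (cases "\<bar>t - grid T k i\<bar> < T / 2^k")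
      case True
      then have "dist y (x i) \<le> r" using near i by auto
      then show ?thesis by (auto simp: dist_norm tent_def intro!: mult_left_mono)
    next
      case False
      have "t * 2^k / T - real i = (t - grid T k i) * (2^k / T)"
        using T by (simp add: grid_def field_simps)
      then have "\<bar>t * 2^k / T - real i\<bar> = \<bar>t - grid T k i\<bar> * (2^k / T)"
        using T by (simp add: abs_mult)
      moreover have "1 \<le> \<bar>t - grid T k i\<bar> * (2^k / T)"
        using False T by (simp add: field_simps)
      ultimately have "?w i = 0" by (simp add: tent_def)
      then show ?thesis by simp
    qed
  qed
  also have "\<dots> = r" by (simp add: sum_distrib_right[symmetric] one)
  finally show ?thesis .
qed

lemma continuous_on_interp: "continuous_on A (interp T k x)"
  unfolding interp_def tent_def by (auto intro!: continuous_intros simp: divide_inverse)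

lemma dist_interp_le:
  "dist (interp T k x t) (interp T k y t) \<le> (\<Sum>i\<le>2^k. dist (x i) (y i))"
proof -
  have "interp T k x t - interp T k y t = (\<Sum>i\<le>2^k. tent (t * 2^k / T - real i) *\<^sub>R (x i - y i))"
    by (simp add: interp_def scaleR_diff_right sum_subtractf)
  also have "norm \<dots> \<le> (\<Sum>i\<le>2^k. dist (x i) (y i))"
  proof (rule sum_norm_le)
    fix i
    have "\<bar>tent (t * 2^k / T - real i)\<bar> \<le> 1" by (simp add: tent_def)
    then show "norm (tent (t * 2^k / T - real i) *\<^sub>R (x i - y i)) \<le> dist (x i) (y i)"
      by (simp add: dist_norm mult_left_le_one_le)
  qed
  finally show ?thesis by (simp add: dist_norm)
qed

lemma interp_uniform_limit:
  fixes f :: "real \<Rightarrow> 'v::real_normed_vector"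
  assumes T: "0 < T" and f: "continuous_on {0..T} f" and e: "0 < e"
  shows "\<forall>\<^sub>F k in sequentially. \<forall>t\<in>{0..T}. dist (f t) (interp T k (\<lambda>i. f (grid T k i)) t) \<le> e"
proof -
  have "uniformly_continuous_on {0..T} f"
    by (rule compact_uniformly_continuous[OF f]) simp
  then obtain d where d: "0 < d" and
    unif: "\<And>s t. s \<in> {0..T} \<Longrightarrow> t \<in> {0..T} \<Longrightarrow> dist s t < d \<Longrightarrow> dist (f s) (f t) < e"
    using e unfolding uniformly_continuous_on_def by metis
  have "(\<lambda>k. T * (1 / 2) ^ k) \<longlonglongrightarrow> T * 0"
    by (intro tendsto_mult tendsto_const LIMSEQ_power_zero) simp
  then have "\<forall>\<^sub>F k in sequentially. T * (1 / 2) ^ k < d"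
    using d by (intro order_tendstoD(2)[where y=0]) auto
  then show ?thesis
  proof eventually_elim
    case (elim k)
    show ?case
    proof
      fix t assume t: "t \<in> {0..T}"
      show "dist (f t) (interp T k (\<lambda>i. f (grid T k i)) t) \<le> e"
      proof (rule interp_dist_le[OF T t])
        fix i :: nat assume "i \<le> 2^k" "\<bar>t - grid T k i\<bar> < T / 2^k"
        then show "dist (f t) (f (grid T k i)) \<le> e"
          using unif[OF t grid_in[OF T \<open>i \<le> 2^k\<close>]] elim by (simp add: dist_real_def power_divide)
      qed
    qed
  qed
qed

lemma interp_functional_tendsto:
  fixes f :: "real \<Rightarrow> 'v::real_normed_vector"
  assumes T: "0 < T" and f: "continuous_on {0..T} f" and G: "lipschitz_functional T L G"
  shows "(\<lambda>k. G (interp T k (\<lambda>i. f (grid T k i)))) \<longlonglongrightarrow> G f"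
proof (rule LIMSEQ_I)
  fix e :: real assume e: "0 < e"
  let ?r = "e / (2 * (\<bar>L\<bar> + 1))"
  have "0 < ?r" using e by (simp add: add_nonneg_pos)
  from interp_uniform_limit[OF T f this]
  obtain k0 where k0: "\<And>k. k \<ge> k0 \<Longrightarrow> \<forall>t\<in>{0..T}. dist (f t) (interp T k (\<lambda>i. f (grid T k i)) t) \<le> ?r"
    by (auto simp: eventually_sequentially)
  have "norm (G (interp T k (\<lambda>i. f (grid T k i))) - G f) < e" if "k \<ge> k0" for k
  proof -
    have "\<bar>G f - G (interp T k (\<lambda>i. f (grid T k i)))\<bar> \<le> L * ?r"
      using k0[OF that] by (intro lipschitz_functionalD[OF G f continuous_on_interp]) auto
    also have "\<dots> \<le> (\<bar>L\<bar> + 1) * ?r"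
      using \<open>0 < ?r\<close> by (intro mult_right_mono) auto
    also have "\<dots> = e / 2" by (simp add: divide_simps)
    finally show ?thesis using e by (simp add: abs_minus_commute)
  qed
  then show "\<exists>no. \<forall>k\<ge>no. norm (G (interp T k (\<lambda>i. f (grid T k i))) - G f) < e" by blast
qed

lemma continuous_on_finite_coordinates:
  fixes g :: "('i::countable \<Rightarrow> 'v::metric_space) \<Rightarrow> real"
  assumes "\<And>x y. \<bar>g x - g y\<bar> \<le> L * (\<Sum>d\<in>D. dist (x d) (y d))"
  shows "continuous_on S g"
proof (rule continuous_at_imp_continuous_on, intro ballI)
  fix x :: "'i \<Rightarrow> 'v"
  have "((\<lambda>y. L * (\<Sum>d\<in>D. dist (y d) (x d))) \<longlongrightarrow> L * (\<Sum>d\<in>D. dist (x d) (x d))) (at x)"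
  proof (intro tendsto_intros)
    fix i
    have "continuous_on UNIV (\<lambda>y::'i \<Rightarrow> 'v. y i)" by simp
    then show "((\<lambda>y::'i \<Rightarrow> 'v. y i) \<longlongrightarrow> x i) (at x)"
      by (auto simp: continuous_on_def)
  qed
  then have lim: "((\<lambda>y. L * (\<Sum>d\<in>D. dist (y d) (x d))) \<longlongrightarrow> 0) (at x)" by simp
  have "((\<lambda>y. g y - g x) \<longlongrightarrow> 0) (at x)"
    by (rule Lim_null_comparison[OF always_eventually lim]) (use assms in simp)
  then show "isCont g x"
    unfolding isCont_def by (subst Lim_null)
qed

lemma continuous_on_interp_functional:
  assumes G: "lipschitz_functional T L G"
  shows "continuous_on UNIV (\<lambda>x::nat \<Rightarrow> 'v::real_normed_vector. G (interp T k x))"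
  by (rule continuous_on_finite_coordinates,
      rule lipschitz_functionalD[OF G continuous_on_interp continuous_on_interp]) (rule dist_interp_le)

lemma lipschitz_functional_interp_measurable:
  fixes f :: "'a \<Rightarrow> real \<Rightarrow> 'v::{real_normed_vector,second_countable_topology}"
  assumes T: "0 < T" and G: "lipschitz_functional T L G"
    and rv: "\<And>t. 0 \<le> t \<Longrightarrow> (\<lambda>\<omega>. f \<omega> t) \<in> borel_measurable P"
  shows "(\<lambda>\<omega>. G (interp T k (\<lambda>i. f \<omega> (grid T k i)))) \<in> borel_measurable P"
proof -
  have [measurable]: "(\<lambda>x::nat \<Rightarrow> 'v. G (interp T k x)) \<in> borel_measurable borel"
    by (rule borel_measurable_continuous_onI[OF continuous_on_interp_functional[OF G]])
  have [measurable]: "(\<lambda>\<omega>. f \<omega> (grid T k i)) \<in> borel_measurable P" for i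
    using T by (intro rv) (simp add: grid_def)
  have "(\<lambda>\<omega> i. f \<omega> (grid T k i)) \<in> borel_measurable P"
    by (rule measurable_coordinatewise_then_product) simp
  then show ?thesis by measurable
qed

text \<open>A Lipschitz functional is the pointwise limit of its values at the interpolations, and those are
continuous functions of finitely many coordinates of the process.\<close>

lemma lipschitz_functional_measurable:
  fixes f :: "'a \<Rightarrow> real \<Rightarrow> 'v::{real_normed_vector,second_countable_topology}"
  assumes T: "0 < T" and G: "lipschitz_functional T L G"
    and rv: "\<And>t. 0 \<le> t \<Longrightarrow> (\<lambda>\<omega>. f \<omega> t) \<in> borel_measurable P"
    and cont: "\<And>\<omega>. \<omega> \<in> space P \<Longrightarrow> continuous_on {0..T} (f \<omega>)"
  shows "(\<lambda>\<omega>. G (f \<omega>)) \<in> borel_measurable P"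
  by (rule borel_measurable_LIMSEQ_real[OF interp_functional_tendsto[OF T cont G]
        lipschitz_functional_interp_measurable[OF T G rv]])

section \<open>Chaining\<close>

text \<open>Let \<open>q\<close> be this rate. A fourth moment bound \<open>C (t-s)\<^sup>2\<close> contributes \<open>2\<^sup>-\<^sup>n = q\<^sup>8\<^sup>n\<close> on the dyadic grid of level
\<open>n\<close>, which leaves room for the factor \<open>q\<^sup>-\<^sup>3\<^sup>n\<close> in the definition below.\<close>

definition osc_rate :: real where
  "osc_rate = root 8 (1 / 2)"

text \<open>A majorant of the largest increment over the grid of level \<open>n\<close>, by \<open>x \<le> a + x\<^sup>4/a\<^sup>3\<close> with \<open>a = q\<^sup>n\<close>. Unlike
the maximum, it has an expectation that fourth moments control without taking roots.\<close>

definition oscillation :: "real \<Rightarrow> nat \<Rightarrow> (real \<Rightarrow> 'v::metric_space) \<Rightarrow> real" where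
  "oscillation T n f = osc_rate ^ n +
     (\<Sum>i<2^n. dist (f (grid T n (Suc i))) (f (grid T n i)) ^ 4) / osc_rate ^ (3 * n)"

lemma osc_rate: "0 < osc_rate" "osc_rate < 1" "osc_rate ^ 8 = 1 / 2"
proof -
  show *: "osc_rate ^ 8 = 1 / 2" unfolding osc_rate_def by (rule real_root_pow_pos2) auto
  show "0 < osc_rate" unfolding osc_rate_def by simp
  show "osc_rate < 1"
  proof (rule ccontr)
    assume "\<not> osc_rate < 1"
    then have "1 \<le> osc_rate ^ 8" by (intro one_le_power) simp
    then show False using * by simp
  qed
qed

lemma oscillation_nonneg: "0 \<le> oscillation T n f"
  unfolding oscillation_def using osc_rate(1) by (intro add_nonneg_nonneg divide_nonneg_nonneg sum_nonneg) auto

lemma dist_grid_le_oscillation: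
  assumes "i < 2 ^ n"
  shows "dist (f (grid T n (Suc i))) (f (grid T n i)) \<le> oscillation T n f"
proof -
  let ?d = "dist (f (grid T n (Suc i))) (f (grid T n i))" and ?a = "osc_rate ^ n"
  have a: "0 < ?a" using osc_rate(1) by simp
  have le: "?d ^ 4 \<le> (\<Sum>i<2^n. dist (f (grid T n (Suc i))) (f (grid T n i)) ^ 4)"
    using assms by (intro member_le_sum) auto
  have "?d \<le> ?a + ?d ^ 4 / ?a ^ 3"
  proof (cases "?d \<le> ?a")
    case True
    then show ?thesis using a by (simp add: add_increasing2)
  next
    case False
    then have "?a ^ 3 \<le> ?d ^ 3" using a by (intro power_mono) auto
    then have "?d * ?a ^ 3 \<le> ?d * ?d ^ 3" by (intro mult_left_mono) auto
    also have "\<dots> = ?d ^ 4" by (simp add: eval_nat_numeral)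
    finally have "?d \<le> ?d ^ 4 / ?a ^ 3" using a by (simp add: le_divide_eq)
    then show ?thesis using a by linarith
  qed
  also have "\<dots> \<le> oscillation T n f"
  proof -
    have "?a ^ 3 = osc_rate ^ (3 * n)" by (simp add: power_mult[symmetric] mult.commute)
    then show ?thesis
      unfolding oscillation_def using a le osc_rate(1) by (simp add: divide_right_mono)
  qed
  finally show ?thesis .
qed

text \<open>Round \<open>t\<close> down to the grids of level \<open>k\<close>, \<open>k+1\<close>, and so on; consecutive roundings are equal or
neighbours on the finer grid, and they converge to \<open>t\<close>. A node at distance less than one mesh from
\<open>t\<close> is the rounding of level \<open>k\<close> or its right neighbour, which accounts for the term of level \<open>k\<close>.\<close>

lemma dist_grid_le_suminf_oscillation:
  fixes f :: "real \<Rightarrow> 'v::metric_space"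
  assumes T: "0 < T" and f: "continuous_on {0..T} f" and t: "t \<in> {0..T}"
    and i: "i \<le> 2 ^ k" "\<bar>t - grid T k i\<bar> < T / 2 ^ k"
    and summ: "summable (\<lambda>n. oscillation T n f)"
  shows "dist (f t) (f (grid T k i)) \<le> (\<Sum>n. oscillation T (n + k) f)"
proof -
  define fl where "fl n = nat \<lfloor>t * 2 ^ n / T\<rfloor>" for n
  have nn: "0 \<le> t * 2 ^ n / T" for n using T t by simp
  have fl: "real (fl n) \<le> t * 2 ^ n / T" "t * 2 ^ n / T < real (fl n) + 1" for n
    using nn[of n] unfolding fl_def by linarith+
  have fl_le: "fl n \<le> 2 ^ n" for n
  proof -
    have "t * 2 ^ n / T \<le> 2 ^ n" using T t by (simp add: divide_simps)
    then have "real (fl n) \<le> 2 ^ n" using fl(1)[of n] by linarith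
    then show ?thesis by (metis of_nat_le_iff of_nat_numeral of_nat_power)
  qed
  have fl_Suc: "fl (Suc n) = 2 * fl n \<or> fl (Suc n) = Suc (2 * fl n)" for n
  proof -
    have "t * 2 ^ Suc n / T = 2 * (t * 2 ^ n / T)" by simp
    then have "real (fl (Suc n)) < 2 * real (fl n) + 2" "2 * real (fl n) < real (fl (Suc n)) + 1"
      using fl[of n] fl[of "Suc n"] by linarith+
    then show ?thesis by linarith
  qed
  have grid_double: "grid T (Suc n) (2 * j) = grid T n j" for n j
    by (simp add: grid_def)
  have step: "dist (f (grid T n (fl n))) (f (grid T (Suc n) (fl (Suc n)))) \<le> oscillation T (Suc n) f" for n
    using fl_Suc[of n]
  proof
    assume "fl (Suc n) = 2 * fl n"
    then show ?thesis by (simp add: grid_double oscillation_nonneg)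
  next
    assume e: "fl (Suc n) = Suc (2 * fl n)"
    then have "2 * fl n < 2 ^ Suc n" using fl_le[of "Suc n"] by simp
    from dist_grid_le_oscillation[OF this, of f T] show ?thesis
      by (simp add: e grid_double dist_commute)
  qed
  have partial: "dist (f (grid T k (fl k))) (f (grid T (N + k) (fl (N + k)))) \<le> (\<Sum>n<N. oscillation T (Suc (n + k)) f)" for N
  proof (induction N)
    case (Suc N)
    then show ?case
      using step[of "N + k"]
        dist_triangle[of "f (grid T k (fl k))" "f (grid T (Suc N + k) (fl (Suc N + k)))" "f (grid T (N + k) (fl (N + k)))"]
      by simp
  qed simp
  have "summable (\<lambda>n. oscillation T (n + k) f)" using summ by (subst summable_iff_shift)
  then have summ': "summable (\<lambda>n. oscillation T (Suc (n + k)) f)"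
    and split: "(\<Sum>n. oscillation T (n + k) f) = oscillation T k f + (\<Sum>n. oscillation T (Suc (n + k)) f)"
    using summable_Suc_iff[of "\<lambda>n. oscillation T (n + k) f"] suminf_split_head[of "\<lambda>n. oscillation T (n + k) f"] by auto
  have bound: "dist (f (grid T k (fl k))) (f (grid T (N + k) (fl (N + k)))) \<le> (\<Sum>n. oscillation T (Suc (n + k)) f)" for N
    using partial[of N] sum_le_suminf[OF summ', of "{..<N}"] by (fastforce simp: oscillation_nonneg)
  have near: "\<bar>grid T n (fl n) - t\<bar> \<le> T * (1 / 2) ^ n" for n
  proof -
    have "grid T n (fl n) - t = (real (fl n) - t * 2 ^ n / T) * (T / 2 ^ n)"
      using T by (simp add: grid_def field_simps)
    then have "\<bar>grid T n (fl n) - t\<bar> = \<bar>real (fl n) - t * 2 ^ n / T\<bar> * (T / 2 ^ n)"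
      using T by (simp add: abs_mult)
    also have "\<dots> \<le> 1 * (T / 2 ^ n)"
      using fl[of n] T by (intro mult_right_mono) auto
    finally show ?thesis by (simp add: power_divide)
  qed
  have "(\<lambda>n. T * (1 / 2) ^ n) \<longlonglongrightarrow> T * 0"
    by (intro tendsto_mult tendsto_const LIMSEQ_power_zero) simp
  then have lim: "(\<lambda>n. T * (1 / 2) ^ n) \<longlonglongrightarrow> 0" by simp
  have "(\<lambda>n. grid T n (fl n) - t) \<longlonglongrightarrow> 0"
    by (rule Lim_null_comparison[OF _ lim]) (use near in simp)
  then have "(\<lambda>n. grid T n (fl n)) \<longlonglongrightarrow> t" by (subst Lim_null)
  then have "(\<lambda>n. f (grid T n (fl n))) \<longlonglongrightarrow> f t"
    by (rule continuous_on_tendsto_compose[OF f _ t]) (use grid_in[OF T fl_le] in auto)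
  then have "(\<lambda>N. f (grid T (N + k) (fl (N + k)))) \<longlonglongrightarrow> f t" by (rule LIMSEQ_ignore_initial_segment)
  then have "(\<lambda>N. dist (f (grid T k (fl k))) (f (grid T (N + k) (fl (N + k))))) \<longlonglongrightarrow> dist (f (grid T k (fl k))) (f t)"
    by (intro tendsto_dist tendsto_const)
  then have main: "dist (f (grid T k (fl k))) (f t) \<le> (\<Sum>n. oscillation T (Suc (n + k)) f)"
    by (rule LIMSEQ_le_const2) (use bound in auto)
  have "\<bar>t * 2 ^ k / T - real i\<bar> < 1"
  proof -
    have "t * 2 ^ k / T - real i = (t - grid T k i) * (2 ^ k / T)"
      using T by (simp add: grid_def field_simps)
    then have "\<bar>t * 2 ^ k / T - real i\<bar> = \<bar>t - grid T k i\<bar> * (2 ^ k / T)"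
      using T by (simp add: abs_mult)
    also have "\<dots> < 1" using i(2) T by (simp add: field_simps)
    finally show ?thesis .
  qed
  then have "i = fl k \<or> i = Suc (fl k)" using fl[of k] by linarith
  then have "dist (f (grid T k (fl k))) (f (grid T k i)) \<le> oscillation T k f"
  proof
    assume e: "i = Suc (fl k)"
    then have "fl k < 2 ^ k" using i(1) by simp
    from dist_grid_le_oscillation[OF this, of f T] show ?thesis by (simp add: e dist_commute)
  qed (simp add: oscillation_nonneg)
  then show ?thesis
    using main split dist_triangle[of "f t" "f (grid T k i)" "f (grid T k (fl k))"] by (simp add: dist_commute)
qed

text \<open>There are \<open>2\<^sup>n\<close> increments over intervals of length \<open>T/2\<^sup>n\<close>, so the fourth moments add up to
\<open>C T\<^sup>2 2\<^sup>-\<^sup>n = C T\<^sup>2 q\<^sup>8\<^sup>n\<close>, and dividing by \<open>q\<^sup>3\<^sup>n\<close> leaves \<open>C T\<^sup>2 q\<^sup>5\<^sup>n\<close>.\<close>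

lemma nn_integral_oscillation_le:
  fixes f :: "'a \<Rightarrow> real \<Rightarrow> 'v::{real_normed_vector,second_countable_topology}"
  assumes P: "prob_space P" and T: "0 < T" and C: "0 \<le> C"
    and rv: "\<And>t. 0 \<le> t \<Longrightarrow> (\<lambda>\<omega>. f \<omega> t) \<in> borel_measurable P"
    and moment: "\<And>s t. s \<in> {0..T} \<Longrightarrow> t \<in> {0..T} \<Longrightarrow>
        (\<integral>\<^sup>+\<omega>. ennreal (dist (f \<omega> t) (f \<omega> s) ^ 4) \<partial>P) \<le> ennreal (C * (t - s)\<^sup>2)"
  shows "(\<integral>\<^sup>+\<omega>. ennreal (oscillation T n (f \<omega>)) \<partial>P) \<le> ennreal ((1 + C * T\<^sup>2) * osc_rate ^ n)"
proof -
  interpret prob_space P by (rule P)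
  let ?d = "\<lambda>\<omega> i. dist (f \<omega> (grid T n (Suc i))) (f \<omega> (grid T n i)) ^ 4"
  let ?a = "1 / osc_rate ^ (3 * n)"
  have a: "0 \<le> ?a" using osc_rate(1) by simp
  have [measurable]: "(\<lambda>\<omega>. f \<omega> (grid T n i)) \<in> borel_measurable P" for i
    using T by (intro rv) (simp add: grid_def)
  have "(\<integral>\<^sup>+\<omega>. ennreal (oscillation T n (f \<omega>)) \<partial>P)
      = (\<integral>\<^sup>+\<omega>. ennreal (osc_rate ^ n) + ennreal ?a * (\<Sum>i<2^n. ennreal (?d \<omega> i)) \<partial>P)"
  proof (rule nn_integral_cong)
    fix \<omega>
    have "oscillation T n (f \<omega>) = osc_rate ^ n + ?a * (\<Sum>i<2^n. ?d \<omega> i)"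
      by (simp add: oscillation_def)
    then show "ennreal (oscillation T n (f \<omega>)) = ennreal (osc_rate ^ n) + ennreal ?a * (\<Sum>i<2^n. ennreal (?d \<omega> i))"
      using a osc_rate(1) by (simp add: sum_nonneg ennreal_plus[symmetric] ennreal_mult[symmetric] del: ennreal_plus)
  qed
  also have "\<dots> = ennreal (osc_rate ^ n) + ennreal ?a * (\<Sum>i<2^n. \<integral>\<^sup>+\<omega>. ennreal (?d \<omega> i) \<partial>P)"
    by (simp add: nn_integral_add nn_integral_cmult nn_integral_sum emeasure_space_1 del: sum_ennreal)
  also have "\<dots> \<le> ennreal (osc_rate ^ n) + ennreal ?a * (\<Sum>i<2^n::nat. ennreal (C * (T / 2 ^ n)\<^sup>2))"
  proof (intro add_left_mono mult_left_mono sum_mono)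
    fix i :: nat assume i: "i \<in> {..<2^n}"
    have "grid T n (Suc i) - grid T n i = T / 2 ^ n" by (simp add: grid_def field_simps)
    then show "(\<integral>\<^sup>+\<omega>. ennreal (?d \<omega> i) \<partial>P) \<le> ennreal (C * (T / 2 ^ n)\<^sup>2)"
      using moment[OF grid_in[OF T] grid_in[OF T], of i n "Suc i" n] i by simp
  qed simp
  also have "\<dots> = ennreal (osc_rate ^ n + ?a * (2 ^ n * (C * (T / 2 ^ n)\<^sup>2)))"
    using a C osc_rate(1) by (simp add: sum_nonneg ennreal_plus[symmetric] ennreal_mult[symmetric] ennreal_of_nat_eq_real_of_nat  del: ennreal_plus)
  also have "\<dots> \<le> ennreal ((1 + C * T\<^sup>2) * osc_rate ^ n)"
  proof (rule ennreal_leI)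
    have h: "(1 / 2 :: real) ^ n = osc_rate ^ (8 * n)" by (simp only: power_mult osc_rate)
    have "2 ^ n * (C * (T / 2 ^ n)\<^sup>2) = C * T\<^sup>2 * (1 / 2) ^ n"
      by (simp add: field_simps power2_eq_square power_divide)
    also have "\<dots> = C * T\<^sup>2 * (osc_rate ^ (3 * n) * osc_rate ^ (5 * n))"
      by (simp add: h power_add[symmetric])
    finally have "?a * (2 ^ n * (C * (T / 2 ^ n)\<^sup>2)) = C * T\<^sup>2 * osc_rate ^ (5 * n)"
      using osc_rate(1) by (simp add: field_simps)
    also have "\<dots> \<le> C * T\<^sup>2 * osc_rate ^ n"
      using C osc_rate by (intro mult_left_mono power_decreasing) auto
    finally show "osc_rate ^ n + ?a * (2 ^ n * (C * (T / 2 ^ n)\<^sup>2)) \<le> (1 + C * T\<^sup>2) * osc_rate ^ n"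
      by (simp add: algebra_simps)
  qed
  finally show ?thesis .
qed

text \<open>The pointwise estimate is stated in the extended reals: for paths whose oscillations are not summable
its right-hand side is infinite, so it holds for every path and can be integrated term by term.\<close>

lemma expectation_interp_error_le:
  fixes f :: "'a \<Rightarrow> real \<Rightarrow> 'v::{real_normed_vector,second_countable_topology}"
  assumes P: "prob_space P" and T: "0 < T" and C: "0 \<le> C" and L: "0 < L"
    and rv: "\<And>t. 0 \<le> t \<Longrightarrow> (\<lambda>\<omega>. f \<omega> t) \<in> borel_measurable P"
    and cont: "\<And>\<omega>. \<omega> \<in> space P \<Longrightarrow> continuous_on {0..T} (f \<omega>)"
    and moment: "\<And>s t. s \<in> {0..T} \<Longrightarrow> t \<in> {0..T} \<Longrightarrow>
        (\<integral>\<^sup>+\<omega>. ennreal (dist (f \<omega> t) (f \<omega> s) ^ 4) \<partial>P) \<le> ennreal (C * (t - s)\<^sup>2)"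
    and G: "lipschitz_functional T L G" and bdd: "\<And>f. \<bar>G f\<bar> \<le> B"
  shows "\<bar>(\<integral>\<omega>. G (f \<omega>) \<partial>P) - (\<integral>\<omega>. G (interp T k (\<lambda>i. f \<omega> (grid T k i))) \<partial>P)\<bar>
     \<le> L * ((1 + C * T\<^sup>2) * (osc_rate ^ k / (1 - osc_rate)))"
proof -
  interpret prob_space P by (rule P)
  let ?I = "\<lambda>\<omega>. interp T k (\<lambda>i. f \<omega> (grid T k i))"
  let ?K = "L * ((1 + C * T\<^sup>2) * (osc_rate ^ k / (1 - osc_rate)))"
  have K: "0 \<le> ?K" using L C osc_rate by (intro mult_nonneg_nonneg divide_nonneg_nonneg add_nonneg_nonneg) auto
  have [measurable]: "(\<lambda>\<omega>. G (f \<omega>)) \<in> borel_measurable P"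
    by (rule lipschitz_functional_measurable[OF T G rv cont])
  have [measurable]: "(\<lambda>\<omega>. G (?I \<omega>)) \<in> borel_measurable P"
    by (rule lipschitz_functional_interp_measurable[OF T G rv])
  have [measurable]: "(\<lambda>\<omega>. f \<omega> (grid T n i)) \<in> borel_measurable P" for i n
    using T by (intro rv) (simp add: grid_def)
  have [measurable]: "(\<lambda>\<omega>. oscillation T n (f \<omega>)) \<in> borel_measurable P" for n
    unfolding oscillation_def by measurable
  have int: "integrable P (\<lambda>\<omega>. G (f \<omega>))" "integrable P (\<lambda>\<omega>. G (?I \<omega>))"
    using bdd by (auto intro!: integrable_const_bound[where B=B])
  have pw: "ennreal \<bar>G (f \<omega>) - G (?I \<omega>)\<bar> \<le> ennreal L * (\<Sum>n. ennreal (oscillation T (n + k) (f \<omega>)))"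
    if \<omega>: "\<omega> \<in> space P" for \<omega>
  proof (cases "summable (\<lambda>n. oscillation T n (f \<omega>))")
    case True
    let ?s = "\<Sum>n. oscillation T (n + k) (f \<omega>)"
    have summ: "summable (\<lambda>n. oscillation T (n + k) (f \<omega>))" using True by (subst summable_iff_shift)
    have "\<bar>G (f \<omega>) - G (?I \<omega>)\<bar> \<le> L * ?s"
    proof (rule lipschitz_functionalD[OF G cont[OF \<omega>] continuous_on_interp])
      fix t assume "t \<in> {0..T}"
      then show "dist (f \<omega> t) (?I \<omega> t) \<le> ?s"
        by (intro interp_dist_le[OF T] dist_grid_le_suminf_oscillation[OF T cont[OF \<omega>] _ _ _ True])
    qed
    then have "ennreal \<bar>G (f \<omega>) - G (?I \<omega>)\<bar> \<le> ennreal (L * ?s)" by (rule ennreal_leI)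
    also have "\<dots> = ennreal L * ennreal ?s"
      using L summ by (intro ennreal_mult suminf_nonneg) (auto simp: oscillation_nonneg)
    also have "ennreal ?s = (\<Sum>n. ennreal (oscillation T (n + k) (f \<omega>)))"
      using summ by (intro suminf_ennreal2[symmetric]) (auto simp: oscillation_nonneg)
    finally show ?thesis .
  next
    case False
    then have "\<not> summable (\<lambda>n. oscillation T (n + k) (f \<omega>))" by (subst summable_iff_shift)
    then have "(\<Sum>n. ennreal (oscillation T (n + k) (f \<omega>))) = top"
      using summable_suminf_not_top[of "\<lambda>n. oscillation T (n + k) (f \<omega>)", OF oscillation_nonneg] by blast
    then show ?thesis using L by (simp add: ennreal_mult_top)
  qed
  have "(\<integral>\<^sup>+\<omega>. ennreal \<bar>G (f \<omega>) - G (?I \<omega>)\<bar> \<partial>P)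
      \<le> (\<integral>\<^sup>+\<omega>. ennreal L * (\<Sum>n. ennreal (oscillation T (n + k) (f \<omega>))) \<partial>P)"
    by (rule nn_integral_mono) (rule pw)
  also have "\<dots> = ennreal L * (\<Sum>n. \<integral>\<^sup>+\<omega>. ennreal (oscillation T (n + k) (f \<omega>)) \<partial>P)"
    by (simp add: nn_integral_cmult nn_integral_suminf)
  also have "\<dots> \<le> ennreal L * (\<Sum>n. ennreal ((1 + C * T\<^sup>2) * osc_rate ^ (n + k)))"
    by (intro mult_left_mono suminf_le nn_integral_oscillation_le[OF P T C rv moment]) auto
  also have "(\<Sum>n. ennreal ((1 + C * T\<^sup>2) * osc_rate ^ (n + k)))
      = ennreal ((1 + C * T\<^sup>2) * (osc_rate ^ k / (1 - osc_rate)))"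
  proof -
    have "(\<lambda>n. osc_rate ^ n) sums (1 / (1 - osc_rate))"
      using osc_rate by (intro geometric_sums) auto
    from sums_mult[OF this, of "(1 + C * T\<^sup>2) * osc_rate ^ k"]
    have s: "(\<lambda>n. (1 + C * T\<^sup>2) * osc_rate ^ (n + k)) sums ((1 + C * T\<^sup>2) * (osc_rate ^ k / (1 - osc_rate)))"
      by (simp add: power_add mult_ac)
    show ?thesis
      using s C osc_rate(1)
      by (subst suminf_ennreal2) (auto simp: sums_iff)
  qed
  also have "ennreal L * \<dots> = ennreal ?K"
    using L C osc_rate by (simp add: ennreal_mult[symmetric])
  finally have le: "(\<integral>\<^sup>+\<omega>. ennreal \<bar>G (f \<omega>) - G (?I \<omega>)\<bar> \<partial>P) \<le> ennreal ?K" .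
  have "ennreal (\<integral>\<omega>. \<bar>G (f \<omega>) - G (?I \<omega>)\<bar> \<partial>P) = (\<integral>\<^sup>+\<omega>. ennreal \<bar>G (f \<omega>) - G (?I \<omega>)\<bar> \<partial>P)"
    using int by (intro nn_integral_eq_integral[symmetric]) auto
  from ord_eq_le_trans[OF this le] have le': "(\<integral>\<omega>. \<bar>G (f \<omega>) - G (?I \<omega>)\<bar> \<partial>P) \<le> ?K"
    by (subst (asm) ennreal_le_iff[OF K])
  have "\<bar>(\<integral>\<omega>. G (f \<omega>) \<partial>P) - (\<integral>\<omega>. G (?I \<omega>) \<partial>P)\<bar> = \<bar>\<integral>\<omega>. G (f \<omega>) - G (?I \<omega>) \<partial>P\<bar>"
    using int by simp
  also have "\<dots> \<le> (\<integral>\<omega>. \<bar>G (f \<omega>) - G (?I \<omega>)\<bar> \<partial>P)" by (rule integral_abs_bound)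
  also note le'
  finally show ?thesis .
qed

section \<open>Convergence of finite-dimensional distributions\<close>

text \<open>Real parts of trigonometric polynomials in the coordinates from \<open>D\<close>, with arbitrary real frequencies.
The product formula for cosines makes them an algebra.\<close>

inductive trig_sum :: "'i set \<Rightarrow> (('i \<Rightarrow> real) \<Rightarrow> real) \<Rightarrow> bool" for D where
  wave: "trig_sum D (\<lambda>x. c * cos ((\<Sum>d\<in>D. u d * x d) + \<theta>))"
| add: "trig_sum D f \<Longrightarrow> trig_sum D g \<Longrightarrow> trig_sum D (\<lambda>x. f x + g x)"

lemma trig_sum_mult:
  assumes "trig_sum D f" "trig_sum D g"
  shows "trig_sum D (\<lambda>x. f x * g x)"
  using assms
proof (induction rule: trig_sum.induct)
  case (wave c u \<theta>)
  from \<open>trig_sum D g\<close> show ?case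
  proof (induction rule: trig_sum.induct)
    case (wave c' u' \<theta>')
    have eq: "(\<lambda>x. c * cos ((\<Sum>d\<in>D. u d * x d) + \<theta>) * (c' * cos ((\<Sum>d\<in>D. u' d * x d) + \<theta>'))) =
      (\<lambda>x. c * c' / 2 * cos ((\<Sum>d\<in>D. (u d - u' d) * x d) + (\<theta> - \<theta>'))
         + c * c' / 2 * cos ((\<Sum>d\<in>D. (u d + u' d) * x d) + (\<theta> + \<theta>')))" (is "?l = ?r")
    proof
      fix x
      let ?w = "(\<Sum>d\<in>D. u d * x d) + \<theta>" and ?z = "(\<Sum>d\<in>D. u' d * x d) + \<theta>'"
      have "?l x = c * c' * (cos ?w * cos ?z)" by simp
      also have "\<dots> = c * c' / 2 * (cos (?w - ?z) + cos (?w + ?z))" by (simp add: cos_times_cos)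
      also have "?w - ?z = (\<Sum>d\<in>D. (u d - u' d) * x d) + (\<theta> - \<theta>')"
        by (simp add: left_diff_distrib sum_subtractf)
      also have "?w + ?z = (\<Sum>d\<in>D. (u d + u' d) * x d) + (\<theta> + \<theta>')"
        by (simp add: distrib_right sum.distrib)
      finally show "?l x = ?r x" by (simp add: algebra_simps)
    qed
    show ?case unfolding eq by (rule trig_sum.add[OF trig_sum.wave trig_sum.wave])
  next
    case (add f g)
    then show ?case using trig_sum.add by (simp add: distrib_left)
  qed
next
  case (add f1 f2)
  then show ?case using trig_sum.add by (simp add: distrib_right)
qed

text \<open>The map \<open>x \<mapsto> sin(x/R)\<close> takes all of Euclidean space into a compact cube. On the cube, the functions that
become trigonometric sums after composition with this map form an algebra; it contains the
coordinates, so it separates points and the Stone-Weierstrass theorem applies.\<close>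

lemma trig_sum_approximation:
  fixes g :: "('i::countable \<Rightarrow> real) \<Rightarrow> real"
  assumes D: "finite D" and R: "0 < R" and e: "0 < e"
    and g: "\<And>x y. \<bar>g x - g y\<bar> \<le> L * (\<Sum>d\<in>D. \<bar>x d - y d\<bar>)"
  obtains p where "trig_sum D p" "\<And>x. \<bar>g (\<lambda>d. R * sin (x d / R)) - p x\<bar> < e"
proof -
  \<comment> \<open>Coordinates outside \<open>D\<close> are frozen at 0, where the algebra could not separate points.\<close>
  define K :: "('i \<Rightarrow> real) set" where "K = PiE UNIV (\<lambda>d. if d \<in> D then {-1..1} else {0})"
  define s where "s x = (\<lambda>d. if d \<in> D then sin (x d / R) else 0)" for x :: "'i \<Rightarrow> real"
  define P where "P p \<longleftrightarrow> continuous_on K p \<and> trig_sum D (\<lambda>x. p (s x))" for p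
  have sK: "s x \<in> K" for x by (auto simp: s_def K_def PiE_iff)
  have "compactin (product_topology (\<lambda>i::'i. euclideanreal) UNIV) K"
    unfolding K_def by (subst compactin_PiE) auto
  then have cK: "compact K" by (simp add: euclidean_product_topology)
  have trig_const: "trig_sum D (\<lambda>x. c)" for c :: real
    using trig_sum.wave[of D c "\<lambda>_. 0" 0] by simp
  have trig_sin: "trig_sum D (\<lambda>x. sin (x d / R))" if "d \<in> D" for d
  proof -
    have "(\<Sum>d'\<in>D. (if d' = d then 1 / R else 0) * x d') = x d / R" for x :: "'i \<Rightarrow> real"
    proof -
      have "(\<Sum>d'\<in>D. (if d' = d then 1 / R else 0) * x d') = (\<Sum>d'\<in>D. if d' = d then x d / R else 0)"
        by (rule sum.cong) auto
      then show ?thesis using D that by simp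
    qed
    moreover have "sin y = 1 * cos (y + (- (pi / 2)))" for y :: real
      using cos_diff[of y "pi/2"] by simp
    ultimately show ?thesis
      using trig_sum.wave[of D 1 "\<lambda>d'. if d' = d then 1 / R else 0" "- (pi / 2)"] by simp
  qed
  have "\<exists>p. P p \<and> (\<forall>x\<in>K. \<bar>g (\<lambda>d. R * x d) - p x\<bar> < e)"
  proof (rule Stone_Weierstrass_HOL[OF cK])
    show "P (\<lambda>x. c)" for c by (simp add: P_def trig_const)
    show "continuous_on K f" if "P f" for f using that by (simp add: P_def)
    show "P (\<lambda>x. f x + h x)" if "P f \<and> P h" for f h
      using that by (auto simp: P_def intro!: continuous_intros trig_sum.add)
    show "P (\<lambda>x. f x * h x)" if "P f \<and> P h" for f h
      using that by (auto simp: P_def intro!: continuous_intros trig_sum_mult)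
    show "\<exists>f. P f \<and> f x \<noteq> f y" if xy: "x \<in> K \<and> y \<in> K \<and> x \<noteq> y" for x y
    proof -
      obtain d where d: "x d \<noteq> y d" using xy by (metis ext)
      have "d \<in> D"
      proof (rule ccontr)
        assume "d \<notin> D"
        then have "x d = 0" "y d = 0" using xy unfolding K_def PiE_iff by (auto split: if_splits)
        then show False using d by simp
      qed
      have "P (\<lambda>x. x d)"
        unfolding P_def
      proof
        show "continuous_on K (\<lambda>x. x d)" by (rule continuous_on_subset[of UNIV]) auto
        show "trig_sum D (\<lambda>x. s x d)" using trig_sin[OF \<open>d \<in> D\<close>] \<open>d \<in> D\<close> by (simp add: s_def)
      qed
      then show ?thesis using d by blast
    qed
    show "continuous_on K (\<lambda>x. g (\<lambda>d. R * x d))"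
    proof (rule continuous_on_finite_coordinates)
      fix x y :: "'i \<Rightarrow> real"
      have "\<bar>g (\<lambda>d. R * x d) - g (\<lambda>d. R * y d)\<bar> \<le> L * (\<Sum>d\<in>D. \<bar>R * x d - R * y d\<bar>)" by (rule g)
      also have "\<dots> = L * R * (\<Sum>d\<in>D. \<bar>x d - y d\<bar>)"
        using R by (simp add: right_diff_distrib[symmetric] abs_mult sum_distrib_left mult_ac)
      finally show "\<bar>g (\<lambda>d. R * x d) - g (\<lambda>d. R * y d)\<bar> \<le> L * R * (\<Sum>d\<in>D. dist (x d) (y d))"
        by (simp add: dist_real_def)
    qed
    show "0 < e" by (rule e)
  qed
  then obtain p where p: "P p" "\<And>x. x \<in> K \<Longrightarrow> \<bar>g (\<lambda>d. R * x d) - p x\<bar> < e" by blast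
  have "\<bar>g (\<lambda>d. R * sin (x d / R)) - p (s x)\<bar> < e" for x
  proof -
    have "\<bar>g (\<lambda>d. R * sin (x d / R)) - g (\<lambda>d. R * s x d)\<bar> \<le> L * (\<Sum>d\<in>D. \<bar>R * sin (x d / R) - R * s x d\<bar>)"
      by (rule g)
    also have "(\<Sum>d\<in>D. \<bar>R * sin (x d / R) - R * s x d\<bar>) = 0"
      by (rule sum.neutral) (auto simp: s_def)
    finally show ?thesis using p(2)[OF sK[of x]] by simp
  qed
  then show ?thesis using p(1) that unfolding P_def by blast
qed

lemma abs_diff_sin_le: "\<bar>x - R * sin (x / R)\<bar> \<le> x\<^sup>2 / R" if "0 < R" for x R :: real
proof -
  have "\<bar>sin y - y\<bar> \<le> y\<^sup>2" for y :: real
  proof -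
    have "2 * \<bar>sin y - y\<bar> \<le> y\<^sup>2"
      using Maclaurin_sin_bound[of y 2] by (simp add: eval_nat_numeral sin_coeff_def)
    moreover have "\<bar>sin y - y\<bar> \<le> 2 * \<bar>sin y - y\<bar>" by simp
    ultimately show ?thesis by (rule order_trans[rotated])
  qed
  from this[of "x / R"] have "R * \<bar>sin (x / R) - x / R\<bar> \<le> R * (x / R)\<^sup>2"
    using that by (intro mult_left_mono) auto
  moreover have "R * \<bar>sin (x / R) - x / R\<bar> = \<bar>x - R * sin (x / R)\<bar>"
    using that by (simp add: abs_mult[symmetric] abs_minus_commute abs_mult_pos' right_diff_distrib)
  ultimately show ?thesis using that by (simp add: power2_eq_square)
qed

text \<open>Since \<open>|x - R sin(x/R)| \<le> x\<^sup>2/R\<close> everywhere, second moments bound the cost of the cutoff.\<close>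

lemma expectation_sin_cutoff_le:
  fixes g :: "('i::countable \<Rightarrow> real) \<Rightarrow> real" and X :: "'a \<Rightarrow> 'i \<Rightarrow> real"
  assumes P: "prob_space P" and D: "finite D" and R: "0 < R" and L: "0 \<le> L"
    and g: "\<And>x y. \<bar>g x - g y\<bar> \<le> L * (\<Sum>d\<in>D. \<bar>x d - y d\<bar>)"
    and p: "\<And>x. \<bar>g (\<lambda>d. R * sin (x d / R)) - p x\<bar> < e"
    and intg: "integrable P (\<lambda>\<omega>. g (X \<omega>))" and intp: "integrable P (\<lambda>\<omega>. p (X \<omega>))"
    and sq: "\<And>d. d \<in> D \<Longrightarrow> integrable P (\<lambda>\<omega>. (X \<omega> d)\<^sup>2)" "\<And>d. d \<in> D \<Longrightarrow> (\<integral>\<omega>. (X \<omega> d)\<^sup>2 \<partial>P) \<le> V"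
  shows "\<bar>(\<integral>\<omega>. g (X \<omega>) \<partial>P) - (\<integral>\<omega>. p (X \<omega>) \<partial>P)\<bar> \<le> L * real (card D) * V / R + e"
proof -
  interpret prob_space P by (rule P)
  have pw: "\<bar>g x - p x\<bar> \<le> L / R * (\<Sum>d\<in>D. (x d)\<^sup>2) + e" for x
  proof -
    have "\<bar>g x - g (\<lambda>d. R * sin (x d / R))\<bar> \<le> L * (\<Sum>d\<in>D. \<bar>x d - R * sin (x d / R)\<bar>)" by (rule g)
    also have "\<dots> \<le> L * (\<Sum>d\<in>D. (x d)\<^sup>2 / R)"
      by (intro mult_left_mono sum_mono abs_diff_sin_le R L)
    also have "\<dots> = L / R * (\<Sum>d\<in>D. (x d)\<^sup>2)" by (simp add: sum_divide_distrib[symmetric])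
    finally show ?thesis using p[of x] by linarith
  qed
  have "\<bar>(\<integral>\<omega>. g (X \<omega>) \<partial>P) - (\<integral>\<omega>. p (X \<omega>) \<partial>P)\<bar> = \<bar>\<integral>\<omega>. g (X \<omega>) - p (X \<omega>) \<partial>P\<bar>"
    using intg intp by simp
  also have "\<dots> \<le> (\<integral>\<omega>. \<bar>g (X \<omega>) - p (X \<omega>)\<bar> \<partial>P)" by (rule integral_abs_bound)
  also have "\<dots> \<le> (\<integral>\<omega>. L / R * (\<Sum>d\<in>D. (X \<omega> d)\<^sup>2) + e \<partial>P)"
    using intg intp sq pw by (intro integral_mono) auto
  also have "\<dots> = L / R * (\<Sum>d\<in>D. \<integral>\<omega>. (X \<omega> d)\<^sup>2 \<partial>P) + e"
    using sq by (simp add: prob_space)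
  also have "\<dots> \<le> L / R * (\<Sum>d\<in>D. V) + e"
    using L R sq by (intro add_right_mono mult_left_mono sum_mono) auto
  finally show ?thesis by simp
qed

lemma lipschitz_expectation_tendsto:
  fixes g :: "('i::countable \<Rightarrow> real) \<Rightarrow> real" and X :: "nat \<Rightarrow> 'a \<Rightarrow> 'i \<Rightarrow> real" and Y :: "'b \<Rightarrow> 'i \<Rightarrow> real"
  assumes P: "\<And>n. prob_space (P n)" and Q: "prob_space Q" and D: "finite D" and L: "0 \<le> L"
    and g: "\<And>x y. \<bar>g x - g y\<bar> \<le> L * (\<Sum>d\<in>D. \<bar>x d - y d\<bar>)"
    and intg: "\<And>n. integrable (P n) (\<lambda>\<omega>. g (X n \<omega>))" "integrable Q (\<lambda>\<omega>. g (Y \<omega>))"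
    and rv: "\<And>n d. d \<in> D \<Longrightarrow> (\<lambda>\<omega>. X n \<omega> d) \<in> borel_measurable (P n)"
            "\<And>d. d \<in> D \<Longrightarrow> (\<lambda>\<omega>. Y \<omega> d) \<in> borel_measurable Q"
    and sqX: "\<And>n d. d \<in> D \<Longrightarrow> integrable (P n) (\<lambda>\<omega>. (X n \<omega> d)\<^sup>2)"
             "\<And>n d. d \<in> D \<Longrightarrow> (\<integral>\<omega>. (X n \<omega> d)\<^sup>2 \<partial>P n) \<le> V"
    and sqY: "\<And>d. d \<in> D \<Longrightarrow> integrable Q (\<lambda>\<omega>. (Y \<omega> d)\<^sup>2)"
             "\<And>d. d \<in> D \<Longrightarrow> (\<integral>\<omega>. (Y \<omega> d)\<^sup>2 \<partial>Q) \<le> V"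
    and wave_lim: "\<And>u \<theta>. (\<lambda>n. \<integral>\<omega>. cos ((\<Sum>d\<in>D. u d * X n \<omega> d) + \<theta>) \<partial>P n)
                 \<longlonglongrightarrow> (\<integral>\<omega>. cos ((\<Sum>d\<in>D. u d * Y \<omega> d) + \<theta>) \<partial>Q)"
  shows "(\<lambda>n. \<integral>\<omega>. g (X n \<omega>) \<partial>P n) \<longlonglongrightarrow> (\<integral>\<omega>. g (Y \<omega>) \<partial>Q)"
proof -
  have trig: "(\<lambda>n. \<integral>\<omega>. p (X n \<omega>) \<partial>P n) \<longlonglongrightarrow> (\<integral>\<omega>. p (Y \<omega>) \<partial>Q) \<and>
     (\<forall>n. integrable (P n) (\<lambda>\<omega>. p (X n \<omega>))) \<and> integrable Q (\<lambda>\<omega>. p (Y \<omega>))"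
    if "trig_sum D p" for p
    using that
  proof (induction rule: trig_sum.induct)
    case (wave c u \<theta>)
    have [measurable]: "(\<lambda>\<omega>. \<Sum>d\<in>D. u d * X n \<omega> d) \<in> borel_measurable (P n)" for n
      using rv(1) by (intro borel_measurable_sum borel_measurable_times) auto
    have [measurable]: "(\<lambda>\<omega>. \<Sum>d\<in>D. u d * Y \<omega> d) \<in> borel_measurable Q"
      using rv(2) by (intro borel_measurable_sum borel_measurable_times) auto
    have fin: "finite_measure (P n)" "finite_measure Q" for n
      using P Q by (simp_all add: prob_space_def)
    have 1: "integrable (P n) (\<lambda>\<omega>. cos ((\<Sum>d\<in>D. u d * X n \<omega> d) + \<theta>))" for n
      by (intro finite_measure.integrable_const_bound[OF fin(1), where B=1]) auto
    have 2: "integrable Q (\<lambda>\<omega>. cos ((\<Sum>d\<in>D. u d * Y \<omega> d) + \<theta>))"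
      by (intro finite_measure.integrable_const_bound[OF fin(2), where B=1]) auto
    show ?case using 1 2 wave_lim[of u \<theta>] by (auto intro!: tendsto_intros)
  next
    case (add f h)
    then show ?case by (auto intro!: tendsto_add)
  qed
  show ?thesis
  proof (rule LIMSEQ_I)
    fix e :: real assume e: "0 < e"
    \<comment> \<open>Chosen so that the cutoff error \<open>L card D V / R\<close> is at most \<open>e/4\<close>, whatever the sign of \<open>V\<close>.\<close>
    define R where "R = 4 * (L * real (card D) * \<bar>V\<bar> + 1) / e"
    have R: "0 < R" using e L by (auto simp: R_def intro!: divide_pos_pos mult_pos_pos add_nonneg_pos)
    have VR: "L * real (card D) * V / R \<le> e / 4"
    proof -
      have "L * real (card D) * V \<le> L * real (card D) * \<bar>V\<bar> + 1"
        using mult_left_mono[of V "\<bar>V\<bar>" "L * real (card D)"] L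
        by (metis abs_ge_self add_increasing2 mult_nonneg_nonneg of_nat_0_le_iff zero_le_one)
      also have "\<dots> = R * (e / 4)" using e by (simp add: R_def)
      finally show ?thesis using R by (simp add: divide_le_eq mult.commute)
    qed
    obtain p where p: "trig_sum D p" "\<And>x. \<bar>g (\<lambda>d. R * sin (x d / R)) - p x\<bar> < e / 8"
      using trig_sum_approximation[OF D R _ g, of "e / 8"] e by auto
    note t = trig[OF p(1)]
    have X: "\<bar>(\<integral>\<omega>. g (X n \<omega>) \<partial>P n) - (\<integral>\<omega>. p (X n \<omega>) \<partial>P n)\<bar> \<le> e / 4 + e / 8" for n
      by (rule order_trans[OF expectation_sin_cutoff_le[OF P[of n] D R L g p(2), where X="X n" and V=V] add_right_mono[OF VR]])
         (use intg t sqX in auto)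
    have Y: "\<bar>(\<integral>\<omega>. g (Y \<omega>) \<partial>Q) - (\<integral>\<omega>. p (Y \<omega>) \<partial>Q)\<bar> \<le> e / 4 + e / 8"
      by (rule order_trans[OF expectation_sin_cutoff_le[OF Q D R L g p(2), where X=Y and V=V] add_right_mono[OF VR]])
         (use intg t sqY in auto)
    obtain n0 where n0: "\<And>n. n \<ge> n0 \<Longrightarrow> norm ((\<integral>\<omega>. p (X n \<omega>) \<partial>P n) - (\<integral>\<omega>. p (Y \<omega>) \<partial>Q)) < e / 8"
      using LIMSEQ_D[OF conjunct1[OF t], of "e / 8"] e by auto
    show "\<exists>n0. \<forall>n\<ge>n0. norm ((\<integral>\<omega>. g (X n \<omega>) \<partial>P n) - (\<integral>\<omega>. g (Y \<omega>) \<partial>Q)) < e"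
    proof (intro exI allI impI)
      fix n assume "n0 \<le> n"
      from n0[OF this] X[of n] Y show "norm ((\<integral>\<omega>. g (X n \<omega>) \<partial>P n) - (\<integral>\<omega>. g (Y \<omega>) \<partial>Q)) < e"
        unfolding real_norm_def by linarith
    qed
  qed
qed

section \<open>A criterion for convergence in distribution of continuous processes\<close>

lemma integrable_bound_of_nn_integral:
  fixes f :: "'a \<Rightarrow> real"
  assumes "f \<in> borel_measurable P" "\<And>x. 0 \<le> f x" "(\<integral>\<^sup>+x. ennreal (f x) \<partial>P) \<le> ennreal c" "0 \<le> c"
  shows "integrable P f" "(\<integral>x. f x \<partial>P) \<le> c"
proof -
  show int: "integrable P f"
    by (rule integrableI_nonneg) (use assms le_less_trans[OF assms(3)] in auto)
  have "ennreal (\<integral>x. f x \<partial>P) = (\<integral>\<^sup>+x. ennreal (f x) \<partial>P)"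
    using assms(2) int by (intro nn_integral_eq_integral[symmetric]) auto
  from ord_eq_le_trans[OF this assms(3)] show "(\<integral>x. f x \<partial>P) \<le> c"
    by (subst (asm) ennreal_le_iff[OF assms(4)])
qed

lemma square_le_one_plus_fourth_power: "(x::real)\<^sup>2 \<le> 1 + x ^ 4"
proof -
  have "0 \<le> (x\<^sup>2 - 1)\<^sup>2 + x\<^sup>2 + x ^ 4" by simp
  also have "\<dots> = 2 * x ^ 4 - x\<^sup>2 + 1" by (simp add: power2_eq_square algebra_simps eval_nat_numeral)
  finally have "x\<^sup>2 \<le> 1 + 2 * x ^ 4" by linarith
  moreover have "x\<^sup>2 * 2 \<le> 1 + (x\<^sup>2)\<^sup>2"
    using zero_le_power2[of "x\<^sup>2 - 1"] by (simp add: power2_eq_square algebra_simps)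
  ultimately show ?thesis by (simp add: power_mult[symmetric])
qed

lemma coordinate_second_moment:
  fixes f :: "'a \<Rightarrow> real \<Rightarrow> 'v::euclidean_space"
  assumes P: "prob_space P" and T: "0 < T" and C: "0 \<le> C"
    and rv: "\<And>t. 0 \<le> t \<Longrightarrow> (\<lambda>\<omega>. f \<omega> t) \<in> borel_measurable P"
    and start: "\<And>\<omega>. \<omega> \<in> space P \<Longrightarrow> f \<omega> 0 = 0"
    and moment: "\<And>s t. s \<in> {0..T} \<Longrightarrow> t \<in> {0..T} \<Longrightarrow>
        (\<integral>\<^sup>+\<omega>. ennreal (dist (f \<omega> t) (f \<omega> s) ^ 4) \<partial>P) \<le> ennreal (C * (t - s)\<^sup>2)"
    and t: "t \<in> {0..T}" and b: "b \<in> Basis"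
  shows "integrable P (\<lambda>\<omega>. (f \<omega> t \<bullet> b)\<^sup>2)" "(\<integral>\<omega>. (f \<omega> t \<bullet> b)\<^sup>2 \<partial>P) \<le> 1 + C * T\<^sup>2"
proof -
  interpret prob_space P by (rule P)
  have [measurable]: "(\<lambda>\<omega>. f \<omega> t) \<in> borel_measurable P" using t by (intro rv) auto
  have "(\<integral>\<^sup>+\<omega>. ennreal ((f \<omega> t \<bullet> b)\<^sup>2) \<partial>P) \<le> (\<integral>\<^sup>+\<omega>. 1 + ennreal (dist (f \<omega> t) (f \<omega> 0) ^ 4) \<partial>P)"
  proof (rule nn_integral_mono)
    fix \<omega> assume \<omega>: "\<omega> \<in> space P"
    have "(f \<omega> t \<bullet> b)\<^sup>2 \<le> (norm (f \<omega> t))\<^sup>2"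
      using Basis_le_norm[OF b, of "f \<omega> t"] by (simp add: abs_le_square_iff[symmetric])
    also have "\<dots> \<le> 1 + dist (f \<omega> t) (f \<omega> 0) ^ 4"
      using square_le_one_plus_fourth_power start[OF \<omega>] by simp
    finally have "ennreal ((f \<omega> t \<bullet> b)\<^sup>2) \<le> ennreal (1 + dist (f \<omega> t) (f \<omega> 0) ^ 4)" by (rule ennreal_leI)
    then show "ennreal ((f \<omega> t \<bullet> b)\<^sup>2) \<le> 1 + ennreal (dist (f \<omega> t) (f \<omega> 0) ^ 4)" by simp
  qed
  also have "\<dots> = 1 + (\<integral>\<^sup>+\<omega>. ennreal (dist (f \<omega> t) (f \<omega> 0) ^ 4) \<partial>P)"
    using rv[of 0] by (subst nn_integral_add) (auto simp: emeasure_space_1)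
  also have "\<dots> \<le> 1 + ennreal (C * (t - 0)\<^sup>2)"
    using moment[of 0 t] t T by (intro add_left_mono) auto
  also have "\<dots> \<le> 1 + ennreal (C * T\<^sup>2)"
    using t C by (intro add_left_mono ennreal_leI mult_left_mono power_mono) auto
  also have "\<dots> = ennreal (1 + C * T\<^sup>2)" using C by simp
  finally have *: "(\<integral>\<^sup>+\<omega>. ennreal ((f \<omega> t \<bullet> b)\<^sup>2) \<partial>P) \<le> ennreal (1 + C * T\<^sup>2)" .
  show "integrable P (\<lambda>\<omega>. (f \<omega> t \<bullet> b)\<^sup>2)" "(\<integral>\<omega>. (f \<omega> t \<bullet> b)\<^sup>2 \<partial>P) \<le> 1 + C * T\<^sup>2"
    using integrable_bound_of_nn_integral[OF _ _ *] C by auto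
qed

context
  fixes Z :: "nat \<Rightarrow> 'a \<Rightarrow> real \<Rightarrow> 'v::euclidean_space" and W :: "'b \<Rightarrow> real \<Rightarrow> 'v"
    and P :: "nat \<Rightarrow> 'a measure" and Q :: "'b measure" and T C L B :: real
    and G :: "(real \<Rightarrow> 'v) \<Rightarrow> real"
  assumes P: "\<And>n. prob_space (P n)" and Q: "prob_space Q" and T: "0 < T" and C: "0 \<le> C" and L: "0 < L"
    and rv: "\<And>n t. 0 \<le> t \<Longrightarrow> (\<lambda>\<omega>. Z n \<omega> t) \<in> borel_measurable (P n)"
            "\<And>t. 0 \<le> t \<Longrightarrow> (\<lambda>\<omega>. W \<omega> t) \<in> borel_measurable Q"
    and start: "\<And>n \<omega>. \<omega> \<in> space (P n) \<Longrightarrow> Z n \<omega> 0 = 0" "\<And>\<omega>. \<omega> \<in> space Q \<Longrightarrow> W \<omega> 0 = 0"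
    and moment: "\<And>n s t. s \<in> {0..T} \<Longrightarrow> t \<in> {0..T} \<Longrightarrow>
          (\<integral>\<^sup>+\<omega>. ennreal (dist (Z n \<omega> t) (Z n \<omega> s) ^ 4) \<partial>P n) \<le> ennreal (C * (t - s)\<^sup>2)"
        "\<And>s t. s \<in> {0..T} \<Longrightarrow> t \<in> {0..T} \<Longrightarrow>
          (\<integral>\<^sup>+\<omega>. ennreal (dist (W \<omega> t) (W \<omega> s) ^ 4) \<partial>Q) \<le> ennreal (C * (t - s)\<^sup>2)"
    and wave_lim: "\<And>h m U \<theta>. 0 < h \<Longrightarrow>
          (\<lambda>n. \<integral>\<omega>. cos ((\<Sum>k\<le>m. U k \<bullet> Z n \<omega> (real k * h)) + \<theta>) \<partial>P n)
            \<longlonglongrightarrow> (\<integral>\<omega>. cos ((\<Sum>k\<le>m. U k \<bullet> W \<omega> (real k * h)) + \<theta>) \<partial>Q)"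
    and G: "lipschitz_functional T L G" and bdd: "\<And>f. \<bar>G f\<bar> \<le> B"
begin

text \<open>The coordinates are the inner products of the nodal values with an enumerated orthonormal basis, so
that the index type is countable; a linear form in them is a linear form \<open>\<Sum>\<^sub>k U\<^sub>k \<bullet> Z(k h)\<close> in the nodal
values.\<close>

lemma interpolated_functional_tendsto:
  shows "(\<lambda>n. \<integral>\<omega>. G (interp T k (\<lambda>i. Z n \<omega> (grid T k i))) \<partial>P n)
           \<longlonglongrightarrow> (\<integral>\<omega>. G (interp T k (\<lambda>i. W \<omega> (grid T k i))) \<partial>Q)"
proof -
  obtain e :: "nat \<Rightarrow> 'v" where e: "bij_betw e {0..<card (Basis::'v set)} Basis"
    using ex_bij_betw_nat_finite[OF finite_Basis] by blast
  let ?B = "{0..<card (Basis::'v set)}"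
  have eB: "e b \<in> Basis" if "b \<in> ?B" for b using bij_betwE[OF e] that by blast
  define D where "D = {..2 ^ k :: nat} \<times> ?B"
  have finD: "finite D" by (simp add: D_def)
  define vec where "vec y = (\<lambda>i. \<Sum>b\<in>?B. y (i, b) *\<^sub>R e b)" for y :: "nat \<times> nat \<Rightarrow> real"
  define g where "g y = G (interp T k (vec y))" for y
  define X where "X = (\<lambda>(z :: real \<Rightarrow> 'v) d. z (grid T k (fst d)) \<bullet> e (snd d))"
  have vecX: "vec (X z) = (\<lambda>i. z (grid T k i))" for z
  proof
    fix i
    have "vec (X z) i = (\<Sum>b\<in>Basis. (z (grid T k i) \<bullet> b) *\<^sub>R b)"
      unfolding vec_def X_def using sum.reindex_bij_betw[OF e, of "\<lambda>b. (z (grid T k i) \<bullet> b) *\<^sub>R b"] by simp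
    then show "vec (X z) i = z (grid T k i)" by (simp add: euclidean_representation)
  qed
  then have gX: "g (X z) = G (interp T k (\<lambda>i. z (grid T k i)))" for z by (simp add: g_def)
  have g_lip: "\<bar>g x - g y\<bar> \<le> L * (\<Sum>d\<in>D. \<bar>x d - y d\<bar>)" for x y
  proof -
    have "\<bar>g x - g y\<bar> \<le> L * (\<Sum>i\<le>2^k. dist (vec x i) (vec y i))"
      unfolding g_def
      by (rule lipschitz_functionalD[OF G continuous_on_interp continuous_on_interp]) (rule dist_interp_le)
    also have "\<dots> \<le> L * (\<Sum>i\<le>2^k. \<Sum>b\<in>?B. \<bar>x (i, b) - y (i, b)\<bar>)"
    proof (intro mult_left_mono sum_mono)
      fix i
      have "dist (vec x i) (vec y i) = norm (\<Sum>b\<in>?B. (x (i, b) - y (i, b)) *\<^sub>R e b)"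
        by (simp add: vec_def dist_norm scaleR_left_diff_distrib sum_subtractf)
      also have "\<dots> \<le> (\<Sum>b\<in>?B. \<bar>x (i, b) - y (i, b)\<bar>)"
        by (rule sum_norm_le) (use eB in simp)
      finally show "dist (vec x i) (vec y i) \<le> (\<Sum>b\<in>?B. \<bar>x (i, b) - y (i, b)\<bar>)" .
    qed (use L in simp)
    also have "\<dots> = L * (\<Sum>d\<in>D. \<bar>x d - y d\<bar>)"
      by (simp add: D_def sum.cartesian_product case_prod_unfold)
    finally show ?thesis .
  qed
  have grid0: "0 \<le> grid T k i" for i using T by (simp add: grid_def)
  have wave: "(\<Sum>d\<in>D. u d * X z d) = (\<Sum>i\<le>2^k. vec u i \<bullet> z (real i * (T / 2^k)))" for u z
  proof -
    have "(\<Sum>d\<in>D. u d * X z d) = (\<Sum>i\<le>2^k. \<Sum>b\<in>?B. u (i, b) * X z (i, b))"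
      by (simp add: D_def sum.cartesian_product case_prod_unfold)
    also have "\<dots> = (\<Sum>i\<le>2^k. vec u i \<bullet> z (grid T k i))"
      by (simp add: vec_def X_def inner_sum_left inner_commute[of "z _"])
    finally show ?thesis by (simp add: grid_def mult.commute)
  qed
  have fin: "finite_measure (P n)" "finite_measure Q" for n
    using P Q by (simp_all add: prob_space_def)
  have "(\<lambda>n. \<integral>\<omega>. g (X (Z n \<omega>)) \<partial>P n) \<longlonglongrightarrow> (\<integral>\<omega>. g (X (W \<omega>)) \<partial>Q)"
  proof (rule lipschitz_expectation_tendsto[where D=D and L=L and V="1 + C * T\<^sup>2", OF P Q finD _ g_lip])
    show "0 \<le> L" using L by simp
    show "integrable (P n) (\<lambda>\<omega>. g (X (Z n \<omega>)))" for n
      unfolding gX using lipschitz_functional_interp_measurable[OF T G rv(1)] bdd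
      by (intro finite_measure.integrable_const_bound[OF fin(1), where B=B]) auto
    show "integrable Q (\<lambda>\<omega>. g (X (W \<omega>)))"
      unfolding gX using lipschitz_functional_interp_measurable[OF T G rv(2)] bdd
      by (intro finite_measure.integrable_const_bound[OF fin(2), where B=B]) auto
    show "(\<lambda>\<omega>. X (Z n \<omega>) d) \<in> borel_measurable (P n)" for n d
      unfolding X_def using rv(1)[OF grid0] by measurable
    show "(\<lambda>\<omega>. X (W \<omega>) d) \<in> borel_measurable Q" for d
      unfolding X_def using rv(2)[OF grid0] by measurable
    fix d assume "d \<in> D"
    then have d: "grid T k (fst d) \<in> {0..T}" "e (snd d) \<in> Basis"
      using grid_in[OF T] eB by (auto simp: D_def)
    show "integrable (P n) (\<lambda>\<omega>. (X (Z n \<omega>) d)\<^sup>2)" "(\<integral>\<omega>. (X (Z n \<omega>) d)\<^sup>2 \<partial>P n) \<le> 1 + C * T\<^sup>2" for n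
      unfolding X_def by (rule coordinate_second_moment[OF P T C rv(1) start(1) moment(1) d]; assumption)+
    show "integrable Q (\<lambda>\<omega>. (X (W \<omega>) d)\<^sup>2)" "(\<integral>\<omega>. (X (W \<omega>) d)\<^sup>2 \<partial>Q) \<le> 1 + C * T\<^sup>2"
      unfolding X_def by (rule coordinate_second_moment[OF Q T C rv(2) start(2) moment(2) d]; assumption)+
  next
    fix u \<theta>
    show "(\<lambda>n. \<integral>\<omega>. cos ((\<Sum>d\<in>D. u d * X (Z n \<omega>) d) + \<theta>) \<partial>P n)
        \<longlonglongrightarrow> (\<integral>\<omega>. cos ((\<Sum>d\<in>D. u d * X (W \<omega>) d) + \<theta>) \<partial>Q)"
      unfolding wave by (rule wave_lim) (use T in simp)
  qed
  then show ?thesis by (simp add: gX)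
qed

text \<open>The interpolation error is small uniformly in \<open>n\<close>, so the level \<open>k\<close> of the grid can be fixed before \<open>n\<close>
tends to infinity.\<close>

lemma lipschitz_functional_expectation_tendsto:
  assumes cont: "\<And>n \<omega>. \<omega> \<in> space (P n) \<Longrightarrow> continuous_on {0..T} (Z n \<omega>)"
              "\<And>\<omega>. \<omega> \<in> space Q \<Longrightarrow> continuous_on {0..T} (W \<omega>)"
  shows "(\<lambda>n. \<integral>\<omega>. G (Z n \<omega>) \<partial>P n) \<longlonglongrightarrow> (\<integral>\<omega>. G (W \<omega>) \<partial>Q)"
proof (rule LIMSEQ_I)
  fix \<epsilon> :: real assume \<epsilon>: "0 < \<epsilon>"
  let ?K = "\<lambda>k. L * ((1 + C * T\<^sup>2) * (osc_rate ^ k / (1 - osc_rate)))"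
  have "?K \<longlonglongrightarrow> L * ((1 + C * T\<^sup>2) * (0 / (1 - osc_rate)))"
    using osc_rate by (intro tendsto_intros LIMSEQ_power_zero) auto
  then have "\<forall>\<^sub>F k in sequentially. ?K k < \<epsilon> / 3"
    using \<epsilon> by (intro order_tendstoD(2)) auto
  then obtain k where k: "?K k < \<epsilon> / 3" by (auto simp: eventually_sequentially)
  let ?z = "\<lambda>n. \<integral>\<omega>. G (interp T k (\<lambda>i. Z n \<omega> (grid T k i))) \<partial>P n"
  let ?w = "\<integral>\<omega>. G (interp T k (\<lambda>i. W \<omega> (grid T k i))) \<partial>Q"
  have 1: "\<bar>(\<integral>\<omega>. G (Z n \<omega>) \<partial>P n) - ?z n\<bar> \<le> ?K k" for n
    by (rule expectation_interp_error_le[OF P T C L rv(1) cont(1) moment(1) G bdd])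
  have 2: "\<bar>(\<integral>\<omega>. G (W \<omega>) \<partial>Q) - ?w\<bar> \<le> ?K k"
    by (rule expectation_interp_error_le[OF Q T C L rv(2) cont(2) moment(2) G bdd])
  have "?z \<longlonglongrightarrow> ?w"
    by (rule interpolated_functional_tendsto)
  from LIMSEQ_D[OF this, of "\<epsilon> / 3"] \<epsilon>
  obtain n0 where n0: "\<And>n. n \<ge> n0 \<Longrightarrow> norm (?z n - ?w) < \<epsilon> / 3" by auto
  show "\<exists>n0. \<forall>n\<ge>n0. norm ((\<integral>\<omega>. G (Z n \<omega>) \<partial>P n) - (\<integral>\<omega>. G (W \<omega>) \<partial>Q)) < \<epsilon>"
  proof (intro exI allI impI)
    fix n assume "n0 \<le> n"
    from n0[OF this] 1[of n] 2 k
    show "norm ((\<integral>\<omega>. G (Z n \<omega>) \<partial>P n) - (\<integral>\<omega>. G (W \<omega>) \<partial>Q)) < \<epsilon>"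
      unfolding real_norm_def by linarith
  qed
qed

end

text \<open>Lower semicontinuity for the topology of compact convergence; on the half-line the sets \<open>[0,m]\<close> suffice
as compact sets.\<close>

definition lower_semicontinuous_paths :: "'v::metric_space set \<Rightarrow> ((real \<Rightarrow> 'v) \<Rightarrow> real) \<Rightarrow> bool" where
  "lower_semicontinuous_paths H F \<longleftrightarrow> (\<forall>f\<in>continuous_maps {0..} H. \<forall>\<epsilon>>0. \<exists>m \<delta>. 0 < \<delta> \<and>
     (\<forall>g\<in>continuous_maps {0..} H. (\<forall>t\<in>{0..real (m::nat)}. dist (f t) (g t) < \<delta>) \<longrightarrow> F f - \<epsilon> \<le> F g))"

lemma openin_compact_convergence_halfline:
  assumes U: "openin (compact_convergence_topology {0::real..} H) U" and f: "f \<in> U"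
  shows "\<exists>m \<delta>. 0 < \<delta> \<and> (\<forall>g\<in>continuous_maps {0..} H.
           (\<forall>t\<in>{0..real (m::nat)}. dist (f t) (g t) < \<delta>) \<longrightarrow> g \<in> U)"
proof -
  obtain K e where K: "compact K" "K \<subseteq> {0..}" "0 < e" "compact_nbhd {0..} H f K e \<subseteq> U"
    using U f unfolding openin_compact_convergence_topology by meson
  obtain a where a: "\<And>x. x \<in> K \<Longrightarrow> norm x \<le> a"
    using compact_imp_bounded[OF K(1)] unfolding bounded_iff by blast
  obtain m :: nat where "a \<le> real m" using real_arch_simple by blast
  then have sub: "K \<subseteq> {0..real m}" using a K(2) by fastforce
  show ?thesis
  proof (intro exI[of _ m] exI[of _ e] conjI ballI impI)
    fix g assume "g \<in> continuous_maps {0..} H" "\<forall>t\<in>{0..real m}. dist (f t) (g t) < e"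
    then have "g \<in> compact_nbhd {0..} H f K e" using sub by (auto simp: compact_nbhd_def)
    then show "g \<in> U" using K(4) by blast
  qed (rule K(3))
qed

lemma lower_semicontinuous_indicator:
  assumes "openin (compact_convergence_topology {0::real..} H) U"
  shows "lower_semicontinuous_paths H (indicator U)"
  unfolding lower_semicontinuous_paths_def
proof (intro ballI allI impI)
  fix f and \<epsilon> :: real assume \<epsilon>: "0 < \<epsilon>"
  show "\<exists>m \<delta>. 0 < \<delta> \<and> (\<forall>g\<in>continuous_maps {0..} H.
     (\<forall>t\<in>{0..real (m::nat)}. dist (f t) (g t) < \<delta>) \<longrightarrow> indicator U f - \<epsilon> \<le> (indicator U g :: real))"
  proof (cases "f \<in> U")
    case True
    from openin_compact_convergence_halfline[OF assms True] obtain m \<delta> where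
      "0 < \<delta>" "\<And>g. g \<in> continuous_maps {0..} H \<Longrightarrow> (\<forall>t\<in>{0..real (m::nat)}. dist (f t) (g t) < \<delta>) \<Longrightarrow> g \<in> U"
      by blast
    then show ?thesis using True \<epsilon> by (intro exI[of _ m] exI[of _ \<delta>]) auto
  next
    case False
    then show ?thesis using \<epsilon> by (intro exI[of _ 0] exI[of _ 1]) (auto simp: indicator_def)
  qed
qed

lemma lower_semicontinuous_continuous_map:
  assumes F: "continuous_map (compact_convergence_topology {0::real..} H) euclideanreal F"
  shows "lower_semicontinuous_paths H F"
  unfolding lower_semicontinuous_paths_def
proof (intro ballI allI impI)
  fix f :: "real \<Rightarrow> _" and \<epsilon> :: real assume f: "f \<in> continuous_maps {0..} H" and \<epsilon>: "0 < \<epsilon>"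
  let ?T = "compact_convergence_topology {0::real..} H"
  have "openin ?T {g \<in> topspace ?T. F g \<in> {F f - \<epsilon><..}}"
    using F by (rule openin_continuous_map_preimage) simp
  moreover have "f \<in> {g \<in> topspace ?T. F g \<in> {F f - \<epsilon><..}}"
    using f \<epsilon> by (simp add: topspace_compact_convergence_topology)
  ultimately obtain m \<delta> where "0 < \<delta>" "\<And>g. g \<in> continuous_maps {0..} H \<Longrightarrow>
     (\<forall>t\<in>{0..real (m::nat)}. dist (f t) (g t) < \<delta>) \<Longrightarrow> F f - \<epsilon> < F g"
    using openin_compact_convergence_halfline by (metis (mono_tags, lifting) greaterThan_iff mem_Collect_eq)
  then show "\<exists>m \<delta>. 0 < \<delta> \<and> (\<forall>g\<in>continuous_maps {0..} H.
     (\<forall>t\<in>{0..real (m::nat)}. dist (f t) (g t) < \<delta>) \<longrightarrow> F f - \<epsilon> \<le> F g)"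
    by (intro exI[of _ m] exI[of _ \<delta>]) (auto intro: less_imp_le)
qed

lemma continuous_maps_restrict:
  "f \<in> continuous_maps {0..} H \<Longrightarrow> continuous_on {0..T} f" for T :: real
  unfolding continuous_maps_def by (auto intro: continuous_on_subset)

context
  fixes H :: "'v::euclidean_space set" and F :: "(real \<Rightarrow> 'v) \<Rightarrow> real" and B :: real
  assumes B: "\<And>g. g \<in> continuous_maps {0..} H \<Longrightarrow> \<bar>F g\<bar> \<le> B"
    and lsc: "lower_semicontinuous_paths H F" and B0: "0 \<le> B"
begin

lemma lsc_envelope_tendsto:
  assumes "f \<in> continuous_maps {0..} H"
  shows "(\<lambda>n. lower_envelope H B F (Suc n) f) \<longlonglongrightarrow> F f"
proof (rule LIMSEQ_Suc[OF lower_envelope_tendsto[OF _ assms]])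
  show "\<And>g. g \<in> continuous_maps {0..} H \<Longrightarrow> \<bar>F g\<bar> \<le> B" by (rule B)
qed (use lsc assms in \<open>auto simp: lower_semicontinuous_paths_def\<close>)

lemma lsc_envelope_measurable:
  fixes f :: "'a \<Rightarrow> real \<Rightarrow> 'v"
  assumes rv: "\<And>t. 0 \<le> t \<Longrightarrow> (\<lambda>\<omega>. f \<omega> t) \<in> borel_measurable P"
    and paths: "\<And>\<omega>. \<omega> \<in> space P \<Longrightarrow> f \<omega> \<in> continuous_maps {0..} H"
  shows "(\<lambda>\<omega>. lower_envelope H B F (Suc n) (f \<omega>)) \<in> borel_measurable P"
  by (rule lipschitz_functional_measurable[OF _ lower_envelope_lipschitz[OF B B0] rv])
     (use continuous_maps_restrict[OF paths] in auto)

lemma lsc_measurable: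
  fixes f :: "'a \<Rightarrow> real \<Rightarrow> 'v"
  assumes rv: "\<And>t. 0 \<le> t \<Longrightarrow> (\<lambda>\<omega>. f \<omega> t) \<in> borel_measurable P"
    and paths: "\<And>\<omega>. \<omega> \<in> space P \<Longrightarrow> f \<omega> \<in> continuous_maps {0..} H"
  shows "(\<lambda>\<omega>. F (f \<omega>)) \<in> borel_measurable P"
  by (rule borel_measurable_LIMSEQ_real[OF lsc_envelope_tendsto[OF paths] lsc_envelope_measurable[OF rv paths]])

text \<open>For a fixed envelope \<open>E\<^sub>k \<le> F\<close> the expectations converge, and the expectation of \<open>E\<^sub>k(W)\<close> is close to that
of \<open>F(W)\<close> by dominated convergence.\<close>

lemma lsc_portmanteau:
  fixes Z :: "nat \<Rightarrow> 'a \<Rightarrow> real \<Rightarrow> 'v" and W :: "'b \<Rightarrow> real \<Rightarrow> 'v"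
  assumes P: "\<And>n. prob_space (P n)" and Q: "prob_space Q"
    and rv: "\<And>n t. 0 \<le> t \<Longrightarrow> (\<lambda>\<omega>. Z n \<omega> t) \<in> borel_measurable (P n)"
            "\<And>t. 0 \<le> t \<Longrightarrow> (\<lambda>\<omega>. W \<omega> t) \<in> borel_measurable Q"
    and paths: "\<And>n \<omega>. \<omega> \<in> space (P n) \<Longrightarrow> Z n \<omega> \<in> continuous_maps {0..} H"
               "\<And>\<omega>. \<omega> \<in> space Q \<Longrightarrow> W \<omega> \<in> continuous_maps {0..} H"
    and lim: "\<And>T L G. 0 < T \<Longrightarrow> 0 < L \<Longrightarrow> lipschitz_functional T L G \<Longrightarrow> (\<And>f. \<bar>G f\<bar> \<le> B) \<Longrightarrow>
                (\<lambda>n. \<integral>\<omega>. G (Z n \<omega>) \<partial>P n) \<longlonglongrightarrow> (\<integral>\<omega>. G (W \<omega>) \<partial>Q)"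
    and \<epsilon>: "0 < \<epsilon>"
  shows "\<forall>\<^sub>F n in sequentially. (\<integral>\<omega>. F (W \<omega>) \<partial>Q) - \<epsilon> < (\<integral>\<omega>. F (Z n \<omega>) \<partial>P n)"
proof -
  interpret Q: prob_space Q by (rule Q)
  let ?E = "\<lambda>k. lower_envelope H B F (Suc k)"
  have "(\<lambda>k. \<integral>\<omega>. ?E k (W \<omega>) \<partial>Q) \<longlonglongrightarrow> (\<integral>\<omega>. F (W \<omega>) \<partial>Q)"
  proof (rule integral_dominated_convergence[where w="\<lambda>_. B"])
    show "(\<lambda>\<omega>. F (W \<omega>)) \<in> borel_measurable Q" by (rule lsc_measurable[OF rv(2) paths(2)])
    show "(\<lambda>\<omega>. ?E k (W \<omega>)) \<in> borel_measurable Q" for k by (rule lsc_envelope_measurable[OF rv(2) paths(2)])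
  qed (auto intro!: lsc_envelope_tendsto paths lower_envelope_abs_le B B0)
  then have "\<forall>\<^sub>F k in sequentially. (\<integral>\<omega>. F (W \<omega>) \<partial>Q) - \<epsilon> < (\<integral>\<omega>. ?E k (W \<omega>) \<partial>Q)"
    using \<epsilon> by (intro order_tendstoD(1)) auto
  then obtain k where k: "(\<integral>\<omega>. F (W \<omega>) \<partial>Q) - \<epsilon> < (\<integral>\<omega>. ?E k (W \<omega>) \<partial>Q)"
    by (auto simp: eventually_sequentially)
  have "(\<lambda>n. \<integral>\<omega>. ?E k (Z n \<omega>) \<partial>P n) \<longlonglongrightarrow> (\<integral>\<omega>. ?E k (W \<omega>) \<partial>Q)"
    by (rule lim[OF _ _ lower_envelope_lipschitz[OF B B0]]) (auto intro!: lower_envelope_abs_le B B0)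
  then have "\<forall>\<^sub>F n in sequentially. (\<integral>\<omega>. F (W \<omega>) \<partial>Q) - \<epsilon> < (\<integral>\<omega>. ?E k (Z n \<omega>) \<partial>P n)"
    using k by (rule order_tendstoD(1))
  then show ?thesis
  proof eventually_elim
    case (elim n)
    interpret Pn: prob_space "P n" by (rule P)
    have "(\<integral>\<omega>. ?E k (Z n \<omega>) \<partial>P n) \<le> (\<integral>\<omega>. F (Z n \<omega>) \<partial>P n)"
    proof (rule integral_mono)
      show "integrable (P n) (\<lambda>\<omega>. F (Z n \<omega>))"
        using lsc_measurable[OF rv(1) paths(1)] B paths(1)
        by (intro Pn.integrable_const_bound[where B=B]) auto
      show "integrable (P n) (\<lambda>\<omega>. ?E k (Z n \<omega>))"
        using lsc_envelope_measurable[OF rv(1) paths(1)]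
        by (intro Pn.integrable_const_bound[where B=B]) (auto intro!: lower_envelope_abs_le B B0)
      show "?E k (Z n \<omega>) \<le> F (Z n \<omega>)" if "\<omega> \<in> space (P n)" for \<omega>
        by (rule lower_envelope_le[OF B paths(1)[OF that]])
    qed
    then show ?case using elim by linarith
  qed
qed

end

text \<open>The indicator of an open set is lower semicontinuous, hence measurable along the process.\<close>

lemma measurable_borel_of_compact_convergence:
  fixes f :: "'a \<Rightarrow> real \<Rightarrow> 'v::euclidean_space"
  assumes rv: "\<And>t. 0 \<le> t \<Longrightarrow> (\<lambda>\<omega>. f \<omega> t) \<in> borel_measurable P"
    and paths: "\<And>\<omega>. \<omega> \<in> space P \<Longrightarrow> f \<omega> \<in> continuous_maps {0..} H"
  shows "f \<in> P \<rightarrow>\<^sub>M borel_of (compact_convergence_topology {0::real..} H)"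
  unfolding borel_of_def
proof (rule measurable_measure_of)
  let ?T = "compact_convergence_topology {0::real..} H"
  show "{U. openin ?T U} \<subseteq> Pow (topspace ?T)" by (auto dest: openin_subset)
  show "f \<in> space P \<rightarrow> topspace ?T" using paths by (simp add: topspace_compact_convergence_topology)
  fix U assume "U \<in> {U. openin ?T U}"
  then have "lower_semicontinuous_paths H (indicator U)" by (simp add: lower_semicontinuous_indicator)
  then have [measurable]: "(\<lambda>\<omega>. indicator U (f \<omega>) :: real) \<in> borel_measurable P"
    by (intro lsc_measurable[where B=1 and H=H and F="indicator U", OF _ _ _ rv paths])
       (auto intro: indicator_le_1)
  have "f -` U \<inter> space P = {\<omega> \<in> space P. (indicator U (f \<omega>) :: real) = 1}"
    by (auto simp: indicator_def split: if_splits)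
  also have "\<dots> \<in> sets P" by measurable
  finally show "f -` U \<inter> space P \<in> sets P" .
qed

text \<open>The condition on cosines is convergence of finite-dimensional distributions in the form of
characteristic functions, along arithmetic progressions of times, which contain the dyadic grids. The
moment condition controls the interpolation error and, together with the starting point 0, the second
moments of the coordinates.\<close>

theorem converges_in_distribution_criterion:
  fixes Z :: "nat \<Rightarrow> 'a \<Rightarrow> real \<Rightarrow> 'v::euclidean_space" and W :: "'b \<Rightarrow> real \<Rightarrow> 'v"
  assumes P: "\<And>n. prob_space (P n)" and Q: "prob_space Q"
    and rv: "\<And>n t. 0 \<le> t \<Longrightarrow> (\<lambda>\<omega>. Z n \<omega> t) \<in> borel_measurable (P n)"
            "\<And>t. 0 \<le> t \<Longrightarrow> (\<lambda>\<omega>. W \<omega> t) \<in> borel_measurable Q"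
    and paths: "\<And>n \<omega>. \<omega> \<in> space (P n) \<Longrightarrow> Z n \<omega> \<in> continuous_maps {0..} H"
               "\<And>\<omega>. \<omega> \<in> space Q \<Longrightarrow> W \<omega> \<in> continuous_maps {0..} H"
    and start: "\<And>n \<omega>. \<omega> \<in> space (P n) \<Longrightarrow> Z n \<omega> 0 = 0" "\<And>\<omega>. \<omega> \<in> space Q \<Longrightarrow> W \<omega> 0 = 0"
    and moment: "\<And>T. 0 < T \<Longrightarrow> \<exists>C\<ge>0. \<forall>s\<in>{0..T}. \<forall>t\<in>{0..T}.
          (\<forall>n. (\<integral>\<^sup>+\<omega>. ennreal (dist (Z n \<omega> t) (Z n \<omega> s) ^ 4) \<partial>P n) \<le> ennreal (C * (t - s)\<^sup>2)) \<and>
          (\<integral>\<^sup>+\<omega>. ennreal (dist (W \<omega> t) (W \<omega> s) ^ 4) \<partial>Q) \<le> ennreal (C * (t - s)\<^sup>2)"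
    and wave_lim: "\<And>h m U \<theta>. 0 < h \<Longrightarrow>
          (\<lambda>n. \<integral>\<omega>. cos ((\<Sum>k\<le>m. U k \<bullet> Z n \<omega> (real k * h)) + \<theta>) \<partial>P n)
            \<longlonglongrightarrow> (\<integral>\<omega>. cos ((\<Sum>k\<le>m. U k \<bullet> W \<omega> (real k * h)) + \<theta>) \<partial>Q)"
  shows "converges_in_distribution (compact_convergence_topology {0::real..} H) P Z Q W"
proof -
  let ?T = "compact_convergence_topology {0::real..} H"
  have lip: "(\<lambda>n. \<integral>\<omega>. G (Z n \<omega>) \<partial>P n) \<longlonglongrightarrow> (\<integral>\<omega>. G (W \<omega>) \<partial>Q)"
    if T: "0 < T" and L: "0 < L" and G: "lipschitz_functional T L G" and bdd: "\<And>f. \<bar>G f\<bar> \<le> B" for T L B G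
  proof -
    obtain C where C: "0 \<le> C" and m: "\<And>s t n. s \<in> {0..T} \<Longrightarrow> t \<in> {0..T} \<Longrightarrow>
          (\<integral>\<^sup>+\<omega>. ennreal (dist (Z n \<omega> t) (Z n \<omega> s) ^ 4) \<partial>P n) \<le> ennreal (C * (t - s)\<^sup>2)"
        "\<And>s t. s \<in> {0..T} \<Longrightarrow> t \<in> {0..T} \<Longrightarrow>
          (\<integral>\<^sup>+\<omega>. ennreal (dist (W \<omega> t) (W \<omega> s) ^ 4) \<partial>Q) \<le> ennreal (C * (t - s)\<^sup>2)"
      using moment[OF T] by blast
    show ?thesis
      by (rule lipschitz_functional_expectation_tendsto[OF P Q T C L rv start m wave_lim G bdd])
         (use paths continuous_maps_restrict in blast)+
  qed
  have lower: "\<forall>\<^sub>F n in sequentially. (\<integral>\<omega>. F (W \<omega>) \<partial>Q) - \<epsilon> < (\<integral>\<omega>. F (Z n \<omega>) \<partial>P n)"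
    if F: "continuous_map ?T euclideanreal F" and B: "\<And>g. g \<in> topspace ?T \<Longrightarrow> \<bar>F g\<bar> \<le> B" and "0 < \<epsilon>" for F B \<epsilon>
  proof (rule lsc_portmanteau[OF _ _ _ P Q rv paths])
    show "\<bar>F g\<bar> \<le> \<bar>B\<bar>" if "g \<in> continuous_maps {0..} H" for g
      using B[of g] that by (simp add: topspace_compact_convergence_topology)
    show "lower_semicontinuous_paths H F" by (rule lower_semicontinuous_continuous_map[OF F])
    show "(\<lambda>n. \<integral>\<omega>. G (Z n \<omega>) \<partial>P n) \<longlonglongrightarrow> (\<integral>\<omega>. G (W \<omega>) \<partial>Q)"
      if "0 < T" "0 < L" "lipschitz_functional T L G" "\<And>f. \<bar>G f\<bar> \<le> \<bar>B\<bar>" for T L G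
      by (rule lip[OF that])
  qed (use \<open>0 < \<epsilon>\<close> in auto)
  show ?thesis
    unfolding converges_in_distribution_def
  proof (intro conjI allI impI)
    show "\<forall>\<^sub>F n in sequentially. Z n \<in> P n \<rightarrow>\<^sub>M borel_of ?T"
      by (rule always_eventually) (intro allI measurable_borel_of_compact_convergence rv paths)
    show "W \<in> Q \<rightarrow>\<^sub>M borel_of ?T"
      by (intro measurable_borel_of_compact_convergence rv paths)
    fix F assume "continuous_map ?T euclideanreal F \<and> bounded (F ` topspace ?T)"
    then obtain B where F: "continuous_map ?T euclideanreal F" and B: "\<And>g. g \<in> topspace ?T \<Longrightarrow> \<bar>F g\<bar> \<le> B"
      unfolding bounded_iff by auto
    have F': "continuous_map ?T euclideanreal (\<lambda>g. - F g)"
      using F by (rule continuous_map_minus)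
    show "(\<lambda>n. \<integral>\<omega>. F (Z n \<omega>) \<partial>P n) \<longlonglongrightarrow> (\<integral>\<omega>. F (W \<omega>) \<partial>Q)"
    proof (rule tendstoI)
      fix \<epsilon> :: real assume \<epsilon>: "0 < \<epsilon>"
      show "\<forall>\<^sub>F n in sequentially. dist (\<integral>\<omega>. F (Z n \<omega>) \<partial>P n) (\<integral>\<omega>. F (W \<omega>) \<partial>Q) < \<epsilon>"
        using lower[OF F B \<epsilon>] lower[OF F' _ \<epsilon>, of B]
        by (rule eventually_elim2) (use B in \<open>auto simp: dist_real_def abs_less_iff\<close>)
    qed
  qed
qed

section \<open>Centered Gaussian variables\<close>

lemma integral_std_normal_distribution_moments:
  "(\<integral>x. x \<partial>std_normal_distribution) = 0" "(\<integral>x. x ^ 2 \<partial>std_normal_distribution) = 1"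
  "(\<integral>x. x ^ 4 \<partial>std_normal_distribution) = 3" "(\<integral>x. x ^ 8 \<partial>std_normal_distribution) = 105"
  using integral_std_normal_distribution_moment_odd[of 1] std_normal_distribution_even_moments(1)[of 1]
    std_normal_distribution_even_moments(1)[of 2] std_normal_distribution_even_moments(1)[of 4]
  by (simp_all add: fact_numeral)

context prob_space
begin

text \<open>Defined through the characteristic function in order to include the constant 0 (\<open>v = 0\<close>) and to
  make sums of independent variables a matter of multiplying exponentials.\<close>

definition centered_gaussian :: "('a \<Rightarrow> real) \<Rightarrow> real \<Rightarrow> bool" where
  "centered_gaussian X v \<longleftrightarrow> random_variable borel X \<and>
     (\<forall>u. char (distr M borel X) u = complex_of_real (exp (- (u\<^sup>2 * v) / 2)))"

lemma centered_gaussian_rv: "centered_gaussian X v \<Longrightarrow> random_variable borel X"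
  by (simp add: centered_gaussian_def)

lemma centered_gaussian_nonneg:
  assumes "centered_gaussian X v"
  shows "0 \<le> v"
proof -
  interpret d: real_distribution "distr M borel X"
    using centered_gaussian_rv[OF assms] by (rule real_distribution_distr)
  have "cmod (char (distr M borel X) 1) \<le> 1" by (rule d.cmod_char_le_1)
  then show ?thesis using assms by (simp add: centered_gaussian_def)
qed

text \<open>Both sides have the same characteristic function; written as an image of the standard normal law, the
identity holds for \<open>v = 0\<close> as well and transports all moments.\<close>

lemma centered_gaussian_distr:
  assumes "centered_gaussian X v"
  shows "distr M borel X = distr std_normal_distribution borel (\<lambda>x. sqrt v * x)"
proof (rule Levy_uniqueness)
  show "real_distribution (distr M borel X)"
    using centered_gaussian_rv[OF assms] by (rule real_distribution_distr)
  interpret S: real_distribution std_normal_distribution by (rule real_dist_normal_dist)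
  show "real_distribution (distr std_normal_distribution borel (\<lambda>x. sqrt v * x))"
    by (rule S.real_distribution_distr) simp
  show "char (distr M borel X) = char (distr std_normal_distribution borel (\<lambda>x. sqrt v * x))"
  proof
    fix u
    have "char (distr std_normal_distribution borel (\<lambda>x. sqrt v * x)) u
        = char std_normal_distribution (u * sqrt v)"
      unfolding char_def by (subst integral_distr) (simp_all add: mult.assoc)
    also have "\<dots> = complex_of_real (exp (- (u\<^sup>2 * v) / 2))"
      using centered_gaussian_nonneg[OF assms] by (simp add: char_std_normal_distribution power_mult_distrib)
    finally show "char (distr M borel X) u = char (distr std_normal_distribution borel (\<lambda>x. sqrt v * x)) u"
      using assms by (simp add: centered_gaussian_def)
  qed
qed

lemma centered_gaussian_moment:
  assumes "centered_gaussian X v"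
  shows "integrable M (\<lambda>\<omega>. X \<omega> ^ n)"
    and "expectation (\<lambda>\<omega>. X \<omega> ^ n) = sqrt v ^ n * (\<integral>x. x ^ n \<partial>std_normal_distribution)"
proof -
  note rv[measurable] = centered_gaussian_rv[OF assms]
  have "integrable (distr M borel X) (\<lambda>x. x ^ n)"
    unfolding centered_gaussian_distr[OF assms]
    by (subst integrable_distr_eq)
       (auto simp: power_mult_distrib intro!: integrable_mult_right integrable_std_normal_distribution_moment)
  then show "integrable M (\<lambda>\<omega>. X \<omega> ^ n)" by (subst (asm) integrable_distr_eq) auto
  have "expectation (\<lambda>\<omega>. X \<omega> ^ n) = (\<integral>x. x ^ n \<partial>distr M borel X)"
    by (subst integral_distr) auto
  also have "\<dots> = sqrt v ^ n * (\<integral>x. x ^ n \<partial>std_normal_distribution)"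
    unfolding centered_gaussian_distr[OF assms]
    by (subst integral_distr) (auto simp: power_mult_distrib)
  finally show "expectation (\<lambda>\<omega>. X \<omega> ^ n) = sqrt v ^ n * (\<integral>x. x ^ n \<partial>std_normal_distribution)" .
qed

lemma centered_gaussian_moments:
  assumes "centered_gaussian X v"
  shows "integrable M X" "expectation X = 0"
    "expectation (\<lambda>\<omega>. X \<omega> ^ 2) = v" "expectation (\<lambda>\<omega>. X \<omega> ^ 4) = 3 * v\<^sup>2"
    "expectation (\<lambda>\<omega>. X \<omega> ^ 8) = 105 * v ^ 4"
proof -
  have s: "sqrt v ^ 2 = v" using centered_gaussian_nonneg[OF assms] by simp
  have "sqrt v ^ 4 = (sqrt v ^ 2) ^ 2" "sqrt v ^ 8 = (sqrt v ^ 2) ^ 4" by (simp_all flip: power_mult)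
  then have s': "sqrt v ^ 4 = v ^ 2" "sqrt v ^ 8 = v ^ 4" by (simp_all only: s)
  show "integrable M X" "expectation X = 0"
    using centered_gaussian_moment[OF assms, of 1] by (simp_all add: integral_std_normal_distribution_moments)
  show "expectation (\<lambda>\<omega>. X \<omega> ^ 2) = v" "expectation (\<lambda>\<omega>. X \<omega> ^ 4) = 3 * v\<^sup>2"
    "expectation (\<lambda>\<omega>. X \<omega> ^ 8) = 105 * v ^ 4"
    unfolding centered_gaussian_moment(2)[OF assms] integral_std_normal_distribution_moments s s' by simp_all
qed

lemma centered_gaussian_cong:
  assumes "centered_gaussian X v" "\<And>\<omega>. \<omega> \<in> space M \<Longrightarrow> X \<omega> = Y \<omega>" "v = w"
  shows "centered_gaussian Y w"
proof -
  have "distr M borel X = distr M borel Y" by (rule distr_cong) (use assms in auto)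
  moreover have "random_variable borel Y"
    using centered_gaussian_rv[OF assms(1)] assms(2) by (simp cong: measurable_cong)
  ultimately show ?thesis using assms by (simp add: centered_gaussian_def)
qed

lemma centered_gaussian_scale:
  assumes "centered_gaussian X v"
  shows "centered_gaussian (\<lambda>\<omega>. c * X \<omega>) (c\<^sup>2 * v)"
proof -
  note [measurable] = centered_gaussian_rv[OF assms]
  have "char (distr M borel (\<lambda>\<omega>. c * X \<omega>)) u = char (distr M borel X) (u * c)" for u
    unfolding char_def by (subst (1 2) integral_distr) (auto simp: mult.assoc)
  then show ?thesis using assms by (simp add: centered_gaussian_def power_mult_distrib mult_ac)
qed

lemma centered_gaussian_sum:
  assumes "indep_vars (\<lambda>_. borel) X I" "\<And>i. i \<in> I \<Longrightarrow> centered_gaussian (X i) (v i)" "finite I"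
  shows "centered_gaussian (\<lambda>\<omega>. \<Sum>i\<in>I. X i \<omega>) (\<Sum>i\<in>I. v i)"
proof -
  have "random_variable borel (\<lambda>\<omega>. \<Sum>i\<in>I. X i \<omega>)"
    using centered_gaussian_rv[OF assms(2)] by (intro borel_measurable_sum)
  moreover have "char (distr M borel (\<lambda>\<omega>. \<Sum>i\<in>I. X i \<omega>)) u
      = complex_of_real (exp (- (u\<^sup>2 * (\<Sum>i\<in>I. v i)) / 2))" for u
  proof -
    have "char (distr M borel (\<lambda>\<omega>. \<Sum>i\<in>I. X i \<omega>)) u = (\<Prod>i\<in>I. char (distr M borel (X i)) u)"
      by (rule char_distr_sum[OF assms(1)])
    also have "\<dots> = (\<Prod>i\<in>I. complex_of_real (exp (- (u\<^sup>2 * v i) / 2)))"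
      using assms(2) by (intro prod.cong) (auto simp: centered_gaussian_def)
    also have "\<dots> = complex_of_real (exp (\<Sum>i\<in>I. - (u\<^sup>2 * v i) / 2))"
      using assms(3) by (simp add: exp_sum)
    also have "(\<Sum>i\<in>I. - (u\<^sup>2 * v i) / 2) = - (u\<^sup>2 * (\<Sum>i\<in>I. v i)) / 2"
      by (simp add: sum_distrib_left sum_negf sum_divide_distrib)
    finally show ?thesis .
  qed
  ultimately show ?thesis by (simp add: centered_gaussian_def)
qed

lemma centered_gaussian_add:
  assumes ind: "indep_var borel X borel Y" and X: "centered_gaussian X v" and Y: "centered_gaussian Y w"
  shows "centered_gaussian (\<lambda>\<omega>. X \<omega> + Y \<omega>) (v + w)"
  using centered_gaussian_rv[OF X] centered_gaussian_rv[OF Y] X Y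
  by (auto simp: centered_gaussian_def char_distr_add[OF ind] exp_add[symmetric] algebra_simps add_divide_distrib diff_divide_distrib simp flip: of_real_mult)

lemma centered_gaussian_of_normal:
  assumes X: "distributed M lborel X (normal_density 0 \<sigma>)" and \<sigma>: "0 < \<sigma>"
  shows "centered_gaussian X (\<sigma>\<^sup>2)"
proof -
  have rv[measurable]: "random_variable borel X" using distributed_measurable[OF X] by simp
  have "distributed M lborel (\<lambda>x. (X x - 0) / \<sigma>) std_normal_density"
    using X \<sigma> by (subst (asm) normal_standard_normal_convert)
  then have "distr M lborel (\<lambda>x. X x / \<sigma>) = std_normal_distribution"
    using distributed_distr_eq_density by fastforce
  moreover have "distr M lborel (\<lambda>x. X x / \<sigma>) = distr M borel (\<lambda>x. X x / \<sigma>)" by (rule distr_cong) auto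
  ultimately have S: "distr M borel (\<lambda>x. X x / \<sigma>) = std_normal_distribution" by simp
  have "char (distr M borel X) u = char (distr M borel (\<lambda>x. X x / \<sigma>)) (u * \<sigma>)" for u
    unfolding char_def by (subst (1 2) integral_distr) (use \<sigma> in auto)
  then show ?thesis by (simp add: centered_gaussian_def S char_std_normal_distribution power_mult_distrib)
qed

end

section \<open>The Wick formula\<close>

text \<open>A linear space of jointly Gaussian variables. Joint normality is expressed by the fact that every
linear combination belongs to \<open>G\<close> and is Gaussian.\<close>

locale gaussian_space = prob_space +
  fixes G :: "('a \<Rightarrow> real) set"
  assumes G_add: "X \<in> G \<Longrightarrow> Y \<in> G \<Longrightarrow> (\<lambda>\<omega>. X \<omega> + Y \<omega>) \<in> G"
    and G_scale: "X \<in> G \<Longrightarrow> (\<lambda>\<omega>. c * X \<omega>) \<in> G"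
    and G_gaussian: "X \<in> G \<Longrightarrow> \<exists>v. centered_gaussian X v"
begin

lemma G_diff: "X \<in> G \<Longrightarrow> Y \<in> G \<Longrightarrow> (\<lambda>\<omega>. X \<omega> - Y \<omega>) \<in> G"
  using G_add[OF _ G_scale[where c="-1"], of X Y] by simp

lemma G_fourth_moment:
  assumes "X \<in> G"
  shows "integrable M (\<lambda>\<omega>. X \<omega> ^ 2)" "integrable M (\<lambda>\<omega>. X \<omega> ^ 4)"
    "expectation (\<lambda>\<omega>. X \<omega> ^ 4) = 3 * (expectation (\<lambda>\<omega>. X \<omega> ^ 2))\<^sup>2"
proof -
  obtain v where v: "centered_gaussian X v" using G_gaussian[OF assms] by blast
  show "integrable M (\<lambda>\<omega>. X \<omega> ^ 2)" "integrable M (\<lambda>\<omega>. X \<omega> ^ 4)"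
    "expectation (\<lambda>\<omega>. X \<omega> ^ 4) = 3 * (expectation (\<lambda>\<omega>. X \<omega> ^ 2))\<^sup>2"
    by (simp_all only: centered_gaussian_moment(1)[OF v] centered_gaussian_moments[OF v])
qed

lemma G_integrable_mult:
  assumes "X \<in> G" "Y \<in> G"
  shows "integrable M (\<lambda>\<omega>. X \<omega> * Y \<omega>)"
proof -
  have "(\<lambda>\<omega>. X \<omega> * Y \<omega>) = (\<lambda>\<omega>. ((X \<omega> + Y \<omega>) ^ 2 - (X \<omega> - Y \<omega>) ^ 2) / 4)"
    by (auto simp: power2_eq_square algebra_simps)
  then show ?thesis
    using G_fourth_moment(1)[OF G_add[OF assms]] G_fourth_moment(1)[OF G_diff[OF assms]] by simp
qed

text \<open>Polarization: \<open>192 x y z w\<close> is the signed sum of the eight fourth powers \<open>(x \<plusminus> y \<plusminus> z \<plusminus> w)\<^sup>4\<close>. Each of these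
has expectation \<open>3 (E S\<^sup>2)\<^sup>2\<close>, a polynomial in the covariances, and the same signed sum of
these polynomials is \<open>192\<close> times the right-hand side.\<close>

lemma wick_real:
  assumes G: "x \<in> G" "y \<in> G" "z \<in> G" "w \<in> G"
  shows "integrable M (\<lambda>\<omega>. x \<omega> * y \<omega> * z \<omega> * w \<omega>)"
    and "expectation (\<lambda>\<omega>. x \<omega> * y \<omega> * z \<omega> * w \<omega>) =
       expectation (\<lambda>\<omega>. x \<omega> * y \<omega>) * expectation (\<lambda>\<omega>. z \<omega> * w \<omega>) +
       expectation (\<lambda>\<omega>. x \<omega> * z \<omega>) * expectation (\<lambda>\<omega>. y \<omega> * w \<omega>) +
       expectation (\<lambda>\<omega>. x \<omega> * w \<omega>) * expectation (\<lambda>\<omega>. y \<omega> * z \<omega>)"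
proof -
  define S where "S a b c = (\<lambda>\<omega>. x \<omega> + a * y \<omega> + b * z \<omega> + c * w \<omega>)" for a b c :: real
  have SG: "S a b c \<in> G" for a b c
    unfolding S_def by (intro G_add G_scale G)
  note int = G_integrable_mult[OF G(1) G(1)] G_integrable_mult[OF G(1) G(2)] G_integrable_mult[OF G(1) G(3)]
    G_integrable_mult[OF G(1) G(4)] G_integrable_mult[OF G(2) G(2)] G_integrable_mult[OF G(2) G(3)]
    G_integrable_mult[OF G(2) G(4)] G_integrable_mult[OF G(3) G(3)] G_integrable_mult[OF G(3) G(4)]
    G_integrable_mult[OF G(4) G(4)]
  let ?E = "\<lambda>f. expectation f"
  have S2: "?E (\<lambda>\<omega>. S a b c \<omega> ^ 2) = ?E (\<lambda>\<omega>. x \<omega> * x \<omega>) + a\<^sup>2 * ?E (\<lambda>\<omega>. y \<omega> * y \<omega>)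
      + b\<^sup>2 * ?E (\<lambda>\<omega>. z \<omega> * z \<omega>) + c\<^sup>2 * ?E (\<lambda>\<omega>. w \<omega> * w \<omega>)
      + 2 * a * ?E (\<lambda>\<omega>. x \<omega> * y \<omega>) + 2 * b * ?E (\<lambda>\<omega>. x \<omega> * z \<omega>) + 2 * c * ?E (\<lambda>\<omega>. x \<omega> * w \<omega>)
      + 2 * a * b * ?E (\<lambda>\<omega>. y \<omega> * z \<omega>) + 2 * a * c * ?E (\<lambda>\<omega>. y \<omega> * w \<omega>) + 2 * b * c * ?E (\<lambda>\<omega>. z \<omega> * w \<omega>)"
    for a b c
  proof -
    have "(\<lambda>\<omega>. S a b c \<omega> ^ 2) = (\<lambda>\<omega>. x \<omega> * x \<omega> + a\<^sup>2 * (y \<omega> * y \<omega>)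
      + b\<^sup>2 * (z \<omega> * z \<omega>) + c\<^sup>2 * (w \<omega> * w \<omega>)
      + 2 * a * (x \<omega> * y \<omega>) + 2 * b * (x \<omega> * z \<omega>) + 2 * c * (x \<omega> * w \<omega>)
      + 2 * a * b * (y \<omega> * z \<omega>) + 2 * a * c * (y \<omega> * w \<omega>) + 2 * b * c * (z \<omega> * w \<omega>))"
      by (rule ext) (simp add: S_def power2_eq_square algebra_simps)
    then show ?thesis using int by simp
  qed
  have pol: "x \<omega> * y \<omega> * z \<omega> * w \<omega> =
     (S 1 1 1 \<omega> ^ 4 - S 1 1 (-1) \<omega> ^ 4 - S 1 (-1) 1 \<omega> ^ 4 + S 1 (-1) (-1) \<omega> ^ 4
      - S (-1) 1 1 \<omega> ^ 4 + S (-1) 1 (-1) \<omega> ^ 4 + S (-1) (-1) 1 \<omega> ^ 4 - S (-1) (-1) (-1) \<omega> ^ 4) / 192" for \<omega>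
    unfolding S_def by algebra
  note S4 = G_fourth_moment(2,3)[OF SG]
  show "integrable M (\<lambda>\<omega>. x \<omega> * y \<omega> * z \<omega> * w \<omega>)"
    unfolding pol using S4(1) by simp
  have "?E (\<lambda>\<omega>. x \<omega> * y \<omega> * z \<omega> * w \<omega>) =
     (?E (\<lambda>\<omega>. S 1 1 1 \<omega> ^ 4) - ?E (\<lambda>\<omega>. S 1 1 (-1) \<omega> ^ 4) - ?E (\<lambda>\<omega>. S 1 (-1) 1 \<omega> ^ 4)
      + ?E (\<lambda>\<omega>. S 1 (-1) (-1) \<omega> ^ 4) - ?E (\<lambda>\<omega>. S (-1) 1 1 \<omega> ^ 4) + ?E (\<lambda>\<omega>. S (-1) 1 (-1) \<omega> ^ 4)
      + ?E (\<lambda>\<omega>. S (-1) (-1) 1 \<omega> ^ 4) - ?E (\<lambda>\<omega>. S (-1) (-1) (-1) \<omega> ^ 4)) / 192"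
    unfolding pol using S4(1) by simp
  then show "?E (\<lambda>\<omega>. x \<omega> * y \<omega> * z \<omega> * w \<omega>) =
       ?E (\<lambda>\<omega>. x \<omega> * y \<omega>) * ?E (\<lambda>\<omega>. z \<omega> * w \<omega>) +
       ?E (\<lambda>\<omega>. x \<omega> * z \<omega>) * ?E (\<lambda>\<omega>. y \<omega> * w \<omega>) +
       ?E (\<lambda>\<omega>. x \<omega> * w \<omega>) * ?E (\<lambda>\<omega>. y \<omega> * z \<omega>)"
    unfolding S4(2) S2 power2_minus power_one mult_1_left mult_1_right mult_minus_left mult_minus_right
    by algebra
qed

text \<open>Wick's formula together with the integrability that makes it linear in each argument. Being invariant
under rotation of its arguments, it extends from real to complex variables one argument at a time.\<close>

definition wick :: "('a \<Rightarrow> complex) \<Rightarrow> ('a \<Rightarrow> complex) \<Rightarrow> ('a \<Rightarrow> complex) \<Rightarrow> ('a \<Rightarrow> complex) \<Rightarrow> bool" where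
  "wick a b c d \<longleftrightarrow> integrable M (\<lambda>\<omega>. a \<omega> * b \<omega>) \<and> integrable M (\<lambda>\<omega>. a \<omega> * c \<omega>) \<and>
     integrable M (\<lambda>\<omega>. a \<omega> * d \<omega>) \<and> integrable M (\<lambda>\<omega>. b \<omega> * c \<omega>) \<and> integrable M (\<lambda>\<omega>. b \<omega> * d \<omega>) \<and>
     integrable M (\<lambda>\<omega>. c \<omega> * d \<omega>) \<and> integrable M (\<lambda>\<omega>. a \<omega> * b \<omega> * c \<omega> * d \<omega>) \<and>
     (\<integral>\<omega>. a \<omega> * b \<omega> * c \<omega> * d \<omega> \<partial>M) =
       (\<integral>\<omega>. a \<omega> * b \<omega> \<partial>M) * (\<integral>\<omega>. c \<omega> * d \<omega> \<partial>M) + (\<integral>\<omega>. a \<omega> * c \<omega> \<partial>M) * (\<integral>\<omega>. b \<omega> * d \<omega> \<partial>M) +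
       (\<integral>\<omega>. a \<omega> * d \<omega> \<partial>M) * (\<integral>\<omega>. b \<omega> * c \<omega> \<partial>M)"

lemma wick_rotate: "wick a b c d \<Longrightarrow> wick d a b c"
  unfolding wick_def by (simp add: mult_ac add_ac)

lemma wick_complex_first:
  assumes "wick (\<lambda>\<omega>. complex_of_real (Re (z \<omega>))) b c d" "wick (\<lambda>\<omega>. complex_of_real (Im (z \<omega>))) b c d"
  shows "wick z b c d"
proof -
  have "z = (\<lambda>\<omega>. complex_of_real (Re (z \<omega>)) + \<i> * complex_of_real (Im (z \<omega>)))"
    using complex_eq by auto
  moreover have "wick (\<lambda>\<omega>. complex_of_real (Re (z \<omega>)) + \<i> * complex_of_real (Im (z \<omega>))) b c d"
    using assms unfolding wick_def
    by (simp add: distrib_right mult.assoc) (simp add: algebra_simps)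
  ultimately show ?thesis by simp
qed

lemma wick_of_real:
  assumes G: "x \<in> G" "y \<in> G" "z \<in> G" "w \<in> G"
  shows "wick (\<lambda>\<omega>. complex_of_real (x \<omega>)) (\<lambda>\<omega>. complex_of_real (y \<omega>))
           (\<lambda>\<omega>. complex_of_real (z \<omega>)) (\<lambda>\<omega>. complex_of_real (w \<omega>))"
  using G_integrable_mult[OF G(1) G(2)] G_integrable_mult[OF G(1) G(3)] G_integrable_mult[OF G(1) G(4)]
    G_integrable_mult[OF G(2) G(3)] G_integrable_mult[OF G(2) G(4)] G_integrable_mult[OF G(3) G(4)]
    wick_real[OF G]
  unfolding wick_def by (simp flip: of_real_mult of_real_add)

lemma wick_complex:
  assumes "\<And>z. z \<in> {z1, z2, z3, z4} \<Longrightarrow> (\<lambda>\<omega>. Re (z \<omega>)) \<in> G \<and> (\<lambda>\<omega>. Im (z \<omega>)) \<in> G"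
  shows "wick z1 z2 z3 z4"
proof -
  have G: "(\<lambda>\<omega>. Re (z1 \<omega>)) \<in> G" "(\<lambda>\<omega>. Im (z1 \<omega>)) \<in> G" "(\<lambda>\<omega>. Re (z2 \<omega>)) \<in> G" "(\<lambda>\<omega>. Im (z2 \<omega>)) \<in> G"
    "(\<lambda>\<omega>. Re (z3 \<omega>)) \<in> G" "(\<lambda>\<omega>. Im (z3 \<omega>)) \<in> G" "(\<lambda>\<omega>. Re (z4 \<omega>)) \<in> G" "(\<lambda>\<omega>. Im (z4 \<omega>)) \<in> G"
    using assms by auto
  have 1: "wick z4 (\<lambda>\<omega>. complex_of_real (a \<omega>)) (\<lambda>\<omega>. complex_of_real (b \<omega>)) (\<lambda>\<omega>. complex_of_real (c \<omega>))"
    if "a \<in> G" "b \<in> G" "c \<in> G" for a b c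
    by (rule wick_complex_first; rule wick_of_real) (use G that in auto)
  have 2: "wick z3 z4 (\<lambda>\<omega>. complex_of_real (a \<omega>)) (\<lambda>\<omega>. complex_of_real (b \<omega>))"
    if "a \<in> G" "b \<in> G" for a b
    by (rule wick_complex_first; rule wick_rotate; rule 1) (use G that in auto)
  have 3: "wick z2 z3 z4 (\<lambda>\<omega>. complex_of_real (a \<omega>))" if "a \<in> G" for a
    by (rule wick_complex_first; rule wick_rotate; rule 2) (use G that in auto)
  show ?thesis
    by (rule wick_complex_first; rule wick_rotate; rule 3) (use G in auto)
qed

end

section \<open>Brownian motions at finitely many times\<close>

lemma path_of_apply: "0 \<le> t \<Longrightarrow> path_of Z \<omega> t = Z t \<omega>"
  by (simp add: path_of_def)

lemma measurable_path_eval: "0 \<le> t \<Longrightarrow> (\<lambda>p. p t) \<in> path_algebra \<rightarrow>\<^sub>M borel"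
  by (rule measurable_component_singleton) simp

lemma borel_measurable_path_sum:
  fixes g :: "nat \<Rightarrow> 'b::topological_space \<Rightarrow> real"
  assumes "\<And>k. g k \<in> borel_measurable borel" "\<And>k. 0 \<le> \<tau> k"
  shows "(\<lambda>p. \<Sum>k\<le>m. g k (p (\<tau> k))) \<in> borel_measurable path_algebra"
  using assms by (intro borel_measurable_sum measurable_compose[OF measurable_path_eval]) auto

context prob_space
begin

lemma real_BM_increment_gaussian:
  assumes "std_real_BM b" "0 \<le> s" "s < t"
  shows "centered_gaussian (\<lambda>\<omega>. b t \<omega> - b s \<omega>) (t - s)"
proof -
  have "distributed M lborel (\<lambda>\<omega>. b t \<omega> - b s \<omega>) (normal_density 0 (sqrt (t - s)))"
    using assms unfolding std_real_BM_def by blast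
  from centered_gaussian_of_normal[OF this] show ?thesis using assms by simp
qed

text \<open>Summation by parts: each value \<open>b(\<tau> k)\<close> is the sum of the first \<open>k\<close> increments, so the combination is one
of independent increments. The same rearrangement turns \<open>min (\<tau> k) (\<tau> l)\<close> into the sum of the
increments of \<open>\<tau>\<close> that both indices have in common.\<close>

lemma real_BM_linear_combination_gaussian:
  fixes \<tau> :: "nat \<Rightarrow> real"
  assumes b: "std_real_BM b" and \<tau>: "strict_mono \<tau>" "\<tau> 0 = 0"
  shows "centered_gaussian (\<lambda>\<omega>. \<Sum>k\<le>m. c k * b (\<tau> k) \<omega>) (\<Sum>k\<le>m. \<Sum>l\<le>m. c k * c l * min (\<tau> k) (\<tau> l))"
proof -
  define incr where "incr i = (\<lambda>\<omega>. b (\<tau> (Suc i)) \<omega> - b (\<tau> i) \<omega>)" for i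
  define \<delta> where "\<delta> i = \<tau> (Suc i) - \<tau> i" for i
  \<comment> \<open>The coefficient of the \<open>i\<close>-th increment after summation by parts.\<close>
  define d where "d i = (\<Sum>k\<le>m. c k * of_bool (i < k))" for i
  have mono: "\<tau> k \<le> \<tau> l \<longleftrightarrow> k \<le> l" for k l using \<tau>(1) by (rule strict_mono_less_eq)
  have nn: "0 \<le> \<tau> k" for k using mono[of 0 k] \<tau>(2) by simp
  have "indep_vars (\<lambda>_. borel) (\<lambda>i \<omega>. b (\<tau> (Suc i)) \<omega> - b (\<tau> i) \<omega>) {..<m}"
    using b \<tau> by (simp add: std_real_BM_def)
  then have "indep_vars (\<lambda>_. borel) incr {..<m}" by (simp add: incr_def[abs_def])
  then have ind: "indep_vars (\<lambda>_. borel) (\<lambda>i \<omega>. d i * incr i \<omega>) {..<m}"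
    by (rule indep_vars_compose2) simp
  have gi: "centered_gaussian (incr i) (\<delta> i)" for i
    unfolding incr_def \<delta>_def by (rule real_BM_increment_gaussian[OF b nn]) (use \<tau>(1) in \<open>simp add: strict_mono_Suc_iff\<close>)
  have "centered_gaussian (\<lambda>\<omega>. \<Sum>i<m. d i * incr i \<omega>) (\<Sum>i<m. (d i)\<^sup>2 * \<delta> i)"
    by (rule centered_gaussian_sum[OF ind centered_gaussian_scale[OF gi]]) simp
  moreover have "(\<Sum>i<m. d i * incr i \<omega>) = (\<Sum>k\<le>m. c k * b (\<tau> k) \<omega>)" if "\<omega> \<in> space M" for \<omega>
  proof -
    have "(\<Sum>i<m. d i * incr i \<omega>) = (\<Sum>k\<le>m. c k * (\<Sum>i<m. of_bool (i < k) * incr i \<omega>))"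
      unfolding d_def sum_distrib_right sum_distrib_left
      by (subst sum.swap) (simp add: mult_ac)
    also have "\<dots> = (\<Sum>k\<le>m. c k * b (\<tau> k) \<omega>)"
    proof (rule sum.cong[OF refl])
      fix k assume k: "k \<in> {..m}"
      have "(\<Sum>i<m. of_bool (i < k) * incr i \<omega>) = (\<Sum>i<k. incr i \<omega>)"
        using k by (intro sum.mono_neutral_cong_right) auto
      also have "\<dots> = b (\<tau> k) \<omega> - b (\<tau> 0) \<omega>"
        unfolding incr_def by (rule sum_lessThan_telescope)
      also have "b (\<tau> 0) \<omega> = 0" using b that \<tau>(2) by (simp add: std_real_BM_def)
      finally show "c k * (\<Sum>i<m. of_bool (i < k) * incr i \<omega>) = c k * b (\<tau> k) \<omega>" by simp
    qed
    finally show ?thesis .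
  qed
  moreover have "(\<Sum>i<m. (d i)\<^sup>2 * \<delta> i) = (\<Sum>k\<le>m. \<Sum>l\<le>m. c k * c l * min (\<tau> k) (\<tau> l))"
  proof -
    have "(\<Sum>i<m. (d i)\<^sup>2 * \<delta> i) = (\<Sum>i<m. \<Sum>k\<le>m. \<Sum>l\<le>m. c k * c l * (of_bool (i < k) * of_bool (i < l) * \<delta> i))"
      unfolding d_def power2_eq_square sum_product sum_distrib_right
      by (intro sum.cong refl) (simp only: sum_distrib_left mult_ac)
    also have "\<dots> = (\<Sum>k\<le>m. \<Sum>l\<le>m. c k * c l * (\<Sum>i<m. of_bool (i < k) * of_bool (i < l) * \<delta> i))"
      unfolding sum_distrib_left by (subst sum.swap) (intro sum.cong refl sum.swap)
    also have "\<dots> = (\<Sum>k\<le>m. \<Sum>l\<le>m. c k * c l * min (\<tau> k) (\<tau> l))"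
    proof (intro sum.cong refl)
      fix k l assume k: "k \<in> {..m}" and "l \<in> {..m}"
      then have "(\<Sum>i<m. of_bool (i < k) * of_bool (i < l) * \<delta> i) = (\<Sum>i<min k l. \<delta> i)"
        by (intro sum.mono_neutral_cong_right) auto
      also have "\<dots> = \<tau> (min k l) - \<tau> 0" unfolding \<delta>_def by (rule sum_lessThan_telescope)
      also have "\<dots> = min (\<tau> k) (\<tau> l)" using mono[of k l] \<tau>(2) by (auto simp: min_def)
      finally show "c k * c l * (\<Sum>i<m. of_bool (i < k) * of_bool (i < l) * \<delta> i) = c k * c l * min (\<tau> k) (\<tau> l)"
        by simp
    qed
    finally show ?thesis .
  qed
  ultimately show ?thesis by (rule centered_gaussian_cong)
qed

text \<open>The real and imaginary parts are independent and carry half of the variance each, hence the factor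
\<open>1/2\<close>.\<close>

lemma complex_BM_linear_combination_gaussian:
  fixes \<tau> :: "nat \<Rightarrow> real"
  assumes z: "std_complex_BM z" and \<tau>: "strict_mono \<tau>" "\<tau> 0 = 0"
  shows "centered_gaussian (\<lambda>\<omega>. \<Sum>k\<le>m. c k \<bullet> z (\<tau> k) \<omega>)
           ((\<Sum>k\<le>m. \<Sum>l\<le>m. (c k \<bullet> c l) * min (\<tau> k) (\<tau> l)) / 2)"
proof -
  obtain b b' where b: "std_real_BM b" "std_real_BM b'"
    and ind: "indep_var path_algebra (path_of b) path_algebra (path_of b')"
    and zb: "\<And>t \<omega>. 0 \<le> t \<Longrightarrow> \<omega> \<in> space M \<Longrightarrow>
       z t \<omega> = (complex_of_real (b t \<omega>) + \<i> * complex_of_real (b' t \<omega>)) / complex_of_real (sqrt 2)"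
    using z unfolding std_complex_BM_def by blast
  have nn: "0 \<le> \<tau> k" for k using strict_mono_less_eq[OF \<tau>(1), of 0 k] \<tau>(2) by simp
  define x where "x k = Re (c k) / sqrt 2" for k
  define y where "y k = Im (c k) / sqrt 2" for k
  have "indep_var borel ((\<lambda>p. \<Sum>k\<le>m. x k * p (\<tau> k)) \<circ> path_of b) borel ((\<lambda>p. \<Sum>k\<le>m. y k * p (\<tau> k)) \<circ> path_of b')"
    by (rule indep_var_compose[OF ind]; rule borel_measurable_path_sum) (use nn in auto)
  then have "indep_var borel (\<lambda>\<omega>. \<Sum>k\<le>m. x k * b (\<tau> k) \<omega>) borel (\<lambda>\<omega>. \<Sum>k\<le>m. y k * b' (\<tau> k) \<omega>)"
    by (simp add: comp_def path_of_apply nn)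
  from centered_gaussian_add[OF this real_BM_linear_combination_gaussian[OF b(1) \<tau>] real_BM_linear_combination_gaussian[OF b(2) \<tau>]]
  show ?thesis
  proof (rule centered_gaussian_cong)
    fix \<omega> assume \<omega>: "\<omega> \<in> space M"
    show "(\<Sum>k\<le>m. x k * b (\<tau> k) \<omega>) + (\<Sum>k\<le>m. y k * b' (\<tau> k) \<omega>) = (\<Sum>k\<le>m. c k \<bullet> z (\<tau> k) \<omega>)"
      unfolding sum.distrib[symmetric]
      by (rule sum.cong) (simp_all add: zb[OF nn \<omega>] inner_complex_def x_def y_def)
  next
    show "(\<Sum>k\<le>m. \<Sum>l\<le>m. x k * x l * min (\<tau> k) (\<tau> l)) + (\<Sum>k\<le>m. \<Sum>l\<le>m. y k * y l * min (\<tau> k) (\<tau> l))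
        = (\<Sum>k\<le>m. \<Sum>l\<le>m. (c k \<bullet> c l) * min (\<tau> k) (\<tau> l)) / 2"
      unfolding sum.distrib[symmetric] sum_divide_distrib
      by (intro sum.cong refl) (simp add: x_def y_def inner_complex_def field_simps)
  qed
qed

end

section \<open>Matrices and moment inequalities\<close>

lemma integral_dominated_nonneg:
  fixes f g :: "'a \<Rightarrow> real"
  assumes "integrable N g" "f \<in> borel_measurable N"
    and "\<And>x. x \<in> space N \<Longrightarrow> 0 \<le> f x" "\<And>x. x \<in> space N \<Longrightarrow> f x \<le> g x"
  shows "integrable N f" "(\<integral>x. f x \<partial>N) \<le> (\<integral>x. g x \<partial>N)"
proof -
  show "integrable N f"
    by (rule Bochner_Integration.integrable_bound[OF assms(1,2)])
       (use assms(3,4) in \<open>fastforce intro!: AE_I2\<close>)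
  then show "(\<integral>x. f x \<partial>N) \<le> (\<integral>x. g x \<partial>N)"
    using assms by (intro integral_mono)
qed

text \<open>For Hermitian matrices the real inner product is a complex bilinear expression in the entries, because
exchanging the indices conjugates the double sum. Covariances of real linear functionals can thus be
computed from expectations of products of complex entries.\<close>

lemma inner_hermitian_matrices:
  fixes U A :: "complex^'n^'n"
  assumes U: "U \<in> hermitian_matrices" and A: "A \<in> hermitian_matrices"
  shows "complex_of_real (U \<bullet> A) = (\<Sum>i\<in>UNIV. \<Sum>p\<in>UNIV. cnj (U $ i $ p) * A $ i $ p)"
proof -
  let ?S = "\<Sum>i\<in>UNIV. \<Sum>p\<in>UNIV. cnj (U $ i $ p) * A $ i $ p"
  have "cnj ?S = (\<Sum>i\<in>UNIV. \<Sum>p\<in>UNIV. U $ i $ p * cnj (A $ i $ p))" by simp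
  also have "\<dots> = (\<Sum>i\<in>UNIV. \<Sum>p\<in>UNIV. cnj (U $ p $ i) * A $ p $ i)"
  proof (intro sum.cong refl)
    fix i p
    have "U $ i $ p = cnj (U $ p $ i)" "A $ p $ i = cnj (A $ i $ p)"
      using U A unfolding hermitian_matrices_def by blast+
    then show "U $ i $ p * cnj (A $ i $ p) = cnj (U $ p $ i) * A $ p $ i" by simp
  qed
  also have "\<dots> = ?S" by (rule sum.swap)
  finally have "?S \<in> \<real>" by (simp add: Reals_cnj_iff)
  then have "?S = complex_of_real (Re ?S)" by (rule of_real_Re[symmetric])
  also have "Re ?S = U \<bullet> A"
    by (simp add: inner_vec_def inner_complex_def)
  finally show ?thesis by simp
qed

text \<open>A sum is at most its number of terms times the largest one.\<close>

lemma sum_power_le: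
  fixes x :: "'i \<Rightarrow> real"
  assumes "finite I" "\<And>i. i \<in> I \<Longrightarrow> 0 \<le> x i" "0 < n"
  shows "(\<Sum>i\<in>I. x i) ^ n \<le> real (card I) ^ n * (\<Sum>i\<in>I. x i ^ n)"
proof (cases "I = {}")
  case True
  then show ?thesis using assms(3) by (simp add: power_0_left)
next
  case False
  define m where "m = Max (x ` I)"
  have "m \<in> x ` I" unfolding m_def using assms(1) False by (intro Max_in) auto
  then obtain i0 where i0: "i0 \<in> I" "m = x i0" by auto
  have le: "x i \<le> m" if "i \<in> I" for i unfolding m_def using that assms(1) by (intro Max_ge) auto
  have "(\<Sum>i\<in>I. x i) \<le> real (card I) * m"
    using sum_bounded_above[of I x m] le by simp
  then have "(\<Sum>i\<in>I. x i) ^ n \<le> (real (card I) * m) ^ n"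
    using assms(2) by (intro power_mono sum_nonneg)
  also have "\<dots> = real (card I) ^ n * m ^ n" by (simp add: power_mult_distrib)
  also have "\<dots> \<le> real (card I) ^ n * (\<Sum>i\<in>I. x i ^ n)"
    unfolding i0(2) using i0(1) assms by (intro mult_left_mono member_le_sum) auto
  finally show ?thesis .
qed

lemma add_power_le:
  fixes x y :: real
  assumes "0 \<le> x" "0 \<le> y" "0 < n"
  shows "(x + y) ^ n \<le> 2 ^ n * (x ^ n + y ^ n)"
  using sum_power_le[of UNIV "\<lambda>b. if b then x else y" n] assms by (simp add: UNIV_bool add_ac)

lemma norm_matrix_le_sum:
  fixes A :: "complex^'n^'m"
  shows "norm A \<le> (\<Sum>i\<in>UNIV. \<Sum>p\<in>UNIV. cmod (A $ i $ p))"
proof -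
  have "norm A \<le> (\<Sum>i\<in>UNIV. norm (A $ i))"
    unfolding norm_vec_def by (rule L2_set_le_sum) simp
  also have "\<dots> \<le> (\<Sum>i\<in>UNIV. \<Sum>p\<in>UNIV. cmod (A $ i $ p))"
    by (intro sum_mono) (simp add: norm_vec_def L2_set_le_sum)
  finally show ?thesis .
qed

lemma cnj_measurable [measurable]: "cnj \<in> borel \<rightarrow>\<^sub>M borel"
  by (intro borel_measurable_continuous_onI continuous_intros)

lemma borel_measurable_matrix:
  fixes f :: "'a \<Rightarrow> complex^'n^'m"
  assumes "\<And>i p. (\<lambda>\<omega>. f \<omega> $ i $ p) \<in> borel_measurable N"
  shows "f \<in> borel_measurable N"
proof (rule borel_measurable_euclidean_space[THEN iffD2], intro ballI)
  fix b :: "complex^'n^'m" assume "b \<in> Basis"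
  then obtain i p c where "b = axis i (axis p c)" unfolding Basis_vec_def by blast
  then have "(\<lambda>\<omega>. f \<omega> \<bullet> b) = (\<lambda>\<omega>. f \<omega> $ i $ p \<bullet> c)" by (simp add: inner_axis)
  then show "(\<lambda>\<omega>. f \<omega> \<bullet> b) \<in> borel_measurable N" using assms[of i p] by simp
qed

definition centered_square :: "('n \<Rightarrow> complex) \<Rightarrow> real \<Rightarrow> complex^'n^'n" where
  "centered_square z t = (\<chi> i p. z i * cnj (z p)) - t *\<^sub>R mat 1"

lemma centered_square_entry:
  "centered_square z t $ i $ p = z i * cnj (z p) - (if i = p then complex_of_real t else 0)"
  by (simp add: centered_square_def mat_def scaleR_conv_of_real[where 'a=complex])

lemma centered_square_hermitian: "centered_square z t \<in> hermitian_matrices"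
  by (auto simp: centered_square_def hermitian_matrices_def mat_def complex_eq_iff)

text \<open>Writing \<open>x x\<^sup>* - y y\<^sup>* = (x - y) x\<^sup>* + y (x - y)\<^sup>*\<close> extracts the factor \<open>D\<close>, which is small for
neighbouring times.\<close>

lemma norm_centered_square_diff_le:
  fixes x y :: "'n::finite \<Rightarrow> complex"
  defines "D \<equiv> \<Sum>i\<in>UNIV. cmod (x i - y i)" and "S \<equiv> \<Sum>i\<in>UNIV. cmod (x i) + cmod (y i)"
  shows "norm (centered_square x t - centered_square y s) \<le> D * S + \<bar>t - s\<bar> * real CARD('n)"
proof -
  let ?A = "(\<chi> i p. x i * cnj (x p)) - (\<chi> i p. y i * cnj (y p)) :: complex^'n^'n"
  have split: "centered_square x t - centered_square y s = ?A - (t - s) *\<^sub>R mat 1"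
    by (simp add: centered_square_def scaleR_left_diff_distrib)
  have "norm ?A \<le> (\<Sum>i\<in>UNIV. \<Sum>p\<in>UNIV. cmod (?A $ i $ p))" by (rule norm_matrix_le_sum)
  also have "\<dots> \<le> (\<Sum>i\<in>UNIV. \<Sum>p\<in>UNIV. cmod (x i - y i) * cmod (x p) + cmod (y i) * cmod (x p - y p))"
  proof (intro sum_mono)
    fix i p
    have "?A $ i $ p = (x i - y i) * cnj (x p) + y i * cnj (x p - y p)"
      by (simp add: algebra_simps)
    then have "cmod (?A $ i $ p) \<le> cmod ((x i - y i) * cnj (x p)) + cmod (y i * cnj (x p - y p))"
      by (metis norm_triangle_ineq)
    also have "\<dots> = cmod (x i - y i) * cmod (x p) + cmod (y i) * cmod (x p - y p)"
      by (simp only: norm_mult complex_mod_cnj)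
    finally show "cmod (?A $ i $ p) \<le> cmod (x i - y i) * cmod (x p) + cmod (y i) * cmod (x p - y p)" .
  qed
  also have "\<dots> = D * (\<Sum>p\<in>UNIV. cmod (x p)) + (\<Sum>i\<in>UNIV. cmod (y i)) * D"
    by (simp add: D_def sum.distrib sum_product)
  also have "\<dots> = D * S"
    by (simp add: S_def sum.distrib algebra_simps)
  finally have A: "norm ?A \<le> D * S" .
  have "norm (mat 1 :: complex^'n^'n) \<le> (\<Sum>i\<in>(UNIV::'n set). \<Sum>p\<in>(UNIV::'n set). cmod ((mat 1 :: complex^'n^'n) $ i $ p))"
    by (rule norm_matrix_le_sum)
  also have "\<dots> = (\<Sum>i\<in>(UNIV::'n set). 1)"
    by (intro sum.cong refl) (simp add: mat_def if_distrib[of cmod] cong: if_cong)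
  finally have "norm (mat 1 :: complex^'n^'n) \<le> real CARD('n)" by simp
  then have "norm ((t - s) *\<^sub>R mat 1 :: complex^'n^'n) \<le> \<bar>t - s\<bar> * real CARD('n)"
    by (simp add: mult_left_mono)
  then show ?thesis
    unfolding split using A norm_triangle_ineq4[of ?A "(t - s) *\<^sub>R mat 1"] by linarith
qed

text \<open>The constant that comes out of \<open>column_increment_moment\<close> for matrices of size \<open>N\<close> and times up to \<open>T\<close>.
What matters is that it does not depend on the number of columns.\<close>

definition column_moment_bound :: "real \<Rightarrow> real \<Rightarrow> real" where
  "column_moment_bound N T = 16 * (105 * N ^ 9 + 53760 * N ^ 9 * T ^ 4 + T\<^sup>2 * N ^ 4)"

lemma column_moment_bound_nonneg: "0 \<le> N \<Longrightarrow> 0 \<le> column_moment_bound N T"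
  by (simp add: column_moment_bound_def)

lemma column_moment_bound_alt:
  fixes N T h :: real
  assumes "h \<noteq> 0"
  shows "16 * (N ^ 8 * (N * (105 * h ^ 4)) / h\<^sup>2 + h\<^sup>2 * (256 * N ^ 8 * (N * (210 * T ^ 4))) + h\<^sup>2 * T\<^sup>2 * N ^ 4)
     = column_moment_bound N T * h\<^sup>2"
  using assms by (simp add: column_moment_bound_def field_simps eval_nat_numeral)

context prob_space
begin

lemma complex_BM_rv:
  assumes "std_complex_BM z" "0 \<le> t"
  shows "random_variable borel (z t)"
proof -
  obtain b b' where b: "std_real_BM b" "std_real_BM b'"
    and zb: "\<And>t \<omega>. 0 \<le> t \<Longrightarrow> \<omega> \<in> space M \<Longrightarrow>
       z t \<omega> = (complex_of_real (b t \<omega>) + \<i> * complex_of_real (b' t \<omega>)) / complex_of_real (sqrt 2)"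
    using assms(1) unfolding std_complex_BM_def by blast
  have [measurable]: "random_variable borel (b t)" "random_variable borel (b' t)"
    using b assms(2) by (auto simp: std_real_BM_def)
  have "random_variable borel (\<lambda>\<omega>. (complex_of_real (b t \<omega>) + \<i> * complex_of_real (b' t \<omega>)) / complex_of_real (sqrt 2))"
    by measurable
  then show ?thesis using zb[OF assms(2)] by (simp cong: measurable_cong)
qed

lemma complex_BM_path:
  assumes "std_complex_BM z" "\<omega> \<in> space M"
  shows "continuous_on {0..} (\<lambda>t. z t \<omega>)" "z 0 \<omega> = 0"
proof -
  obtain b b' where b: "std_real_BM b" "std_real_BM b'"
    and zb: "\<And>t \<omega>. 0 \<le> t \<Longrightarrow> \<omega> \<in> space M \<Longrightarrow>
       z t \<omega> = (complex_of_real (b t \<omega>) + \<i> * complex_of_real (b' t \<omega>)) / complex_of_real (sqrt 2)"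
    using assms(1) unfolding std_complex_BM_def by blast
  have "continuous_on {0..} (\<lambda>t. (complex_of_real (b t \<omega>) + \<i> * complex_of_real (b' t \<omega>)) / complex_of_real (sqrt 2))"
    using b assms(2) by (intro continuous_intros) (auto simp: std_real_BM_def)
  then show "continuous_on {0..} (\<lambda>t. z t \<omega>)"
    by (rule continuous_on_eq) (use zb assms(2) in auto)
  show "z 0 \<omega> = 0" using b zb[of 0 \<omega>] assms(2) by (simp add: std_real_BM_def)
qed

text \<open>With \<open>z = (x + i y) / sqrt 2\<close>, convexity gives \<open>|z|\<^sup>8 = ((x\<^sup>2 + y\<^sup>2)/2)\<^sup>4 \<le> (x\<^sup>8 + y\<^sup>8)/2\<close>, and 105 is the
eighth moment of the standard normal law.\<close>

lemma complex_BM_eighth_moment: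
  assumes "std_complex_BM z" "0 \<le> s" "s \<le> t"
  shows "integrable M (\<lambda>\<omega>. cmod (z t \<omega> - z s \<omega>) ^ 8)"
    and "expectation (\<lambda>\<omega>. cmod (z t \<omega> - z s \<omega>) ^ 8) \<le> 105 * (t - s) ^ 4"
proof -
  obtain b b' where b: "std_real_BM b" "std_real_BM b'"
    and zb: "\<And>t \<omega>. 0 \<le> t \<Longrightarrow> \<omega> \<in> space M \<Longrightarrow>
       z t \<omega> = (complex_of_real (b t \<omega>) + \<i> * complex_of_real (b' t \<omega>)) / complex_of_real (sqrt 2)"
    using assms(1) unfolding std_complex_BM_def by blast
  have rv[measurable]: "random_variable borel (z t)" "random_variable borel (z s)"
    using complex_BM_rv[OF assms(1)] assms(2,3) by auto
  have "integrable M (\<lambda>\<omega>. cmod (z t \<omega> - z s \<omega>) ^ 8) \<and>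
    expectation (\<lambda>\<omega>. cmod (z t \<omega> - z s \<omega>) ^ 8) \<le> 105 * (t - s) ^ 4"
  proof (cases "s = t")
    case False
    then have "s < t" using assms by simp
    define x y where "x = (\<lambda>\<omega>. b t \<omega> - b s \<omega>)" and "y = (\<lambda>\<omega>. b' t \<omega> - b' s \<omega>)"
    have g: "centered_gaussian x (t - s)" "centered_gaussian y (t - s)"
      unfolding x_def y_def using real_BM_increment_gaussian b assms(2) \<open>s < t\<close> by auto
    have le: "cmod (z t \<omega> - z s \<omega>) ^ 8 \<le> (x \<omega> ^ 8 + y \<omega> ^ 8) / 2" if "\<omega> \<in> space M" for \<omega>
    proof -
      have "z t \<omega> - z s \<omega> = (complex_of_real (x \<omega>) + \<i> * complex_of_real (y \<omega>)) / complex_of_real (sqrt 2)"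
        using zb[of t \<omega>] zb[of s \<omega>] that assms(2,3) by (simp add: x_def y_def algebra_simps diff_divide_distrib add_divide_distrib)
      then have sq: "cmod (z t \<omega> - z s \<omega>) ^ 2 = ((x \<omega>)\<^sup>2 + (y \<omega>)\<^sup>2) / 2"
        by (simp add: cmod_power2 power_divide add_divide_distrib)
      have "cmod (z t \<omega> - z s \<omega>) ^ 8 = (cmod (z t \<omega> - z s \<omega>) ^ 2) ^ 4" by (simp flip: power_mult)
      also have "\<dots> = (((x \<omega>)\<^sup>2 + (y \<omega>)\<^sup>2) / 2) ^ 4" by (simp only: sq)
      also have "\<dots> = ((((x \<omega>)\<^sup>2 + (y \<omega>)\<^sup>2) / 2)\<^sup>2)\<^sup>2" by (simp flip: power_mult)
      also have "\<dots> \<le> (((x \<omega>) ^ 4 + (y \<omega>) ^ 4) / 2)\<^sup>2"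
      proof (rule power_mono)
        have "0 \<le> ((x \<omega>)\<^sup>2 - (y \<omega>)\<^sup>2)\<^sup>2" by simp
        then show "(((x \<omega>)\<^sup>2 + (y \<omega>)\<^sup>2) / 2)\<^sup>2 \<le> ((x \<omega>) ^ 4 + (y \<omega>) ^ 4) / 2"
          by (simp add: power2_eq_square field_simps eval_nat_numeral)
      qed simp
      also have "\<dots> \<le> (x \<omega> ^ 8 + y \<omega> ^ 8) / 2"
      proof -
        have "0 \<le> (((x \<omega>) ^ 4 - (y \<omega>) ^ 4))\<^sup>2" by simp
        then show ?thesis by (simp add: power2_eq_square field_simps eval_nat_numeral)
      qed
      finally show ?thesis .
    qed
    have int: "integrable M (\<lambda>\<omega>. (x \<omega> ^ 8 + y \<omega> ^ 8) / 2)"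
      using centered_gaussian_moment(1)[OF g(1)] centered_gaussian_moment(1)[OF g(2)] by simp
    have "(\<lambda>\<omega>. cmod (z t \<omega> - z s \<omega>) ^ 8) \<in> borel_measurable M" by measurable
    note dom = integral_dominated_nonneg[OF int this _ le]
    have "expectation (\<lambda>\<omega>. cmod (z t \<omega> - z s \<omega>) ^ 8) \<le> expectation (\<lambda>\<omega>. (x \<omega> ^ 8 + y \<omega> ^ 8) / 2)"
      by (rule dom(2)) simp
    also have "\<dots> = 105 * (t - s) ^ 4"
      using centered_gaussian_moment(1)[OF g(1)] centered_gaussian_moment(1)[OF g(2)]
        centered_gaussian_moments(5)[OF g(1)] centered_gaussian_moments(5)[OF g(2)] by simp
    finally show ?thesis using dom(1) by simp
  qed simp
  then show "integrable M (\<lambda>\<omega>. cmod (z t \<omega> - z s \<omega>) ^ 8)"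
    and "expectation (\<lambda>\<omega>. cmod (z t \<omega> - z s \<omega>) ^ 8) \<le> 105 * (t - s) ^ 4" by auto
qed

lemma path_family_gaussian:
  assumes ind: "indep_vars (\<lambda>_. path_algebra) (\<lambda>\<alpha>. path_of (z \<alpha>)) I" and I: "finite I"
    and g: "\<And>\<alpha>. \<alpha> \<in> I \<Longrightarrow> g \<alpha> \<in> borel_measurable path_algebra"
    and G: "\<And>\<alpha>. \<alpha> \<in> I \<Longrightarrow> centered_gaussian (\<lambda>\<omega>. g \<alpha> (path_of (z \<alpha>) \<omega>)) (v \<alpha>)"
  shows "centered_gaussian (\<lambda>\<omega>. \<Sum>\<alpha>\<in>I. g \<alpha> (path_of (z \<alpha>) \<omega>)) (\<Sum>\<alpha>\<in>I. v \<alpha>)"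
proof -
  have "indep_vars (\<lambda>_. borel) (\<lambda>\<alpha> \<omega>. g \<alpha> (path_of (z \<alpha>) \<omega>)) I"
    by (rule indep_vars_compose2[OF ind g])
  from centered_gaussian_sum[OF this G I] show ?thesis .
qed

end

section \<open>One column of the Laguerre matrix\<close>

locale complex_BM_column = prob_space +
  fixes a :: "'n::finite \<Rightarrow> real \<Rightarrow> 'a \<Rightarrow> complex"
  assumes BM: "std_complex_BM (a i)"
    and indep: "indep_vars (\<lambda>_. path_algebra) (\<lambda>i. path_of (a i)) UNIV"
begin

abbreviation \<xi> :: "real \<Rightarrow> 'a \<Rightarrow> complex^'n^'n" where
  "\<xi> t \<omega> \<equiv> centered_square (\<lambda>i. a i t \<omega>) t"

text \<open>The increment is at most \<open>D S + h N\<close>, where \<open>h = t - s\<close>, \<open>D\<close> collects the increments of the column and \<open>S\<close> its sizes.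
Weighting the two factors by powers of \<open>h\<close>, \<open>(D S)\<^sup>4 \<le> D\<^sup>8/h\<^sup>2 + h\<^sup>2 S\<^sup>8\<close>; as \<open>E D\<^sup>8\<close> is of order \<open>h\<^sup>4\<close> and
\<open>E S\<^sup>8\<close> is bounded, both terms are of order \<open>h\<^sup>2\<close>.\<close>

lemma column_increment_moment:
  assumes s: "s \<in> {0..T}" and t: "t \<in> {0..T}" and st: "s < t"
  shows "integrable M (\<lambda>\<omega>. norm (\<xi> t \<omega> - \<xi> s \<omega>) ^ 4)"
    and "expectation (\<lambda>\<omega>. norm (\<xi> t \<omega> - \<xi> s \<omega>) ^ 4) \<le> column_moment_bound (real CARD('n)) T * (t - s)\<^sup>2"
proof -
  let ?N = "real CARD('n)" and ?h = "t - s"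
  have h: "0 < ?h" "?h \<le> T" "0 < T" using s t st by auto
  have rv[measurable]: "random_variable borel (a i t)" "random_variable borel (a i s)" for i
    using complex_BM_rv[OF BM] s t by auto
  have rvx: "random_variable borel (\<lambda>\<omega>. \<xi> u \<omega> $ i $ p)" if "u = t \<or> u = s" for u i p
    using that unfolding centered_square_def by auto
  have [measurable]: "random_variable borel (\<xi> t)" "random_variable borel (\<xi> s)"
    by (auto intro!: borel_measurable_matrix rvx)
  define D where "D \<omega> = (\<Sum>i\<in>UNIV. cmod (a i t \<omega> - a i s \<omega>))" for \<omega>
  define S where "S \<omega> = (\<Sum>i\<in>UNIV. cmod (a i t \<omega>) + cmod (a i s \<omega>))" for \<omega>
  define D8 where "D8 \<omega> = (\<Sum>i\<in>UNIV. cmod (a i t \<omega> - a i s \<omega>) ^ 8)" for \<omega>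
  define S8 where "S8 \<omega> = (\<Sum>i\<in>UNIV. cmod (a i t \<omega> - a i 0 \<omega>) ^ 8 + cmod (a i s \<omega> - a i 0 \<omega>) ^ 8)" for \<omega>
  define R where "R \<omega> = 16 * (?N ^ 8 * D8 \<omega> / ?h\<^sup>2 + ?h\<^sup>2 * (256 * ?N ^ 8 * S8 \<omega>) + ?h ^ 4 * ?N ^ 4)" for \<omega>
  have D0: "0 \<le> D \<omega>" and S0: "0 \<le> S \<omega>" for \<omega> by (auto simp: D_def S_def intro!: sum_nonneg add_nonneg_nonneg)
  have D8: "D \<omega> ^ 8 \<le> ?N ^ 8 * D8 \<omega>" for \<omega>
    unfolding D_def D8_def by (rule sum_power_le) auto
  have S8: "S \<omega> ^ 8 \<le> 256 * ?N ^ 8 * S8 \<omega>" if "\<omega> \<in> space M" for \<omega>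
  proof -
    have "S \<omega> ^ 8 \<le> ?N ^ 8 * (\<Sum>i\<in>UNIV. (cmod (a i t \<omega>) + cmod (a i s \<omega>)) ^ 8)"
      unfolding S_def by (rule sum_power_le) auto
    also have "\<dots> \<le> ?N ^ 8 * (\<Sum>i\<in>UNIV. 2 ^ 8 * (cmod (a i t \<omega>) ^ 8 + cmod (a i s \<omega>) ^ 8))"
      by (intro mult_left_mono sum_mono add_power_le) auto
    also have "\<dots> = 256 * ?N ^ 8 * S8 \<omega>"
      using complex_BM_path(2)[OF BM that] by (simp add: S8_def sum_distrib_left mult_ac)
    finally show ?thesis .
  qed
  have le: "norm (\<xi> t \<omega> - \<xi> s \<omega>) ^ 4 \<le> R \<omega>" if \<omega>: "\<omega> \<in> space M" for \<omega>
  proof -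
    have "norm (\<xi> t \<omega> - \<xi> s \<omega>) \<le> D \<omega> * S \<omega> + \<bar>t - s\<bar> * ?N"
      unfolding D_def S_def by (rule norm_centered_square_diff_le)
    then have "norm (\<xi> t \<omega> - \<xi> s \<omega>) ^ 4 \<le> (D \<omega> * S \<omega> + ?h * ?N) ^ 4"
      using h by (intro power_mono) auto
    also have "\<dots> \<le> 2 ^ 4 * ((D \<omega> * S \<omega>) ^ 4 + (?h * ?N) ^ 4)"
      using D0 S0 h by (intro add_power_le mult_nonneg_nonneg) auto
    also have "(D \<omega> * S \<omega>) ^ 4 \<le> ?N ^ 8 * D8 \<omega> / ?h\<^sup>2 + ?h\<^sup>2 * (256 * ?N ^ 8 * S8 \<omega>)"
    proof -
      have "0 \<le> (D \<omega> ^ 4 / ?h - ?h * S \<omega> ^ 4)\<^sup>2 + (D \<omega> ^ 4 / ?h)\<^sup>2 + (?h * S \<omega> ^ 4)\<^sup>2" by simp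
      also have "\<dots> = 2 * (D \<omega> ^ 4 / ?h)\<^sup>2 + 2 * (?h * S \<omega> ^ 4)\<^sup>2 - 2 * (D \<omega> ^ 4 / ?h * (?h * S \<omega> ^ 4))"
        by (simp add: power2_diff)
      also have "D \<omega> ^ 4 / ?h * (?h * S \<omega> ^ 4) = (D \<omega> * S \<omega>) ^ 4"
        using h by (simp add: power_mult_distrib)
      also have "(D \<omega> ^ 4 / ?h)\<^sup>2 = D \<omega> ^ 8 / ?h\<^sup>2" by (simp add: power_divide flip: power_mult)
      also have "(?h * S \<omega> ^ 4)\<^sup>2 = ?h\<^sup>2 * S \<omega> ^ 8" by (simp add: power_mult_distrib flip: power_mult)
      finally have "(D \<omega> * S \<omega>) ^ 4 \<le> D \<omega> ^ 8 / ?h\<^sup>2 + ?h\<^sup>2 * S \<omega> ^ 8" by linarith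
      also have "\<dots> \<le> ?N ^ 8 * D8 \<omega> / ?h\<^sup>2 + ?h\<^sup>2 * (256 * ?N ^ 8 * S8 \<omega>)"
        using D8 S8[OF \<omega>] by (intro add_mono divide_right_mono mult_left_mono) auto
      finally show ?thesis .
    qed
    finally show ?thesis by (simp add: R_def power_mult_distrib)
  qed
  have m: "integrable M (\<lambda>\<omega>. cmod (a i t \<omega> - a i s \<omega>) ^ 8)" "integrable M (\<lambda>\<omega>. cmod (a i t \<omega> - a i 0 \<omega>) ^ 8)"
    "integrable M (\<lambda>\<omega>. cmod (a i s \<omega> - a i 0 \<omega>) ^ 8)" for i
    using complex_BM_eighth_moment(1)[OF BM] s t st by auto
  have intR: "integrable M R" unfolding R_def D8_def S8_def using m by simp
  have "(\<lambda>\<omega>. norm (\<xi> t \<omega> - \<xi> s \<omega>) ^ 4) \<in> borel_measurable M" by measurable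
  note dom = integral_dominated_nonneg[OF intR this _ le]
  show "integrable M (\<lambda>\<omega>. norm (\<xi> t \<omega> - \<xi> s \<omega>) ^ 4)" by (rule dom(1)) simp
  have ED: "expectation D8 \<le> ?N * (105 * ?h ^ 4)"
  proof -
    have "expectation D8 = (\<Sum>i\<in>UNIV. expectation (\<lambda>\<omega>. cmod (a i t \<omega> - a i s \<omega>) ^ 8))"
      unfolding D8_def using m by simp
    also have "\<dots> \<le> (\<Sum>i\<in>(UNIV::'n set). 105 * ?h ^ 4)"
      using complex_BM_eighth_moment(2)[OF BM] s st by (intro sum_mono) auto
    finally show ?thesis by simp
  qed
  have ES: "expectation S8 \<le> ?N * (210 * T ^ 4)"
  proof -
    have b: "expectation (\<lambda>\<omega>. cmod (a i u \<omega> - a i 0 \<omega>) ^ 8) \<le> 105 * T ^ 4" if "u \<in> {0..T}" for i u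
    proof -
      have "expectation (\<lambda>\<omega>. cmod (a i u \<omega> - a i 0 \<omega>) ^ 8) \<le> 105 * (u - 0) ^ 4"
        using that by (intro complex_BM_eighth_moment(2)[OF BM]) auto
      also have "\<dots> \<le> 105 * T ^ 4" using that by (intro mult_left_mono power_mono) auto
      finally show ?thesis .
    qed
    have "expectation S8 = (\<Sum>i\<in>UNIV. expectation (\<lambda>\<omega>. cmod (a i t \<omega> - a i 0 \<omega>) ^ 8) + expectation (\<lambda>\<omega>. cmod (a i s \<omega> - a i 0 \<omega>) ^ 8))"
      unfolding S8_def using m by simp
    also have "\<dots> \<le> (\<Sum>i\<in>(UNIV::'n set). 105 * T ^ 4 + 105 * T ^ 4)"
      using b s t by (intro sum_mono add_mono) auto
    finally show ?thesis by simp
  qed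
  have "expectation (\<lambda>\<omega>. norm (\<xi> t \<omega> - \<xi> s \<omega>) ^ 4) \<le> expectation R"
    by (rule dom(2)) simp
  also have "\<dots> = 16 * (?N ^ 8 * expectation D8 / ?h\<^sup>2 + ?h\<^sup>2 * (256 * ?N ^ 8 * expectation S8) + ?h ^ 4 * ?N ^ 4)"
  proof -
    have "integrable M D8" "integrable M S8" unfolding D8_def S8_def using m by simp_all
    then show ?thesis unfolding R_def by (simp add: prob_space)
  qed
  also have "\<dots> \<le> 16 * (?N ^ 8 * (?N * (105 * ?h ^ 4)) / ?h\<^sup>2 + ?h\<^sup>2 * (256 * ?N ^ 8 * (?N * (210 * T ^ 4))) + ?h\<^sup>2 * T\<^sup>2 * ?N ^ 4)"
  proof -
    have "?h ^ 4 = ?h\<^sup>2 * ?h\<^sup>2" by (simp flip: power_add)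
    also have "\<dots> \<le> ?h\<^sup>2 * T\<^sup>2" using h by (intro mult_left_mono power_mono) auto
    finally show ?thesis using ED ES by (intro mult_left_mono add_mono divide_right_mono mult_right_mono) auto
  qed
  also have "\<dots> = column_moment_bound ?N T * ?h\<^sup>2"
    by (rule column_moment_bound_alt) (use h in simp)
  finally show "expectation (\<lambda>\<omega>. norm (\<xi> t \<omega> - \<xi> s \<omega>) ^ 4) \<le> column_moment_bound ?N T * ?h\<^sup>2" .
qed

end

section \<open>Covariance of one column\<close>

context complex_BM_column
begin

lemma column_linear_gaussian:
  fixes \<tau> :: "nat \<Rightarrow> real"
  assumes \<tau>: "strict_mono (\<tau> :: nat \<Rightarrow> real)" "\<tau> 0 = 0"
  shows "centered_gaussian (\<lambda>\<omega>. \<Sum>i\<in>UNIV. \<Sum>k\<le>m. c i k \<bullet> a i (\<tau> k) \<omega>)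
           (\<Sum>i\<in>UNIV. (\<Sum>k\<le>m. \<Sum>l\<le>m. (c i k \<bullet> c i l) * min (\<tau> k) (\<tau> l)) / 2)"
proof -
  have nn: "0 \<le> \<tau> k" for k using strict_mono_less_eq[OF \<tau>(1), of 0 k] \<tau>(2) by simp
  have "centered_gaussian (\<lambda>\<omega>. \<Sum>i\<in>UNIV. (\<lambda>p. \<Sum>k\<le>m. c i k \<bullet> p (\<tau> k)) (path_of (a i) \<omega>))
           (\<Sum>i\<in>UNIV. (\<Sum>k\<le>m. \<Sum>l\<le>m. (c i k \<bullet> c i l) * min (\<tau> k) (\<tau> l)) / 2)"
  proof (rule path_family_gaussian[OF indep])
    fix i
    show "(\<lambda>p. \<Sum>k\<le>m. c i k \<bullet> p (\<tau> k)) \<in> borel_measurable path_algebra"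
      by (rule borel_measurable_path_sum) (use nn in auto)
    show "centered_gaussian (\<lambda>\<omega>. \<Sum>k\<le>m. c i k \<bullet> path_of (a i) \<omega> (\<tau> k))
        ((\<Sum>k\<le>m. \<Sum>l\<le>m. (c i k \<bullet> c i l) * min (\<tau> k) (\<tau> l)) / 2)"
      using complex_BM_linear_combination_gaussian[OF BM \<tau>] by (simp add: path_of_apply nn)
  qed simp
  then show ?thesis by (simp add: path_of_apply nn)
qed

text \<open>The real linear functionals of the column at the times \<open>\<tau> 0, \<dots>, \<tau> m\<close>; independence of the entries makes them
a Gaussian space, to which Wick's formula applies.\<close>

definition column_span :: "nat \<Rightarrow> (nat \<Rightarrow> real) \<Rightarrow> ('a \<Rightarrow> real) set" where
  "column_span m \<tau> = {(\<lambda>\<omega>. \<Sum>i\<in>UNIV. \<Sum>k\<le>m. c i k \<bullet> a i (\<tau> k) \<omega>) | c. True}"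

lemma column_spanI: "(\<lambda>\<omega>. \<Sum>i\<in>UNIV. \<Sum>k\<le>m. c i k \<bullet> a i (\<tau> k) \<omega>) \<in> column_span m \<tau>"
  by (auto simp: column_span_def)

lemma gaussian_space_column_span:
  assumes \<tau>: "strict_mono (\<tau> :: nat \<Rightarrow> real)" "\<tau> 0 = 0"
  shows "gaussian_space M (column_span m \<tau>)"
proof
  fix X Y assume "X \<in> column_span m \<tau>" "Y \<in> column_span m \<tau>"
  then obtain c d where "X = (\<lambda>\<omega>. \<Sum>i\<in>UNIV. \<Sum>k\<le>m. c i k \<bullet> a i (\<tau> k) \<omega>)"
    "Y = (\<lambda>\<omega>. \<Sum>i\<in>UNIV. \<Sum>k\<le>m. d i k \<bullet> a i (\<tau> k) \<omega>)"
    unfolding column_span_def by blast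
  then have "(\<lambda>\<omega>. X \<omega> + Y \<omega>) = (\<lambda>\<omega>. \<Sum>i\<in>UNIV. \<Sum>k\<le>m. (c i k + d i k) \<bullet> a i (\<tau> k) \<omega>)"
    by (simp add: inner_add_left sum.distrib)
  then show "(\<lambda>\<omega>. X \<omega> + Y \<omega>) \<in> column_span m \<tau>"
    using column_spanI[where m=m and c="\<lambda>i k. c i k + d i k"] by simp
next
  fix X s assume "X \<in> column_span m \<tau>"
  then obtain c where "X = (\<lambda>\<omega>. \<Sum>i\<in>UNIV. \<Sum>k\<le>m. c i k \<bullet> a i (\<tau> k) \<omega>)"
    unfolding column_span_def by blast
  then have "(\<lambda>\<omega>. s * X \<omega>) = (\<lambda>\<omega>. \<Sum>i\<in>UNIV. \<Sum>k\<le>m. (s *\<^sub>R c i k) \<bullet> a i (\<tau> k) \<omega>)"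
    by (simp add: sum_distrib_left)
  then show "(\<lambda>\<omega>. s * X \<omega>) \<in> column_span m \<tau>"
    using column_spanI[where m=m and c="\<lambda>i k. s *\<^sub>R c i k"] by simp
next
  fix X assume "X \<in> column_span m \<tau>"
  then show "\<exists>v. centered_gaussian X v"
    unfolding column_span_def using column_linear_gaussian[OF \<tau>] by blast
qed

lemma column_span_entry:
  assumes "k \<le> m"
  shows "(\<lambda>\<omega>. c \<bullet> a i (\<tau> k) \<omega>) \<in> column_span m \<tau>"
proof -
  have "(\<Sum>l\<le>m. (if j = i \<and> l = k then c else 0) \<bullet> a j (\<tau> l) \<omega>) = (if j = i then c \<bullet> a i (\<tau> k) \<omega> else 0)" for j \<omega>
    using assms by (simp add: if_distrib[of "\<lambda>x. x \<bullet> _"] cong: if_cong)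
  then have "(\<lambda>\<omega>. c \<bullet> a i (\<tau> k) \<omega>) =
     (\<lambda>\<omega>. \<Sum>j\<in>UNIV. \<Sum>l\<le>m. (if j = i \<and> l = k then c else 0) \<bullet> a j (\<tau> l) \<omega>)"
    by simp
  then show ?thesis using column_spanI[where m=m and c="\<lambda>j l. if j = i \<and> l = k then c else 0"] by simp
qed

text \<open>The variance of \<open>x + s y\<close> is known for \<open>s = 1\<close> and \<open>s = -1\<close>, which gives the covariance of \<open>x\<close> and \<open>y\<close> by
polarization.\<close>

lemma entry_covariance_real:
  assumes \<tau>: "strict_mono (\<tau> :: nat \<Rightarrow> real)" "\<tau> 0 = 0"
  shows "expectation (\<lambda>\<omega>. (c \<bullet> a i (\<tau> k) \<omega>) * (d \<bullet> a j (\<tau> l) \<omega>)) = (if i = j then (c \<bullet> d) * min (\<tau> k) (\<tau> l) / 2 else 0)"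
    and "integrable M (\<lambda>\<omega>. (c \<bullet> a i (\<tau> k) \<omega>) * (d \<bullet> a j (\<tau> l) \<omega>))"
proof -
  define m where "m = max k l"
  have km: "k \<le> m" "l \<le> m" by (auto simp: m_def)
  interpret gaussian_space M "column_span m \<tau>" by (rule gaussian_space_column_span[OF \<tau>])
  show "integrable M (\<lambda>\<omega>. (c \<bullet> a i (\<tau> k) \<omega>) * (d \<bullet> a j (\<tau> l) \<omega>))"
    by (intro G_integrable_mult column_span_entry km)
  define x where "x = (\<lambda>\<omega>. c \<bullet> a i (\<tau> k) \<omega>)"
  define y where "y = (\<lambda>\<omega>. d \<bullet> a j (\<tau> l) \<omega>)"
  \<comment> \<open>The coefficients of \<open>x + s y\<close> as an element of the span.\<close>
  define u where "u s j' l' = (if j' = i \<and> l' = k then c else 0) + s *\<^sub>R (if j' = j \<and> l' = l then d else 0)" for s :: real and j' l'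
  have lin: "(\<Sum>j'\<in>UNIV. \<Sum>l'\<le>m. u s j' l' \<bullet> w j' l') = c \<bullet> w i k + s * (d \<bullet> w j l)" for s and w :: "'n \<Rightarrow> nat \<Rightarrow> complex"
  proof -
    have 1: "(\<Sum>l'\<le>m. (if j' = i \<and> l' = k then c else 0) \<bullet> w j' l') = (if j' = i then c \<bullet> w i k else 0)" for j'
      using km by (simp add: if_distrib[of "\<lambda>x. x \<bullet> _"] cong: if_cong)
    have 2: "(\<Sum>l'\<le>m. (if j' = j \<and> l' = l then d else 0) \<bullet> w j' l') = (if j' = j then d \<bullet> w j l else 0)" for j'
      using km by (simp add: if_distrib[of "\<lambda>x. x \<bullet> _"] cong: if_cong)
    have "(\<Sum>j'\<in>UNIV. \<Sum>l'\<le>m. u s j' l' \<bullet> w j' l') =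
       (\<Sum>j'\<in>UNIV. (\<Sum>l'\<le>m. (if j' = i \<and> l' = k then c else 0) \<bullet> w j' l')
          + s * (\<Sum>l'\<le>m. (if j' = j \<and> l' = l then d else 0) \<bullet> w j' l'))"
      by (simp only: u_def inner_add_left inner_scaleR_left sum.distrib sum_distrib_left)
    also have "\<dots> = c \<bullet> w i k + s * (d \<bullet> w j l)"
      unfolding 1 2 by (simp add: sum.distrib sum_distrib_left[symmetric])
    finally show ?thesis .
  qed
  have var: "expectation (\<lambda>\<omega>. (x \<omega> + s * y \<omega>)\<^sup>2) =
     ((c \<bullet> c) * \<tau> k + s\<^sup>2 * (d \<bullet> d) * \<tau> l + 2 * s * (if i = j then (c \<bullet> d) * min (\<tau> k) (\<tau> l) else 0)) / 2" for s
  proof -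
    have ls: "(\<Sum>l'\<le>m. min r (\<tau> l') *\<^sub>R u s j' l') = (if j' = i then min r (\<tau> k) *\<^sub>R c else 0) + (if j' = j then (s * min r (\<tau> l)) *\<^sub>R d else 0)" for r j'
    proof -
      have "(\<Sum>l'\<le>m. min r (\<tau> l') *\<^sub>R u s j' l') =
         (\<Sum>l'\<le>m. if l' = k then (if j' = i then min r (\<tau> k) *\<^sub>R c else 0) else 0)
       + (\<Sum>l'\<le>m. if l' = l then (if j' = j then (s * min r (\<tau> l)) *\<^sub>R d else 0) else 0)"
        unfolding sum.distrib[symmetric] by (intro sum.cong refl) (auto simp: u_def scaleR_add_right)
      then show ?thesis using km by simp
    qed
    have "(\<lambda>\<omega>. x \<omega> + s * y \<omega>) = (\<lambda>\<omega>. \<Sum>j'\<in>UNIV. \<Sum>l'\<le>m. u s j' l' \<bullet> a j' (\<tau> l') \<omega>)"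
      unfolding x_def y_def lin ..
    then have "centered_gaussian (\<lambda>\<omega>. x \<omega> + s * y \<omega>)
       (\<Sum>i'\<in>UNIV. (\<Sum>k'\<le>m. \<Sum>l'\<le>m. (u s i' k' \<bullet> u s i' l') * min (\<tau> k') (\<tau> l')) / 2)"
      using column_linear_gaussian[OF \<tau>, where m=m and c="u s"] by simp
    from centered_gaussian_moments(3)[OF this]
    have "expectation (\<lambda>\<omega>. (x \<omega> + s * y \<omega>)\<^sup>2) =
       (\<Sum>i'\<in>UNIV. (\<Sum>k'\<le>m. \<Sum>l'\<le>m. (u s i' k' \<bullet> u s i' l') * min (\<tau> k') (\<tau> l')) / 2)" .
    also have "\<dots> = (\<Sum>i'\<in>UNIV. \<Sum>k'\<le>m. u s i' k' \<bullet> (\<Sum>l'\<le>m. min (\<tau> k') (\<tau> l') *\<^sub>R u s i' l')) / 2"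
      by (simp add: inner_sum_right sum_divide_distrib mult.commute)
    also have "\<dots> = (c \<bullet> (\<Sum>l'\<le>m. min (\<tau> k) (\<tau> l') *\<^sub>R u s i l') + s * (d \<bullet> (\<Sum>l'\<le>m. min (\<tau> l) (\<tau> l') *\<^sub>R u s j l'))) / 2"
      by (subst lin) simp
    also have "\<dots> = ((c \<bullet> c) * \<tau> k + s\<^sup>2 * (d \<bullet> d) * \<tau> l + 2 * s * (if i = j then (c \<bullet> d) * min (\<tau> k) (\<tau> l) else 0)) / 2"
      unfolding ls
      by (auto simp: inner_add_right power2_eq_square algebra_simps inner_commute[of d c] min.commute)
    finally show ?thesis .
  qed
  have G: "x \<in> column_span m \<tau>" "y \<in> column_span m \<tau>"
    unfolding x_def y_def by (intro column_span_entry km)+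
  have Gs: "(\<lambda>\<omega>. x \<omega> + s * y \<omega>) \<in> column_span m \<tau>" for s by (intro G_add G_scale G)
  have "expectation (\<lambda>\<omega>. x \<omega> * y \<omega>) = expectation (\<lambda>\<omega>. ((x \<omega> + 1 * y \<omega>)\<^sup>2 - (x \<omega> + (-1) * y \<omega>)\<^sup>2) / 4)"
    by (intro Bochner_Integration.integral_cong) (auto simp: power2_eq_square algebra_simps)
  also have "\<dots> = (expectation (\<lambda>\<omega>. (x \<omega> + 1 * y \<omega>)\<^sup>2) - expectation (\<lambda>\<omega>. (x \<omega> + (-1) * y \<omega>)\<^sup>2)) / 4"
    using G_fourth_moment(1)[OF Gs[of 1]] G_fourth_moment(1)[OF Gs[of "-1"]] by simp
  also have "\<dots> = (if i = j then (c \<bullet> d) * min (\<tau> k) (\<tau> l) / 2 else 0)"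
    unfolding var by (simp add: field_simps)
  finally show "expectation (\<lambda>\<omega>. (c \<bullet> a i (\<tau> k) \<omega>) * (d \<bullet> a j (\<tau> l) \<omega>)) = (if i = j then (c \<bullet> d) * min (\<tau> k) (\<tau> l) / 2 else 0)"
    unfolding x_def y_def .
qed

lemma complex_expectation_mult:
  fixes z w :: "'a \<Rightarrow> complex"
  assumes "integrable M (\<lambda>\<omega>. Re (z \<omega>) * Re (w \<omega>))" "integrable M (\<lambda>\<omega>. Im (z \<omega>) * Im (w \<omega>))"
    "integrable M (\<lambda>\<omega>. Re (z \<omega>) * Im (w \<omega>))" "integrable M (\<lambda>\<omega>. Im (z \<omega>) * Re (w \<omega>))"
  shows "integrable M (\<lambda>\<omega>. z \<omega> * w \<omega>)"
    and "(\<integral>\<omega>. z \<omega> * w \<omega> \<partial>M) =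
      complex_of_real (expectation (\<lambda>\<omega>. Re (z \<omega>) * Re (w \<omega>)) - expectation (\<lambda>\<omega>. Im (z \<omega>) * Im (w \<omega>)))
      + \<i> * complex_of_real (expectation (\<lambda>\<omega>. Re (z \<omega>) * Im (w \<omega>)) + expectation (\<lambda>\<omega>. Im (z \<omega>) * Re (w \<omega>)))"
proof -
  have eq: "(\<lambda>\<omega>. z \<omega> * w \<omega>) = (\<lambda>\<omega>. complex_of_real (Re (z \<omega>) * Re (w \<omega>) - Im (z \<omega>) * Im (w \<omega>))
     + \<i> * complex_of_real (Re (z \<omega>) * Im (w \<omega>) + Im (z \<omega>) * Re (w \<omega>)))"
    by (auto simp: complex_eq_iff)
  have i: "integrable M (\<lambda>\<omega>. complex_of_real (Re (z \<omega>) * Re (w \<omega>) - Im (z \<omega>) * Im (w \<omega>)))"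
    "integrable M (\<lambda>\<omega>. \<i> * complex_of_real (Re (z \<omega>) * Im (w \<omega>) + Im (z \<omega>) * Re (w \<omega>)))"
    using assms by (auto simp del: of_real_diff of_real_add of_real_mult)
  show "integrable M (\<lambda>\<omega>. z \<omega> * w \<omega>)" unfolding eq using i by (rule Bochner_Integration.integrable_add)
  show "(\<integral>\<omega>. z \<omega> * w \<omega> \<partial>M) =
      complex_of_real (expectation (\<lambda>\<omega>. Re (z \<omega>) * Re (w \<omega>)) - expectation (\<lambda>\<omega>. Im (z \<omega>) * Im (w \<omega>)))
      + \<i> * complex_of_real (expectation (\<lambda>\<omega>. Re (z \<omega>) * Im (w \<omega>)) + expectation (\<lambda>\<omega>. Im (z \<omega>) * Re (w \<omega>)))"
    unfolding eq Bochner_Integration.integral_add[OF i] integral_mult_right_zero integral_complex_of_real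
    using assms by simp
qed

lemma entry_covariance:
  assumes \<tau>: "strict_mono (\<tau> :: nat \<Rightarrow> real)" "\<tau> 0 = 0"
  shows "(\<integral>\<omega>. a i (\<tau> k) \<omega> * a j (\<tau> l) \<omega> \<partial>M) = 0"
    "(\<integral>\<omega>. cnj (a i (\<tau> k) \<omega>) * cnj (a j (\<tau> l) \<omega>) \<partial>M) = 0"
    "(\<integral>\<omega>. a i (\<tau> k) \<omega> * cnj (a j (\<tau> l) \<omega>) \<partial>M) = (if i = j then complex_of_real (min (\<tau> k) (\<tau> l)) else 0)"
    "(\<integral>\<omega>. cnj (a i (\<tau> k) \<omega>) * a j (\<tau> l) \<omega> \<partial>M) = (if i = j then complex_of_real (min (\<tau> k) (\<tau> l)) else 0)"
    "integrable M (\<lambda>\<omega>. a i (\<tau> k) \<omega> * cnj (a j (\<tau> l) \<omega>))"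
proof -
  have ReIm: "Re z = 1 \<bullet> z" "Im z = \<i> \<bullet> z" for z :: complex by (simp_all add: inner_complex_def)
  have i: "integrable M (\<lambda>\<omega>. Re (a i (\<tau> k) \<omega>) * Re (a j (\<tau> l) \<omega>))" "integrable M (\<lambda>\<omega>. Im (a i (\<tau> k) \<omega>) * Im (a j (\<tau> l) \<omega>))"
    "integrable M (\<lambda>\<omega>. Re (a i (\<tau> k) \<omega>) * Im (a j (\<tau> l) \<omega>))" "integrable M (\<lambda>\<omega>. Im (a i (\<tau> k) \<omega>) * Re (a j (\<tau> l) \<omega>))"
    unfolding ReIm by (rule entry_covariance_real(2)[OF \<tau>])+
  have e: "expectation (\<lambda>\<omega>. Re (a i (\<tau> k) \<omega>) * Re (a j (\<tau> l) \<omega>)) = (if i = j then min (\<tau> k) (\<tau> l) / 2 else 0)"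
    "expectation (\<lambda>\<omega>. Im (a i (\<tau> k) \<omega>) * Im (a j (\<tau> l) \<omega>)) = (if i = j then min (\<tau> k) (\<tau> l) / 2 else 0)"
    "expectation (\<lambda>\<omega>. Re (a i (\<tau> k) \<omega>) * Im (a j (\<tau> l) \<omega>)) = 0"
    "expectation (\<lambda>\<omega>. Im (a i (\<tau> k) \<omega>) * Re (a j (\<tau> l) \<omega>)) = 0"
    unfolding ReIm entry_covariance_real(1)[OF \<tau>] by (simp_all add: inner_complex_def)
  show "(\<integral>\<omega>. a i (\<tau> k) \<omega> * a j (\<tau> l) \<omega> \<partial>M) = 0"
    by (subst complex_expectation_mult(2)) (use i e in simp_all)
  show "(\<integral>\<omega>. cnj (a i (\<tau> k) \<omega>) * cnj (a j (\<tau> l) \<omega>) \<partial>M) = 0"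
    by (subst complex_expectation_mult(2)) (use i e in simp_all)
  show "(\<integral>\<omega>. a i (\<tau> k) \<omega> * cnj (a j (\<tau> l) \<omega>) \<partial>M) = (if i = j then complex_of_real (min (\<tau> k) (\<tau> l)) else 0)"
    by (subst complex_expectation_mult(2)) (use i e in simp_all)
  show "(\<integral>\<omega>. cnj (a i (\<tau> k) \<omega>) * a j (\<tau> l) \<omega> \<partial>M) = (if i = j then complex_of_real (min (\<tau> k) (\<tau> l)) else 0)"
    by (subst complex_expectation_mult(2)) (use i e in simp_all)
  show "integrable M (\<lambda>\<omega>. a i (\<tau> k) \<omega> * cnj (a j (\<tau> l) \<omega>))"
    by (rule complex_expectation_mult(1)) (use i in simp_all)
qed

text \<open>Of the three pairings in Wick's formula, the one within each factor cancels against the centering, the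
one of \<open>a\<^sub>i\<close> with \<open>a\<^sub>q\<close> vanishes because \<open>E[a a] = 0\<close> for complex Brownian motion, and the remaining one
gives \<open>\<delta>\<^sub>i\<^sub>r \<delta>\<^sub>p\<^sub>q min(s,t)\<^sup>2\<close>.\<close>

lemma \<xi>_entry_moments:
  assumes \<tau>: "strict_mono (\<tau> :: nat \<Rightarrow> real)" "\<tau> 0 = 0"
  shows "integrable M (\<lambda>\<omega>. \<xi> (\<tau> k) \<omega> $ i $ p)" "(\<integral>\<omega>. \<xi> (\<tau> k) \<omega> $ i $ p \<partial>M) = 0"
    "integrable M (\<lambda>\<omega>. \<xi> (\<tau> k) \<omega> $ i $ p * \<xi> (\<tau> l) \<omega> $ q $ r)"
    "(\<integral>\<omega>. \<xi> (\<tau> k) \<omega> $ i $ p * \<xi> (\<tau> l) \<omega> $ q $ r \<partial>M)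
       = (if i = r \<and> p = q then (complex_of_real (min (\<tau> k) (\<tau> l)))\<^sup>2 else 0)"
proof -
  note cov = entry_covariance[OF \<tau>]
  show "integrable M (\<lambda>\<omega>. \<xi> (\<tau> k) \<omega> $ i $ p)" unfolding centered_square_entry using cov(5) by simp
  show "(\<integral>\<omega>. \<xi> (\<tau> k) \<omega> $ i $ p \<partial>M) = 0"
    unfolding centered_square_entry using cov(3)[of i k p k] cov(5)[of i k p k] by (simp add: prob_space)
  define m where "m = max k l"
  interpret gaussian_space M "column_span m \<tau>" by (rule gaussian_space_column_span[OF \<tau>])
  have km: "k \<le> m" "l \<le> m" by (auto simp: m_def)
  have ReIm: "Re z = 1 \<bullet> z" "Im z = \<i> \<bullet> z" for z :: complex by (simp_all add: inner_complex_def)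
  have G: "(\<lambda>\<omega>. Re (a i (\<tau> k') \<omega>)) \<in> column_span m \<tau> \<and> (\<lambda>\<omega>. Im (a i (\<tau> k') \<omega>)) \<in> column_span m \<tau>
     \<and> (\<lambda>\<omega>. - Im (a i (\<tau> k') \<omega>)) \<in> column_span m \<tau>" if "k' \<le> m" for i k'
    using column_span_entry[OF that, of 1] column_span_entry[OF that, of \<i>] column_span_entry[OF that, of "- \<i>"]
    by (simp add: inner_complex_def)
  let ?z1 = "\<lambda>\<omega>. a i (\<tau> k) \<omega>" and ?z2 = "\<lambda>\<omega>. cnj (a p (\<tau> k) \<omega>)"
    and ?z3 = "\<lambda>\<omega>. a q (\<tau> l) \<omega>" and ?z4 = "\<lambda>\<omega>. cnj (a r (\<tau> l) \<omega>)"
  have "wick ?z1 ?z2 ?z3 ?z4"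
    by (rule wick_complex) (use G km in auto)
  then have int4: "integrable M (\<lambda>\<omega>. ?z1 \<omega> * ?z2 \<omega> * ?z3 \<omega> * ?z4 \<omega>)"
    and E4: "(\<integral>\<omega>. ?z1 \<omega> * ?z2 \<omega> * ?z3 \<omega> * ?z4 \<omega> \<partial>M) =
       (if i = p then complex_of_real (\<tau> k) else 0) * (if q = r then complex_of_real (\<tau> l) else 0)
       + (if i = r then complex_of_real (min (\<tau> k) (\<tau> l)) else 0) * (if p = q then complex_of_real (min (\<tau> k) (\<tau> l)) else 0)"
    unfolding wick_def cov by simp_all
  let ?u = "if i = p then complex_of_real (\<tau> k) else 0" and ?v = "if q = r then complex_of_real (\<tau> l) else 0"
  have eq: "(\<lambda>\<omega>. \<xi> (\<tau> k) \<omega> $ i $ p * \<xi> (\<tau> l) \<omega> $ q $ r) =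
     (\<lambda>\<omega>. ?z1 \<omega> * ?z2 \<omega> * ?z3 \<omega> * ?z4 \<omega> - ?v * (?z1 \<omega> * ?z2 \<omega>) - ?u * (?z3 \<omega> * ?z4 \<omega>) + ?u * ?v)"
    unfolding centered_square_entry by (rule ext) (simp add: algebra_simps)
  note ints = int4 integrable_mult_right[OF cov(5)[of i k p k], of ?v] integrable_mult_right[OF cov(5)[of q l r l], of ?u]
  show "integrable M (\<lambda>\<omega>. \<xi> (\<tau> k) \<omega> $ i $ p * \<xi> (\<tau> l) \<omega> $ q $ r)"
    unfolding eq by (intro Bochner_Integration.integrable_add Bochner_Integration.integrable_diff ints) simp
  have "(\<integral>\<omega>. \<xi> (\<tau> k) \<omega> $ i $ p * \<xi> (\<tau> l) \<omega> $ q $ r \<partial>M) =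
     (\<integral>\<omega>. ?z1 \<omega> * ?z2 \<omega> * ?z3 \<omega> * ?z4 \<omega> \<partial>M) - ?v * (\<integral>\<omega>. ?z1 \<omega> * ?z2 \<omega> \<partial>M)
       - ?u * (\<integral>\<omega>. ?z3 \<omega> * ?z4 \<omega> \<partial>M) + ?u * ?v"
    unfolding eq
    apply (subst Bochner_Integration.integral_add)
      apply (intro Bochner_Integration.integrable_diff ints)
     apply simp
    apply (subst Bochner_Integration.integral_diff)
      apply (intro Bochner_Integration.integrable_diff ints)
     apply (intro ints)
    apply (subst Bochner_Integration.integral_diff)
      apply (intro ints)+
    apply (simp only: integral_mult_right_zero lebesgue_integral_const prob_space scaleR_one)
    done
  also have "\<dots> = (if i = r \<and> p = q then (complex_of_real (min (\<tau> k) (\<tau> l)))\<^sup>2 else 0)"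
    unfolding E4 cov by (simp add: power2_eq_square)
  finally show "(\<integral>\<omega>. \<xi> (\<tau> k) \<omega> $ i $ p * \<xi> (\<tau> l) \<omega> $ q $ r \<partial>M)
       = (if i = r \<and> p = q then (complex_of_real (min (\<tau> k) (\<tau> l)))\<^sup>2 else 0)" .
qed

lemma inner_\<xi>_moments:
  assumes \<tau>: "strict_mono (\<tau> :: nat \<Rightarrow> real)" "\<tau> 0 = 0"
    and U: "U \<in> hermitian_matrices" and V: "V \<in> hermitian_matrices"
  shows "integrable M (\<lambda>\<omega>. U \<bullet> \<xi> (\<tau> k) \<omega>)" "expectation (\<lambda>\<omega>. U \<bullet> \<xi> (\<tau> k) \<omega>) = 0"
    "integrable M (\<lambda>\<omega>. (U \<bullet> \<xi> (\<tau> k) \<omega>) * (V \<bullet> \<xi> (\<tau> l) \<omega>))"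
    "expectation (\<lambda>\<omega>. (U \<bullet> \<xi> (\<tau> k) \<omega>) * (V \<bullet> \<xi> (\<tau> l) \<omega>)) = (min (\<tau> k) (\<tau> l))\<^sup>2 * (U \<bullet> V)"
proof -
  note m = \<xi>_entry_moments[OF \<tau>]
  note h = inner_hermitian_matrices[OF U centered_square_hermitian] inner_hermitian_matrices[OF V centered_square_hermitian]
  have 1: "(\<lambda>\<omega>. complex_of_real (U \<bullet> \<xi> (\<tau> k) \<omega>)) = (\<lambda>\<omega>. \<Sum>i\<in>UNIV. \<Sum>p\<in>UNIV. cnj (U $ i $ p) * \<xi> (\<tau> k) \<omega> $ i $ p)"
    unfolding h ..
  have i1: "integrable M (\<lambda>\<omega>. complex_of_real (U \<bullet> \<xi> (\<tau> k) \<omega>))"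
    unfolding 1 by (intro Bochner_Integration.integrable_sum integrable_mult_right m(1))
  then show "integrable M (\<lambda>\<omega>. U \<bullet> \<xi> (\<tau> k) \<omega>)" by (simp add: complex_of_real_integrable_eq)
  have "complex_of_real (expectation (\<lambda>\<omega>. U \<bullet> \<xi> (\<tau> k) \<omega>)) = (\<integral>\<omega>. complex_of_real (U \<bullet> \<xi> (\<tau> k) \<omega>) \<partial>M)"
    by (rule integral_complex_of_real[symmetric])
  also have "\<dots> = (\<Sum>i\<in>UNIV. \<Sum>p\<in>UNIV. cnj (U $ i $ p) * (\<integral>\<omega>. \<xi> (\<tau> k) \<omega> $ i $ p \<partial>M))"
    unfolding 1 by (simp add: m(1))
  finally show "expectation (\<lambda>\<omega>. U \<bullet> \<xi> (\<tau> k) \<omega>) = 0" by (simp add: m(2))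
  have 2: "(\<lambda>\<omega>. complex_of_real ((U \<bullet> \<xi> (\<tau> k) \<omega>) * (V \<bullet> \<xi> (\<tau> l) \<omega>))) =
     (\<lambda>\<omega>. \<Sum>i\<in>UNIV. \<Sum>p\<in>UNIV. \<Sum>q\<in>UNIV. \<Sum>r\<in>UNIV. cnj (U $ i $ p) * cnj (V $ q $ r) * (\<xi> (\<tau> k) \<omega> $ i $ p * \<xi> (\<tau> l) \<omega> $ q $ r))"
    unfolding of_real_mult h sum_distrib_right
    unfolding sum_distrib_left
    by (simp only: mult_ac)
  have i2: "integrable M (\<lambda>\<omega>. complex_of_real ((U \<bullet> \<xi> (\<tau> k) \<omega>) * (V \<bullet> \<xi> (\<tau> l) \<omega>)))"
    unfolding 2 by (intro Bochner_Integration.integrable_sum integrable_mult_right m(3))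
  then show "integrable M (\<lambda>\<omega>. (U \<bullet> \<xi> (\<tau> k) \<omega>) * (V \<bullet> \<xi> (\<tau> l) \<omega>))" by (simp only: complex_of_real_integrable_eq)
  have "complex_of_real (expectation (\<lambda>\<omega>. (U \<bullet> \<xi> (\<tau> k) \<omega>) * (V \<bullet> \<xi> (\<tau> l) \<omega>)))
      = (\<integral>\<omega>. complex_of_real ((U \<bullet> \<xi> (\<tau> k) \<omega>) * (V \<bullet> \<xi> (\<tau> l) \<omega>)) \<partial>M)"
    by (rule integral_complex_of_real[symmetric])
  also have "\<dots> = (\<Sum>i\<in>UNIV. \<Sum>p\<in>UNIV. \<Sum>q\<in>UNIV. \<Sum>r\<in>UNIV. cnj (U $ i $ p) * cnj (V $ q $ r) *
       (\<integral>\<omega>. \<xi> (\<tau> k) \<omega> $ i $ p * \<xi> (\<tau> l) \<omega> $ q $ r \<partial>M))"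
    unfolding 2 by (simp add: m(3) del: mult.assoc)
  also have "\<dots> = (\<Sum>i\<in>UNIV. \<Sum>p\<in>UNIV. cnj (U $ i $ p) * cnj (V $ p $ i) * (complex_of_real (min (\<tau> k) (\<tau> l)))\<^sup>2)"
  proof (intro sum.cong refl)
    fix i p
    have "(\<Sum>q\<in>UNIV. \<Sum>r\<in>UNIV. cnj (U $ i $ p) * cnj (V $ q $ r) * (\<integral>\<omega>. \<xi> (\<tau> k) \<omega> $ i $ p * \<xi> (\<tau> l) \<omega> $ q $ r \<partial>M))
       = (\<Sum>q\<in>UNIV. \<Sum>r\<in>UNIV. if r = i then (if q = p then cnj (U $ i $ p) * cnj (V $ p $ i) * (complex_of_real (min (\<tau> k) (\<tau> l)))\<^sup>2 else 0) else 0)"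
      unfolding m(4) by (intro sum.cong refl) auto
    then show "(\<Sum>q\<in>UNIV. \<Sum>r\<in>UNIV. cnj (U $ i $ p) * cnj (V $ q $ r) * (\<integral>\<omega>. \<xi> (\<tau> k) \<omega> $ i $ p * \<xi> (\<tau> l) \<omega> $ q $ r \<partial>M))
       = cnj (U $ i $ p) * cnj (V $ p $ i) * (complex_of_real (min (\<tau> k) (\<tau> l)))\<^sup>2" by simp
  qed
  also have "\<dots> = (\<Sum>i\<in>UNIV. \<Sum>p\<in>UNIV. cnj (U $ i $ p) * V $ i $ p) * (complex_of_real (min (\<tau> k) (\<tau> l)))\<^sup>2"
  proof -
    have "cnj (V $ p $ i) = V $ i $ p" for i p
      by (rule sym) (use V in \<open>unfold hermitian_matrices_def, blast\<close>)
    then show ?thesis by (simp add: sum_distrib_right)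
  qed
  also have "\<dots> = complex_of_real ((min (\<tau> k) (\<tau> l))\<^sup>2 * (U \<bullet> V))"
    unfolding inner_hermitian_matrices[OF U V, symmetric] by simp
  finally show "expectation (\<lambda>\<omega>. (U \<bullet> \<xi> (\<tau> k) \<omega>) * (V \<bullet> \<xi> (\<tau> l) \<omega>)) = (min (\<tau> k) (\<tau> l))\<^sup>2 * (U \<bullet> V)"
    by (simp only: of_real_eq_iff)
qed

end

section \<open>Sums of independent variables\<close>

context prob_space
begin

lemma integrable_lower_power:
  fixes X :: "'a \<Rightarrow> real"
  assumes [measurable]: "random_variable borel X" and "integrable M (\<lambda>\<omega>. X \<omega> ^ 4)" and "k \<le> 4"
  shows "integrable M (\<lambda>\<omega>. X \<omega> ^ k)"
proof (rule Bochner_Integration.integrable_bound)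
  show "integrable M (\<lambda>\<omega>. 1 + X \<omega> ^ 4)" using assms by simp
  show "AE \<omega> in M. norm (X \<omega> ^ k) \<le> norm (1 + X \<omega> ^ 4)"
  proof (rule AE_I2)
    fix \<omega>
    have "\<bar>X \<omega>\<bar> ^ k \<le> 1 + \<bar>X \<omega>\<bar> ^ 4"
    proof (cases "\<bar>X \<omega>\<bar> \<le> 1")
      case True
      then have "\<bar>X \<omega>\<bar> ^ k \<le> 1" by (simp add: power_le_one)
      then show ?thesis by (simp add: add_increasing2)
    next
      case False
      then have "\<bar>X \<omega>\<bar> ^ k \<le> \<bar>X \<omega>\<bar> ^ 4" using assms(3) by (intro power_increasing) auto
      then show ?thesis by simp
    qed
    then show "norm (X \<omega> ^ k) \<le> norm (1 + X \<omega> ^ 4)" by (simp add: power_abs)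
  qed
qed simp

lemma square_expectation_le:
  fixes X :: "'a \<Rightarrow> real"
  assumes rv: "random_variable borel X" and int: "integrable M (\<lambda>\<omega>. X \<omega> ^ 4)"
  shows "(expectation (\<lambda>\<omega>. X \<omega> ^ 2))\<^sup>2 \<le> expectation (\<lambda>\<omega>. X \<omega> ^ 4)"
proof -
  let ?m = "expectation (\<lambda>\<omega>. X \<omega> ^ 2)"
  have i2: "integrable M (\<lambda>\<omega>. X \<omega> ^ 2)" by (rule integrable_lower_power[OF rv int]) simp
  have "0 \<le> expectation (\<lambda>\<omega>. (X \<omega> ^ 2 - ?m)\<^sup>2)" by simp
  also have "(\<lambda>\<omega>. (X \<omega> ^ 2 - ?m)\<^sup>2) = (\<lambda>\<omega>. X \<omega> ^ 4 - 2 * ?m * X \<omega> ^ 2 + ?m\<^sup>2)"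
    by (auto simp: power2_diff power_mult[symmetric])
  also have "expectation \<dots> = expectation (\<lambda>\<omega>. X \<omega> ^ 4) - ?m\<^sup>2"
    using i2 int by (simp add: prob_space power2_eq_square)
  finally show ?thesis by simp
qed

lemma fourth_moment_indep_add:
  fixes S X :: "'a \<Rightarrow> real"
  assumes ind: "indep_var borel X borel S"
    and int: "integrable M (\<lambda>\<omega>. X \<omega> ^ 4)" "integrable M (\<lambda>\<omega>. S \<omega> ^ 4)"
    and mean: "expectation X = 0" "expectation S = 0"
  shows "integrable M (\<lambda>\<omega>. (X \<omega> + S \<omega>) ^ 4)"
    "expectation (\<lambda>\<omega>. (X \<omega> + S \<omega>) ^ 4) = expectation (\<lambda>\<omega>. X \<omega> ^ 4)
       + 6 * (expectation (\<lambda>\<omega>. X \<omega> ^ 2) * expectation (\<lambda>\<omega>. S \<omega> ^ 2)) + expectation (\<lambda>\<omega>. S \<omega> ^ 4)"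
    "expectation (\<lambda>\<omega>. (X \<omega> + S \<omega>) ^ 2) = expectation (\<lambda>\<omega>. X \<omega> ^ 2) + expectation (\<lambda>\<omega>. S \<omega> ^ 2)"
proof -
  note rv = indep_var_rv1[OF ind] indep_var_rv2[OF ind]
  note iX = integrable_lower_power[OF rv(1) int(1)] and iS = integrable_lower_power[OF rv(2) int(2)]
  have prod: "integrable M (\<lambda>\<omega>. X \<omega> ^ p * S \<omega> ^ q) \<and>
      expectation (\<lambda>\<omega>. X \<omega> ^ p * S \<omega> ^ q) = expectation (\<lambda>\<omega>. X \<omega> ^ p) * expectation (\<lambda>\<omega>. S \<omega> ^ q)"
    if "p \<le> 4" "q \<le> 4" for p q
  proof -
    have "indep_var borel ((\<lambda>x. x ^ p) \<circ> X) borel ((\<lambda>x. x ^ q) \<circ> S)"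
      by (rule indep_var_compose[OF ind]) simp_all
    then have i: "indep_var borel (\<lambda>\<omega>. X \<omega> ^ p) borel (\<lambda>\<omega>. S \<omega> ^ q)" by (simp add: comp_def)
    show ?thesis
      using indep_var_integrable[OF i iX[OF that(1)] iS[OF that(2)]]
        indep_var_lebesgue_integral[OF i iX[OF that(1)] iS[OF that(2)]] by simp
  qed
  have eq4: "(\<lambda>\<omega>. (X \<omega> + S \<omega>) ^ 4) = (\<lambda>\<omega>. X \<omega> ^ 4 + 4 * (X \<omega> ^ 3 * S \<omega> ^ 1) + 6 * (X \<omega> ^ 2 * S \<omega> ^ 2)
      + 4 * (X \<omega> ^ 1 * S \<omega> ^ 3) + S \<omega> ^ 4)"
    by (rule ext) (simp add: eval_nat_numeral algebra_simps)
  note p = prod[of 3 1] prod[of 2 2] prod[of 1 3] prod[of 1 1]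
  show "integrable M (\<lambda>\<omega>. (X \<omega> + S \<omega>) ^ 4)" unfolding eq4 using p int by simp
  show "expectation (\<lambda>\<omega>. (X \<omega> + S \<omega>) ^ 4) = expectation (\<lambda>\<omega>. X \<omega> ^ 4)
       + 6 * (expectation (\<lambda>\<omega>. X \<omega> ^ 2) * expectation (\<lambda>\<omega>. S \<omega> ^ 2)) + expectation (\<lambda>\<omega>. S \<omega> ^ 4)"
    unfolding eq4 using p int mean by simp
  have eq2: "(\<lambda>\<omega>. (X \<omega> + S \<omega>) ^ 2) = (\<lambda>\<omega>. X \<omega> ^ 2 + 2 * (X \<omega> ^ 1 * S \<omega> ^ 1) + S \<omega> ^ 2)"
    by (rule ext) (simp add: power2_eq_square algebra_simps)
  show "expectation (\<lambda>\<omega>. (X \<omega> + S \<omega>) ^ 2) = expectation (\<lambda>\<omega>. X \<omega> ^ 2) + expectation (\<lambda>\<omega>. S \<omega> ^ 2)"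
    unfolding eq2 using p iX[of 2] iS[of 2] mean by simp
qed

text \<open>Only even mixed moments survive, so adding a variable increases the fourth moment by at most
\<open>6 (E X\<^sup>2) (E S\<^sup>2) + C \<le> 6 n C + C\<close>. The induction carries the second moment along.\<close>

lemma fourth_moment_indep_sum:
  fixes X :: "'i \<Rightarrow> 'a \<Rightarrow> real"
  assumes "finite I" "indep_vars (\<lambda>_. borel) X I"
    and "\<And>i. i \<in> I \<Longrightarrow> integrable M (\<lambda>\<omega>. X i \<omega> ^ 4)" "\<And>i. i \<in> I \<Longrightarrow> expectation (X i) = 0"
    and "\<And>i. i \<in> I \<Longrightarrow> expectation (\<lambda>\<omega>. X i \<omega> ^ 4) \<le> C"
  shows "integrable M (\<lambda>\<omega>. (\<Sum>i\<in>I. X i \<omega>) ^ 4) \<and> expectation (\<lambda>\<omega>. (\<Sum>i\<in>I. X i \<omega>)) = 0 \<and>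
     expectation (\<lambda>\<omega>. (\<Sum>i\<in>I. X i \<omega>) ^ 2) \<le> real (card I) * sqrt C \<and>
     expectation (\<lambda>\<omega>. (\<Sum>i\<in>I. X i \<omega>) ^ 4) \<le> 3 * (real (card I))\<^sup>2 * C"
  using assms
proof (induction I rule: finite_induct)
  case empty
  then show ?case by simp
next
  case (insert x F)
  let ?S = "\<lambda>\<omega>. \<Sum>i\<in>F. X i \<omega>" and ?n = "real (card F)"
  have IH: "integrable M (\<lambda>\<omega>. ?S \<omega> ^ 4)" "expectation ?S = 0" "expectation (\<lambda>\<omega>. ?S \<omega> ^ 2) \<le> ?n * sqrt C"
    "expectation (\<lambda>\<omega>. ?S \<omega> ^ 4) \<le> 3 * ?n\<^sup>2 * C"
    using insert.IH[OF indep_vars_subset[OF insert.prems(1)]] insert.prems by auto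
  have ind: "indep_var borel (X x) borel ?S"
    by (rule indep_vars_sum[OF insert.hyps insert.prems(1)])
  note rv = indep_var_rv1[OF ind] indep_var_rv2[OF ind]
  have X: "integrable M (\<lambda>\<omega>. X x \<omega> ^ 4)" "expectation (X x) = 0" "expectation (\<lambda>\<omega>. X x \<omega> ^ 4) \<le> C"
    using insert.prems by auto
  have "0 \<le> expectation (\<lambda>\<omega>. X x \<omega> ^ 4)" by simp
  then have C: "0 \<le> C" using X(3) by linarith
  note add = fourth_moment_indep_add[OF ind X(1) IH(1) X(2) IH(2)]
  have sum: "(\<Sum>i\<in>insert x F. X i \<omega>) = X x \<omega> + ?S \<omega>" for \<omega> using insert.hyps by simp
  have "(expectation (\<lambda>\<omega>. X x \<omega> ^ 2))\<^sup>2 \<le> C"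
    using square_expectation_le[OF rv(1) X(1)] X(3) by linarith
  then have X2: "expectation (\<lambda>\<omega>. X x \<omega> ^ 2) \<le> sqrt C" by (rule real_le_rsqrt)
  have i1: "integrable M (X x)" "integrable M ?S"
    using integrable_lower_power[OF rv(1) X(1), of 1] integrable_lower_power[OF rv(2) IH(1), of 1] by simp_all
  have "expectation (\<lambda>\<omega>. X x \<omega> ^ 2) * expectation (\<lambda>\<omega>. ?S \<omega> ^ 2) \<le> sqrt C * (?n * sqrt C)"
    using X2 IH(3) C by (intro mult_mono) auto
  also have "\<dots> = ?n * C" using C by simp
  finally have cross: "expectation (\<lambda>\<omega>. X x \<omega> ^ 2) * expectation (\<lambda>\<omega>. ?S \<omega> ^ 2) \<le> ?n * C" .
  have card: "real (card (insert x F)) = ?n + 1" using insert.hyps by simp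
  have "expectation (\<lambda>\<omega>. (X x \<omega> + ?S \<omega>) ^ 4) \<le> C + 6 * (?n * C) + 3 * ?n\<^sup>2 * C"
    unfolding add(2) using cross X(3) IH(4) by linarith
  also have "\<dots> \<le> 3 * (?n + 1)\<^sup>2 * C"
    using C by (simp add: power2_eq_square algebra_simps)
  finally have 4: "expectation (\<lambda>\<omega>. (X x \<omega> + ?S \<omega>) ^ 4) \<le> 3 * (?n + 1)\<^sup>2 * C" .
  have 2: "expectation (\<lambda>\<omega>. (X x \<omega> + ?S \<omega>) ^ 2) \<le> (?n + 1) * sqrt C"
    unfolding add(3) using X2 IH(3) by (simp add: algebra_simps)
  have 1: "expectation (\<lambda>\<omega>. X x \<omega> + ?S \<omega>) = 0" using i1 X(2) IH(2) by simp
  show ?case unfolding sum card by (intro conjI add(1) 1 2 4)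
qed

text \<open>Each factor \<open>E exp(i u X\<^sub>j / sqrt n)\<close> differs from \<open>1 - u\<^sup>2 v / (2 n)\<close> by \<open>O(n\<^sup>-\<^sup>3\<^sup>/\<^sup>2)\<close>, with a constant that
depends on the fourth moment only, and \<open>n\<close> such errors are summed. The lower bound on \<open>n\<close> keeps
\<open>1 - u\<^sup>2 v / (2 n)\<close> in \<open>[-1, 1]\<close>, as the comparison of products requires.\<close>

lemma char_normalized_sum_le:
  fixes X :: "nat \<Rightarrow> 'a \<Rightarrow> real"
  assumes ind: "indep_vars (\<lambda>_. borel) X {..<n}" and n: "0 < n" and u: "u\<^sup>2 * v / 4 \<le> real n" and v: "0 \<le> v"
    and int: "\<And>j. j < n \<Longrightarrow> integrable M (\<lambda>\<omega>. X j \<omega> ^ 4)"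
    and mean: "\<And>j. j < n \<Longrightarrow> expectation (X j) = 0"
    and var: "\<And>j. j < n \<Longrightarrow> expectation (\<lambda>\<omega>. X j \<omega> ^ 2) = v"
    and four: "\<And>j. j < n \<Longrightarrow> expectation (\<lambda>\<omega>. X j \<omega> ^ 4) \<le> C"
  shows "cmod (char (distr M borel (\<lambda>\<omega>. (\<Sum>j<n. X j \<omega>) / sqrt (real n))) u - (complex_of_real (1 + (- (u\<^sup>2 * v) / 2) / real n)) ^ n)
     \<le> \<bar>u\<bar> ^ 3 * (1 + C) / 6 / sqrt (real n)"
proof -
  let ?r = "sqrt (real n)" and ?t = "u / sqrt (real n)"
  have r: "0 < ?r" "?r\<^sup>2 = real n" using n by auto
  have rv[measurable]: "j < n \<Longrightarrow> random_variable borel (X j)" for j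
    using ind by (auto simp: indep_vars_def)
  have ch: "char (distr M borel (\<lambda>\<omega>. X j \<omega> / ?r)) u = char (distr M borel (X j)) ?t" if "j < n" for j
    unfolding char_def using rv[OF that] by (subst (1 2) integral_distr) auto
  have "char (distr M borel (\<lambda>\<omega>. (\<Sum>j<n. X j \<omega>) / ?r)) u = char (distr M borel (\<lambda>\<omega>. \<Sum>j<n. X j \<omega> / ?r)) u"
    by (simp add: sum_divide_distrib)
  also have "\<dots> = (\<Prod>j<n. char (distr M borel (\<lambda>\<omega>. X j \<omega> / ?r)) u)"
    by (rule char_distr_sum) (rule indep_vars_compose2[OF ind], simp)
  also have "\<dots> = (\<Prod>j<n. char (distr M borel (X j)) ?t)" by (intro prod.cong) (auto simp: ch)
  finally have prod: "char (distr M borel (\<lambda>\<omega>. (\<Sum>j<n. X j \<omega>) / ?r)) u = (\<Prod>j<n. char (distr M borel (X j)) ?t)" .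
  let ?w = "complex_of_real (1 + (- (u\<^sup>2 * v) / 2) / real n)"
  have w: "cmod ?w \<le> 1"
  proof -
    have "u\<^sup>2 * v / 2 / real n \<le> 2" using u n by (simp add: field_simps)
    moreover have "0 \<le> u\<^sup>2 * v / 2 / real n" using v by simp
    ultimately have "\<bar>1 + (- (u\<^sup>2 * v) / 2) / real n\<bar> \<le> 1" by (simp add: abs_le_iff)
    then show ?thesis by (simp only: norm_of_real)
  qed
  have each: "cmod (char (distr M borel (X j)) ?t - ?w) \<le> u\<^sup>2 / (6 * real n) * (\<bar>u\<bar> / ?r * (1 + C))" if j: "j < n" for j
  proof -
    note i = integrable_lower_power[OF rv[OF j] int[OF j]]
    have sq: "?t\<^sup>2 = u\<^sup>2 / real n" using r by (simp add: power_divide)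
    have "cmod (char (distr M borel (X j)) ?t - (1 - ?t\<^sup>2 * v / 2))
        \<le> (?t\<^sup>2 / 6) * expectation (\<lambda>x. min (6 * (X j x)\<^sup>2) (\<bar>?t\<bar> * \<bar>X j x\<bar> ^ 3))"
    proof (rule char_approx3')
      show "variance (X j) = v" using var[OF j] mean[OF j] by simp
    qed (use rv[OF j] i[of 1] i[of 2] mean[OF j] in auto)
    also have "expectation (\<lambda>x. min (6 * (X j x)\<^sup>2) (\<bar>?t\<bar> * \<bar>X j x\<bar> ^ 3)) \<le> expectation (\<lambda>x. \<bar>?t\<bar> * (1 + X j x ^ 4))"
    proof (rule integral_mono)
      show "integrable M (\<lambda>x. min (6 * (X j x)\<^sup>2) (\<bar>?t\<bar> * \<bar>X j x\<bar> ^ 3))"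
        by (rule Bochner_Integration.integrable_bound[of _ "\<lambda>x. 6 * (X j x)\<^sup>2"])
           (use rv[OF j] i[of 2] in \<open>auto intro!: AE_I2\<close>)
      show "integrable M (\<lambda>x. \<bar>?t\<bar> * (1 + X j x ^ 4))" using int[OF j] by simp
      fix x
      have "\<bar>X j x\<bar> ^ 3 \<le> 1 + \<bar>X j x\<bar> ^ 4"
      proof (cases "\<bar>X j x\<bar> \<le> 1")
        case True
        then have "\<bar>X j x\<bar> ^ 3 \<le> 1" by (simp add: power_le_one)
        then show ?thesis by (simp add: add_increasing2)
      next
        case False
        then have "\<bar>X j x\<bar> ^ 3 \<le> \<bar>X j x\<bar> ^ 4" by (intro power_increasing) auto
        then show ?thesis by simp
      qed
      then have "\<bar>?t\<bar> * \<bar>X j x\<bar> ^ 3 \<le> \<bar>?t\<bar> * (1 + X j x ^ 4)" by (intro mult_left_mono) auto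
      then show "min (6 * (X j x)\<^sup>2) (\<bar>?t\<bar> * \<bar>X j x\<bar> ^ 3) \<le> \<bar>?t\<bar> * (1 + X j x ^ 4)" by linarith
    qed
    also have "\<dots> = \<bar>?t\<bar> * (1 + expectation (\<lambda>x. X j x ^ 4))" using int[OF j] by (simp add: prob_space)
    also have "\<dots> \<le> \<bar>?t\<bar> * (1 + C)" using four[OF j] by (intro mult_left_mono) auto
    finally have "cmod (char (distr M borel (X j)) ?t - (1 - ?t\<^sup>2 * v / 2)) \<le> ?t\<^sup>2 / 6 * (\<bar>?t\<bar> * (1 + C))"
      by (simp add: mult_left_mono)
    moreover have "complex_of_real (1 - ?t\<^sup>2 * v / 2) = ?w" unfolding sq by simp
    moreover have "complex_of_real (1 - ?t\<^sup>2 * v / 2) = 1 - ?t\<^sup>2 * v / 2" by simp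
    moreover have "?t\<^sup>2 / 6 * (\<bar>?t\<bar> * (1 + C)) = u\<^sup>2 / (6 * real n) * (\<bar>u\<bar> / ?r * (1 + C))"
      unfolding sq using r by simp
    ultimately show ?thesis by (simp add: mult_ac)
  qed
  have "cmod ((\<Prod>j<n. char (distr M borel (X j)) ?t) - (\<Prod>j<n. ?w)) \<le> (\<Sum>j<n. cmod (char (distr M borel (X j)) ?t - ?w))"
  proof (rule norm_prod_diff)
    fix j assume "j \<in> {..<n}"
    then interpret d: real_distribution "distr M borel (X j)" by (intro real_distribution_distr rv) simp
    show "cmod (char (distr M borel (X j)) ?t) \<le> 1" by (rule d.cmod_char_le_1)
  qed (rule w)
  also have "\<dots> \<le> (\<Sum>j<n. u\<^sup>2 / (6 * real n) * (\<bar>u\<bar> / ?r * (1 + C)))"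
    by (intro sum_mono each) simp
  also have "\<dots> = \<bar>u\<bar> ^ 3 * (1 + C) / 6 / ?r"
    using n by (simp add: power2_eq_square power3_eq_cube abs_mult field_simps)
  finally show ?thesis unfolding prod by simp
qed

end

lemma (in prob_space) expectation_cos_eq_char:
  assumes [measurable]: "random_variable borel X"
  shows "expectation (\<lambda>\<omega>. cos (X \<omega> + \<theta>)) = Re (cis \<theta> * char (distr M borel X) 1)"
proof -
  have int: "complex_integrable M (\<lambda>\<omega>. cis \<theta> * iexp (X \<omega>))"
    by (rule integrable_const_bound[where B=1]) (auto simp: norm_mult)
  have "cis \<theta> * char (distr M borel X) 1 = (CLINT \<omega>|M. cis \<theta> * iexp (X \<omega>))"
    unfolding char_def by (subst integral_distr) simp_all
  then have "Re (cis \<theta> * char (distr M borel X) 1) = expectation (\<lambda>\<omega>. Re (cis \<theta> * iexp (X \<omega>)))"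
    using integral_Re[OF int] by simp
  also have "(\<lambda>\<omega>. Re (cis \<theta> * iexp (X \<omega>))) = (\<lambda>\<omega>. cos (X \<omega> + \<theta>))"
    by (simp add: cis_conv_exp[symmetric] cis_mult add.commute)
  finally show ?thesis ..
qed

text \<open>The comparison with \<open>(1 - v / (2 N))\<^sup>N\<close> uses only the first two moments of the summands and a common bound
of the fourth, so the rows may live on different probability spaces and have different laws.\<close>

theorem triangular_array_cos_limit:
  fixes X :: "nat \<Rightarrow> nat \<Rightarrow> 'a \<Rightarrow> real" and W :: "'b \<Rightarrow> real"
  assumes P: "\<And>n. prob_space (P n)" and Q: "prob_space Q"
    and N: "filterlim N at_top sequentially"
    and ind: "\<And>n. prob_space.indep_vars (P n) (\<lambda>_. borel) (X n) {..<N n}"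
    and int: "\<And>n j. j < N n \<Longrightarrow> integrable (P n) (\<lambda>\<omega>. X n j \<omega> ^ 4)"
    and mean: "\<And>n j. j < N n \<Longrightarrow> (\<integral>\<omega>. X n j \<omega> \<partial>P n) = 0"
    and var: "\<And>n j. j < N n \<Longrightarrow> (\<integral>\<omega>. X n j \<omega> ^ 2 \<partial>P n) = v"
    and four: "\<And>n j. j < N n \<Longrightarrow> (\<integral>\<omega>. X n j \<omega> ^ 4 \<partial>P n) \<le> C"
    and W: "prob_space.centered_gaussian Q W v"
  shows "(\<lambda>n. \<integral>\<omega>. cos ((\<Sum>j<N n. X n j \<omega>) / sqrt (real (N n)) + \<theta>) \<partial>P n)
     \<longlonglongrightarrow> (\<integral>\<omega>. cos (W \<omega> + \<theta>) \<partial>Q)"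
proof -
  interpret Q: prob_space Q by (rule Q)
  have v: "0 \<le> v" by (rule Q.centered_gaussian_nonneg[OF W])
  let ?S = "\<lambda>n \<omega>. (\<Sum>j<N n. X n j \<omega>) / sqrt (real (N n))"
  let ?c = "\<lambda>n. char (distr (P n) borel (?S n)) 1"
  let ?e = "\<lambda>n. complex_of_real ((1 + (- v / 2) / real n) ^ n)"
  have rv: "?S n \<in> borel_measurable (P n)" for n
  proof -
    have "X n j \<in> borel_measurable (P n)" if "j < N n" for j
      using ind[of n] that unfolding prob_space.indep_vars_def[OF P] by auto
    then show ?thesis by (intro borel_measurable_divide borel_measurable_sum) auto
  qed
  have "\<forall>\<^sub>F n in sequentially. nat \<lceil>v / 4\<rceil> + 1 \<le> N n"
    using N by (simp add: filterlim_at_top)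
  then have bound: "\<forall>\<^sub>F n in sequentially. norm (?c n - ?e (N n)) \<le> (1 + C) / 6 * inverse (sqrt (real (N n)))"
  proof eventually_elim
    case (elim n)
    have "v / 4 \<le> real (nat \<lceil>v / 4\<rceil>)" by (rule real_nat_ceiling_ge)
    then have le: "1\<^sup>2 * v / 4 \<le> real (N n)" and pos: "0 < N n" using elim by simp_all
    have "norm (?c n - (complex_of_real (1 + (- (1\<^sup>2 * v) / 2) / real (N n))) ^ N n)
        \<le> \<bar>1\<bar> ^ 3 * (1 + C) / 6 / sqrt (real (N n))"
      by (rule prob_space.char_normalized_sum_le[OF P ind pos le v int mean var four])
    moreover have "(complex_of_real (1 + (- (1\<^sup>2 * v) / 2) / real (N n))) ^ N n = ?e (N n)"
      by (simp only: of_real_power power_one mult_1_left)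
    ultimately show ?case by (simp only: divide_inverse abs_one power_one mult_1_left)
  qed
  have "filterlim (\<lambda>n. sqrt (real (N n))) at_top sequentially"
    by (intro filterlim_compose[OF sqrt_at_top] filterlim_compose[OF filterlim_real_sequentially N])
  then have "(\<lambda>n. (1 + C) / 6 * inverse (sqrt (real (N n)))) \<longlonglongrightarrow> (1 + C) / 6 * 0"
    by (intro tendsto_mult tendsto_const tendsto_inverse_0_at_top)
  then have 1: "(\<lambda>n. ?c n - ?e (N n)) \<longlonglongrightarrow> 0"
    by (intro Lim_null_comparison[OF bound]) simp
  have "?e \<longlonglongrightarrow> complex_of_real (exp (- v / 2))"
    by (rule isCont_tendsto_compose[OF _ tendsto_exp_limit_sequentially]) auto
  then have 2: "(\<lambda>n. ?e (N n)) \<longlonglongrightarrow> complex_of_real (exp (- v / 2))"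
    using N by (rule filterlim_compose)
  have "?c \<longlonglongrightarrow> complex_of_real (exp (- v / 2))"
    using tendsto_add[OF 1 2] by simp
  then have "?c \<longlonglongrightarrow> char (distr Q borel W) 1"
    using W by (simp add: Q.centered_gaussian_def)
  then have "(\<lambda>n. Re (cis \<theta> * ?c n)) \<longlonglongrightarrow> Re (cis \<theta> * char (distr Q borel W) 1)"
    by (intro tendsto_intros)
  then show ?thesis
    using prob_space.expectation_cos_eq_char[OF P rv] Q.expectation_cos_eq_char[OF Q.centered_gaussian_rv[OF W]]
    by simp
qed

section \<open>Hermitian test matrices\<close>

text \<open>The processes take Hermitian values, so a linear functional on all matrices acts on them through the
Hermitian part of its coefficient matrix.\<close>

definition hermitian_part :: "complex^'n^'n \<Rightarrow> complex^'n^'n" where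
  "hermitian_part U = (\<chi> i j. (U $ i $ j + cnj (U $ j $ i)) / 2)"

lemma hermitian_part_hermitian: "hermitian_part U \<in> hermitian_matrices"
  by (simp add: hermitian_part_def hermitian_matrices_def add.commute)

lemma inner_hermitian_part:
  fixes U :: "complex^'n^'n"
  assumes A: "A \<in> hermitian_matrices"
  shows "hermitian_part U \<bullet> A = U \<bullet> A"
proof -
  have half: "((x + y) / 2) \<bullet> z = (x \<bullet> z + y \<bullet> z) / 2" for x y z :: complex
    by (simp add: inner_complex_def field_simps)
  have "(\<Sum>i\<in>UNIV. \<Sum>j\<in>UNIV. cnj (U $ j $ i) \<bullet> A $ i $ j) = (\<Sum>i\<in>UNIV. \<Sum>j\<in>UNIV. U $ j $ i \<bullet> A $ j $ i)"
  proof (intro sum.cong refl)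
    fix i j
    have "A $ i $ j = cnj (A $ j $ i)" using A unfolding hermitian_matrices_def by blast
    then show "cnj (U $ j $ i) \<bullet> A $ i $ j = U $ j $ i \<bullet> A $ j $ i" by (simp add: inner_complex_def)
  qed
  also have "\<dots> = U \<bullet> A" unfolding inner_vec_def by (rule sum.swap)
  finally have "(\<Sum>i\<in>UNIV. \<Sum>j\<in>UNIV. cnj (U $ j $ i) \<bullet> A $ i $ j) = U \<bullet> A" .
  moreover have "hermitian_part U \<bullet> A =
     ((\<Sum>i\<in>UNIV. \<Sum>j\<in>UNIV. U $ i $ j \<bullet> A $ i $ j) + (\<Sum>i\<in>UNIV. \<Sum>j\<in>UNIV. cnj (U $ j $ i) \<bullet> A $ i $ j)) / 2"
    by (simp add: hermitian_part_def inner_vec_def half sum.distrib sum_divide_distrib[symmetric])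
  ultimately show ?thesis by (simp add: inner_vec_def)
qed

lemma cnj_hermitian: "A \<in> hermitian_matrices \<Longrightarrow> cnj (A $ j $ i) = A $ i $ j"
  unfolding hermitian_matrices_def by (rule sym) blast

lemma hermitian_matricesI: "(\<And>i j. cnj (A $ j $ i) = A $ i $ j) \<Longrightarrow> A \<in> hermitian_matrices"
  by (simp add: hermitian_matrices_def)

lemma hermitian_scale_sum:
  assumes "\<And>j. j \<in> J \<Longrightarrow> B j \<in> hermitian_matrices"
  shows "c *\<^sub>R (\<Sum>j\<in>J. B j) \<in> hermitian_matrices"
  by (rule hermitian_matricesI) (simp add: cnj_hermitian[OF assms] complex_cnj_scaleR cong: sum.cong)

lemma continuous_on_matrix:
  fixes f :: "'a::topological_space \<Rightarrow> complex^'n^'m"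
  assumes "\<And>i p. continuous_on S (\<lambda>t. f t $ i $ p)"
  shows "continuous_on S f"
  using assms by (intro continuous_on_vec_lambda[of S "\<lambda>i t. f t $ i", simplified] continuous_on_vec_lambda[of S "\<lambda>p t. f t $ _ $ p", simplified])

section \<open>Time-changed Hermitian Brownian motion\<close>

lemma sum_upper_triangle:
  fixes F :: "'n::{finite,linorder} \<Rightarrow> 'n \<Rightarrow> real"
  assumes sym: "\<And>i j. F i j = F j i"
  shows "(\<Sum>\<alpha>\<in>{(i, j). i \<le> j}. (if fst \<alpha> = snd \<alpha> then 1 else 2) * F (fst \<alpha>) (snd \<alpha>)) = (\<Sum>i\<in>UNIV. \<Sum>j\<in>UNIV. F i j)"
proof -
  let ?f = "\<lambda>\<alpha>. F (fst \<alpha>) (snd \<alpha>)"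
  let ?L = "{(i, j). i < j} :: ('n \<times> 'n) set" and ?D = "{(i, j). i = j} :: ('n \<times> 'n) set" and ?U = "{(i, j). j < i} :: ('n \<times> 'n) set"
  have swap: "sum ?f ?U = sum ?f ?L"
    by (rule sum.reindex_bij_witness[of _ prod.swap prod.swap]) (auto simp: sym)
  have LD: "{(i, j). i \<le> j} = ?L \<union> ?D" "?L \<inter> ?D = {}" "(UNIV :: ('n \<times> 'n) set) = (?L \<union> ?D) \<union> ?U" "(?L \<union> ?D) \<inter> ?U = {}"
    by auto
  have "(\<Sum>i\<in>UNIV. \<Sum>j\<in>UNIV. F i j) = sum ?f UNIV"
    by (simp add: sum.cartesian_product case_prod_unfold)
  also have "\<dots> = sum ?f ?L + sum ?f ?D + sum ?f ?U"
    unfolding LD(3) by (subst sum.union_disjoint[OF finite finite LD(4)], subst sum.union_disjoint[OF finite finite LD(2)]) simp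
  also have "\<dots> = (\<Sum>\<alpha>\<in>?L. 2 * ?f \<alpha>) + (\<Sum>\<alpha>\<in>?D. 1 * ?f \<alpha>)"
    using swap by (simp add: sum_distrib_left[symmetric])
  also have "\<dots> = (\<Sum>\<alpha>\<in>?L. (if fst \<alpha> = snd \<alpha> then 1 else 2) * ?f \<alpha>) + (\<Sum>\<alpha>\<in>?D. (if fst \<alpha> = snd \<alpha> then 1 else 2) * ?f \<alpha>)"
    by (intro arg_cong2[where f="(+)"] sum.cong) auto
  also have "\<dots> = (\<Sum>\<alpha>\<in>{(i, j). i \<le> j}. (if fst \<alpha> = snd \<alpha> then 1 else 2) * ?f \<alpha>)"
    unfolding LD(1) by (rule sum.union_disjoint[OF finite finite LD(2), symmetric])
  finally show ?thesis by simp
qed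

text \<open>Used with \<open>h = t - s\<close> to deduce fourth moments of order \<open>(t-s)\<^sup>2\<close> from eighth moments of order
\<open>(t-s)\<^sup>4\<close>.\<close>

lemma fourth_power_le:
  fixes x h :: real
  assumes "0 < h"
  shows "x ^ 4 \<le> x ^ 8 / h\<^sup>2 + h\<^sup>2"
proof -
  have "0 \<le> (x ^ 4 / h - h)\<^sup>2 + (x ^ 4 / h)\<^sup>2 + h\<^sup>2" by simp
  also have "\<dots> = 2 * (x ^ 4 / h)\<^sup>2 + 2 * h\<^sup>2 - 2 * (x ^ 4 / h * h)" by (simp add: power2_diff)
  also have "x ^ 4 / h * h = x ^ 4" using assms by simp
  also have "(x ^ 4 / h)\<^sup>2 = x ^ 8 / h\<^sup>2" by (simp add: power_divide flip: power_mult)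
  finally show ?thesis by linarith
qed

locale hermitian_BM_process = prob_space +
  fixes X :: "real \<Rightarrow> 'a \<Rightarrow> complex^'n::{finite,linorder}^'n::{finite,linorder}"
  assumes X: "hermitian_BM X"
begin

lemma upper_entry: "i < j \<Longrightarrow> std_complex_BM (\<lambda>t \<omega>. X t \<omega> $ i $ j)"
  using X unfolding hermitian_BM_def by blast

lemma diagonal_entry:
  obtains b where "std_real_BM b" "\<And>t \<omega>. 0 \<le> t \<Longrightarrow> \<omega> \<in> space M \<Longrightarrow> X t \<omega> $ i $ i = complex_of_real (b t \<omega>)"
  using X unfolding hermitian_BM_def by blast

lemma lower_entry: "j < i \<Longrightarrow> 0 \<le> t \<Longrightarrow> \<omega> \<in> space M \<Longrightarrow> X t \<omega> $ i $ j = cnj (X t \<omega> $ j $ i)"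
  using X unfolding hermitian_BM_def by blast

lemma X_hermitian:
  assumes "0 \<le> t" "\<omega> \<in> space M"
  shows "X t \<omega> \<in> hermitian_matrices"
proof -
  have "X t \<omega> $ i $ j = cnj (X t \<omega> $ j $ i)" for i j
  proof (cases i j rule: linorder_cases)
    case less
    then show ?thesis using lower_entry[OF less assms] by simp
  next
    case equal
    obtain b where "\<And>t \<omega>. 0 \<le> t \<Longrightarrow> \<omega> \<in> space M \<Longrightarrow> X t \<omega> $ i $ i = complex_of_real (b t \<omega>)"
      by (rule diagonal_entry[of i]) blast
    then show ?thesis using assms equal by simp
  next
    case greater
    then show ?thesis using lower_entry assms by simp
  qed
  then show ?thesis unfolding hermitian_matrices_def by blast
qed

lemma X_entry_properties:
  shows "0 \<le> t \<Longrightarrow> random_variable borel (\<lambda>\<omega>. X t \<omega> $ i $ j)"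
    and "\<omega> \<in> space M \<Longrightarrow> continuous_on {0..} (\<lambda>t. X t \<omega> $ i $ j)"
    and "\<omega> \<in> space M \<Longrightarrow> X 0 \<omega> $ i $ j = 0"
    and "0 \<le> s \<Longrightarrow> s < t \<Longrightarrow> integrable M (\<lambda>\<omega>. cmod (X t \<omega> $ i $ j - X s \<omega> $ i $ j) ^ 4)
       \<and> expectation (\<lambda>\<omega>. cmod (X t \<omega> $ i $ j - X s \<omega> $ i $ j) ^ 4) \<le> 106 * (t - s)\<^sup>2"
proof -
  have up: "(0 \<le> t \<longrightarrow> random_variable borel (\<lambda>\<omega>. X t \<omega> $ i $ j)) \<and>
    (\<omega> \<in> space M \<longrightarrow> continuous_on {0..} (\<lambda>t. X t \<omega> $ i $ j)) \<and> (\<omega> \<in> space M \<longrightarrow> X 0 \<omega> $ i $ j = 0) \<and>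
    (0 \<le> s \<and> s < t \<longrightarrow> integrable M (\<lambda>\<omega>. cmod (X t \<omega> $ i $ j - X s \<omega> $ i $ j) ^ 4)
       \<and> expectation (\<lambda>\<omega>. cmod (X t \<omega> $ i $ j - X s \<omega> $ i $ j) ^ 4) \<le> 106 * (t - s)\<^sup>2)"
    if ij: "i \<le> j" for i j s t \<omega>
  proof (cases "i = j")
    case False
    then have z: "std_complex_BM (\<lambda>t \<omega>. X t \<omega> $ i $ j)" using upper_entry ij by simp
    have "integrable M (\<lambda>\<omega>. cmod (X t \<omega> $ i $ j - X s \<omega> $ i $ j) ^ 4)
       \<and> expectation (\<lambda>\<omega>. cmod (X t \<omega> $ i $ j - X s \<omega> $ i $ j) ^ 4) \<le> 106 * (t - s)\<^sup>2" if st: "0 \<le> s" "s < t"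
    proof -
      let ?d = "\<lambda>\<omega>. cmod (X t \<omega> $ i $ j - X s \<omega> $ i $ j)"
      have h: "0 < t - s" using st by simp
      note m = complex_BM_eighth_moment[OF z st(1) less_imp_le[OF st(2)]]
      have int: "integrable M (\<lambda>\<omega>. ?d \<omega> ^ 8 / (t - s)\<^sup>2 + (t - s)\<^sup>2)" using m(1) by simp
      have rv: "random_variable borel (\<lambda>\<omega>. X t \<omega> $ i $ j)" "random_variable borel (\<lambda>\<omega>. X s \<omega> $ i $ j)"
        using complex_BM_rv[OF z] st by auto
      have "(\<lambda>\<omega>. ?d \<omega> ^ 4) \<in> borel_measurable M" using rv by measurable
      note dom = integral_dominated_nonneg[OF int this _ fourth_power_le[OF h]]
      have "expectation (\<lambda>\<omega>. ?d \<omega> ^ 4) \<le> expectation (\<lambda>\<omega>. ?d \<omega> ^ 8 / (t - s)\<^sup>2 + (t - s)\<^sup>2)"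
        by (rule dom(2)) simp
      also have "\<dots> = expectation (\<lambda>\<omega>. ?d \<omega> ^ 8) / (t - s)\<^sup>2 + (t - s)\<^sup>2"
        using m(1) by (simp add: prob_space)
      also have "\<dots> \<le> 105 * (t - s) ^ 4 / (t - s)\<^sup>2 + (t - s)\<^sup>2"
        using m(2) by (intro add_right_mono divide_right_mono) auto
      also have "\<dots> = 106 * (t - s)\<^sup>2"
      proof -
        have arith: "105 * r ^ 4 / r\<^sup>2 + r\<^sup>2 = 106 * r\<^sup>2" if "r \<noteq> 0" for r :: real
          using that by (simp add: field_simps eval_nat_numeral)
        show ?thesis by (rule arith) (use h in simp)
      qed
      finally show ?thesis using dom(1) by simp
    qed
    then show ?thesis using complex_BM_rv[OF z] complex_BM_path[OF z] by blast
  next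
    case True
    obtain b where b: "std_real_BM b" and Xb: "\<And>t \<omega>. 0 \<le> t \<Longrightarrow> \<omega> \<in> space M \<Longrightarrow> X t \<omega> $ i $ i = complex_of_real (b t \<omega>)"
      by (rule diagonal_entry[of i]) blast
    have brv: "0 \<le> t \<Longrightarrow> random_variable borel (b t)" for t using b by (simp add: std_real_BM_def)
    have "random_variable borel (\<lambda>\<omega>. X t \<omega> $ i $ i)" if "0 \<le> t"
    proof -
      have "random_variable borel (\<lambda>\<omega>. complex_of_real (b t \<omega>))" using brv[OF that] by simp
      then show ?thesis using Xb[OF that] by (simp cong: measurable_cong)
    qed
    moreover have "continuous_on {0..} (\<lambda>t. X t \<omega> $ i $ i)" if "\<omega> \<in> space M"
    proof -
      have "continuous_on {0..} (\<lambda>t. complex_of_real (b t \<omega>))"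
        using b that by (intro continuous_intros) (auto simp: std_real_BM_def)
      then show ?thesis by (rule continuous_on_eq) (use Xb that in auto)
    qed
    moreover have "X 0 \<omega> $ i $ i = 0" if "\<omega> \<in> space M"
      using Xb[of 0 \<omega>] b that by (simp add: std_real_BM_def)
    moreover have "integrable M (\<lambda>\<omega>. cmod (X t \<omega> $ i $ i - X s \<omega> $ i $ i) ^ 4)
       \<and> expectation (\<lambda>\<omega>. cmod (X t \<omega> $ i $ i - X s \<omega> $ i $ i) ^ 4) \<le> 106 * (t - s)\<^sup>2" if st: "0 \<le> s" "s < t"
    proof -
      note g = real_BM_increment_gaussian[OF b st]
      have eq: "cmod (X t \<omega> $ i $ i - X s \<omega> $ i $ i) ^ 4 = (b t \<omega> - b s \<omega>) ^ 4" if "\<omega> \<in> space M" for \<omega>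
      proof -
        have "X t \<omega> $ i $ i - X s \<omega> $ i $ i = complex_of_real (b t \<omega> - b s \<omega>)"
          using Xb[OF _ that] st by simp
        then show ?thesis by (simp add: power_even_abs del: of_real_diff)
      qed
      have "integrable M (\<lambda>\<omega>. cmod (X t \<omega> $ i $ i - X s \<omega> $ i $ i) ^ 4) = integrable M (\<lambda>\<omega>. (b t \<omega> - b s \<omega>) ^ 4)"
        by (rule Bochner_Integration.integrable_cong[OF refl eq])
      moreover have "expectation (\<lambda>\<omega>. cmod (X t \<omega> $ i $ i - X s \<omega> $ i $ i) ^ 4) = expectation (\<lambda>\<omega>. (b t \<omega> - b s \<omega>) ^ 4)"
        by (rule Bochner_Integration.integral_cong[OF refl eq])
      ultimately show ?thesis
        using centered_gaussian_moment(1)[OF g, of 4] centered_gaussian_moments(4)[OF g] by simp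
    qed
    ultimately show ?thesis using True by simp
  qed
  have low: "X t \<omega> $ i $ j = cnj (X t \<omega> $ j $ i)" if "0 \<le> t" "\<omega> \<in> space M" for i j t \<omega>
    using X_hermitian[OF that] unfolding hermitian_matrices_def by blast
  show "random_variable borel (\<lambda>\<omega>. X t \<omega> $ i $ j)" if "0 \<le> t"
  proof (cases "i \<le> j")
    case False
    then have "random_variable borel (\<lambda>\<omega>. X t \<omega> $ j $ i)" using up[of j i t] that by simp
    then have "random_variable borel (\<lambda>\<omega>. cnj (X t \<omega> $ j $ i))" by simp
    then show ?thesis using low[OF that, of _ i j] by (simp cong: measurable_cong)
  qed (use up that in blast)
  show "continuous_on {0..} (\<lambda>t. X t \<omega> $ i $ j)" if "\<omega> \<in> space M"
  proof (cases "i \<le> j")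
    case False
    then have "continuous_on {0..} (\<lambda>t. cnj (X t \<omega> $ j $ i))"
      using up[of j i] that by (intro continuous_on_cnj) auto
    then show ?thesis by (rule continuous_on_eq) (use low[OF _ that, of _ i j] in simp)
  qed (use up that in blast)
  show "X 0 \<omega> $ i $ j = 0" if "\<omega> \<in> space M"
    using up[of i j] up[of j i] low[OF _ that, of 0 i j] that by (cases "i \<le> j") auto
  show "integrable M (\<lambda>\<omega>. cmod (X t \<omega> $ i $ j - X s \<omega> $ i $ j) ^ 4)
       \<and> expectation (\<lambda>\<omega>. cmod (X t \<omega> $ i $ j - X s \<omega> $ i $ j) ^ 4) \<le> 106 * (t - s)\<^sup>2" if st: "0 \<le> s" "s < t"
  proof (cases "i \<le> j")
    case False
    have eq: "cmod (X t \<omega> $ i $ j - X s \<omega> $ i $ j) ^ 4 = cmod (X t \<omega> $ j $ i - X s \<omega> $ j $ i) ^ 4" if "\<omega> \<in> space M" for \<omega>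
    proof -
      have "X t \<omega> $ i $ j - X s \<omega> $ i $ j = cnj (X t \<omega> $ j $ i - X s \<omega> $ j $ i)"
        using low[OF _ that, of _ i j] st by simp
      then show ?thesis by (simp only: complex_mod_cnj)
    qed
    have "integrable M (\<lambda>\<omega>. cmod (X t \<omega> $ i $ j - X s \<omega> $ i $ j) ^ 4) = integrable M (\<lambda>\<omega>. cmod (X t \<omega> $ j $ i - X s \<omega> $ j $ i) ^ 4)"
      by (rule Bochner_Integration.integrable_cong[OF refl eq])
    moreover have "expectation (\<lambda>\<omega>. cmod (X t \<omega> $ i $ j - X s \<omega> $ i $ j) ^ 4) = expectation (\<lambda>\<omega>. cmod (X t \<omega> $ j $ i - X s \<omega> $ j $ i) ^ 4)"
      by (rule Bochner_Integration.integral_cong[OF refl eq])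
    ultimately show ?thesis using up[of j i t _ s] False st by simp
  qed (use up st in blast)
qed

lemma X_rv: "0 \<le> t \<Longrightarrow> random_variable borel (X t)"
  by (intro borel_measurable_matrix X_entry_properties(1))

lemma X_continuous: "\<omega> \<in> space M \<Longrightarrow> continuous_on {0..} (\<lambda>t. X t \<omega>)"
  by (intro continuous_on_matrix X_entry_properties(2))

lemma X_start: "\<omega> \<in> space M \<Longrightarrow> X 0 \<omega> = 0"
  by (simp add: vec_eq_iff X_entry_properties(3))

lemma X_increment_moment:
  assumes st: "0 \<le> s" "s \<le> t"
  shows "integrable M (\<lambda>\<omega>. norm (X t \<omega> - X s \<omega>) ^ 4)"
    "expectation (\<lambda>\<omega>. norm (X t \<omega> - X s \<omega>) ^ 4) \<le> 106 * real CARD('n) ^ 10 * (t - s)\<^sup>2"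
proof -
  let ?N = "real CARD('n)"
  let ?d = "\<lambda>\<omega> i j. cmod (X t \<omega> $ i $ j - X s \<omega> $ i $ j)"
  have le: "norm (X t \<omega> - X s \<omega>) ^ 4 \<le> ?N ^ 8 * (\<Sum>i\<in>UNIV. \<Sum>j\<in>UNIV. ?d \<omega> i j ^ 4)" for \<omega>
  proof -
    have "norm (X t \<omega> - X s \<omega>) ^ 4 \<le> (\<Sum>i\<in>UNIV. \<Sum>j\<in>UNIV. ?d \<omega> i j) ^ 4"
      using norm_matrix_le_sum[of "X t \<omega> - X s \<omega>"] by (intro power_mono) auto
    also have "\<dots> = (\<Sum>\<alpha>\<in>UNIV. ?d \<omega> (fst \<alpha>) (snd \<alpha>)) ^ 4"
      by (simp add: sum.cartesian_product case_prod_unfold)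
    also have "\<dots> \<le> real CARD('n \<times> 'n) ^ 4 * (\<Sum>\<alpha>\<in>UNIV. ?d \<omega> (fst \<alpha>) (snd \<alpha>) ^ 4)"
      by (rule sum_power_le) auto
    also have "\<dots> = ?N ^ 8 * (\<Sum>i\<in>UNIV. \<Sum>j\<in>UNIV. ?d \<omega> i j ^ 4)"
      by (simp add: sum.cartesian_product case_prod_unfold power_mult_distrib flip: power_add)
    finally show ?thesis .
  qed
  have e: "integrable M (\<lambda>\<omega>. ?d \<omega> i j ^ 4) \<and> expectation (\<lambda>\<omega>. ?d \<omega> i j ^ 4) \<le> 106 * (t - s)\<^sup>2" for i j
    using X_entry_properties(4)[OF st(1)] st by (cases "s = t") auto
  have intR: "integrable M (\<lambda>\<omega>. ?N ^ 8 * (\<Sum>i\<in>UNIV. \<Sum>j\<in>UNIV. ?d \<omega> i j ^ 4))" using e by simp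
  have [measurable]: "random_variable borel (X t)" "random_variable borel (X s)" using X_rv st by auto
  have "(\<lambda>\<omega>. norm (X t \<omega> - X s \<omega>) ^ 4) \<in> borel_measurable M" by measurable
  note dom = integral_dominated_nonneg[OF intR this _ le]
  show "integrable M (\<lambda>\<omega>. norm (X t \<omega> - X s \<omega>) ^ 4)" by (rule dom(1)) simp
  have "expectation (\<lambda>\<omega>. norm (X t \<omega> - X s \<omega>) ^ 4) \<le> expectation (\<lambda>\<omega>. ?N ^ 8 * (\<Sum>i\<in>UNIV. \<Sum>j\<in>UNIV. ?d \<omega> i j ^ 4))"
    by (rule dom(2)) simp
  also have "\<dots> = ?N ^ 8 * (\<Sum>i\<in>UNIV. \<Sum>j\<in>UNIV. expectation (\<lambda>\<omega>. ?d \<omega> i j ^ 4))" using e by simp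
  also have "\<dots> \<le> ?N ^ 8 * (\<Sum>i\<in>(UNIV::'n set). \<Sum>j\<in>(UNIV::'n set). 106 * (t - s)\<^sup>2)"
    using e by (intro mult_left_mono sum_mono) auto
  also have "\<dots> = 106 * ?N ^ 10 * (t - s)\<^sup>2" by (simp add: eval_nat_numeral)
  finally show "expectation (\<lambda>\<omega>. norm (X t \<omega> - X s \<omega>) ^ 4) \<le> 106 * real CARD('n) ^ 10 * (t - s)\<^sup>2" .
qed

text \<open>Pairing with a Hermitian matrix counts each entry above the diagonal twice. The resulting factor 4 in
the variance meets the factor \<open>1/2\<close> of complex Brownian motion, and the product 2 is what
is needed to restore the sum over all entries.\<close>

lemma X_linear_combination_gaussian:
  fixes \<tau> :: "nat \<Rightarrow> real"
  assumes \<tau>: "strict_mono \<tau>" "\<tau> 0 = 0" and U: "\<And>k. U k \<in> hermitian_matrices"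
  shows "centered_gaussian (\<lambda>\<omega>. \<Sum>k\<le>m. U k \<bullet> X (\<tau> k) \<omega>) (\<Sum>k\<le>m. \<Sum>l\<le>m. min (\<tau> k) (\<tau> l) * (U k \<bullet> U l))"
proof -
  have nn: "0 \<le> \<tau> k" for k using strict_mono_less_eq[OF \<tau>(1), of 0 k] \<tau>(2) by simp
  define I where "I = {(i, j). i \<le> j} - ({} :: ('n \<times> 'n) set)"
  \<comment> \<open>The multiplicity of an entry on or above the diagonal; it is also the factor in its variance, \<open>1\<close> for
      real and \<open>2\<^sup>2/2\<close> for complex entries.\<close>
  define w where "w \<alpha> = (if fst \<alpha> = snd \<alpha> then 1 else 2 :: real)" for \<alpha> :: "'n \<times> 'n"
  define z where "z \<alpha> = (\<lambda>t \<omega>. X t \<omega> $ fst \<alpha> $ snd \<alpha>)" for \<alpha>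
  define v where "v \<alpha> = w \<alpha> * (\<Sum>k\<le>m. \<Sum>l\<le>m. (U k $ fst \<alpha> $ snd \<alpha> \<bullet> U l $ fst \<alpha> $ snd \<alpha>) * min (\<tau> k) (\<tau> l))" for \<alpha>
  define g where "g \<alpha> = (\<lambda>p::real \<Rightarrow> complex. \<Sum>k\<le>m. (w \<alpha> *\<^sub>R U k $ fst \<alpha> $ snd \<alpha>) \<bullet> p (\<tau> k))" for \<alpha>
  have herm: "U k $ i $ j = cnj (U k $ j $ i)" for k i j using U[of k] unfolding hermitian_matrices_def by blast
  have "indep_vars (\<lambda>_. path_algebra) (\<lambda>(i, j). path_of (\<lambda>t \<omega>. X t \<omega> $ i $ j)) {(i, j). i \<le> j}"
    using X unfolding hermitian_BM_def by blast
  then have ind: "indep_vars (\<lambda>_. path_algebra) (\<lambda>\<alpha>. path_of (z \<alpha>)) I"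
    by (simp add: I_def z_def case_prod_unfold)
  have "centered_gaussian (\<lambda>\<omega>. \<Sum>\<alpha>\<in>I. g \<alpha> (path_of (z \<alpha>) \<omega>)) (\<Sum>\<alpha>\<in>I. v \<alpha>)"
  proof (rule path_family_gaussian[OF ind])
    show "g \<alpha> \<in> borel_measurable path_algebra" for \<alpha>
      unfolding g_def by (rule borel_measurable_path_sum) (use nn in auto)
    fix \<alpha> assume \<alpha>: "\<alpha> \<in> I"
    have ga: "g \<alpha> (path_of (z \<alpha>) \<omega>) = (\<Sum>k\<le>m. (w \<alpha> *\<^sub>R U k $ fst \<alpha> $ snd \<alpha>) \<bullet> z \<alpha> (\<tau> k) \<omega>)" for \<omega>
      by (simp add: g_def path_of_apply nn)
    show "centered_gaussian (\<lambda>\<omega>. g \<alpha> (path_of (z \<alpha>) \<omega>)) (v \<alpha>)"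
    proof (cases "fst \<alpha> = snd \<alpha>")
      case False
      then have "std_complex_BM (z \<alpha>)" using \<alpha> upper_entry by (auto simp: I_def z_def)
      from complex_BM_linear_combination_gaussian[OF this \<tau>, where c="\<lambda>k. w \<alpha> *\<^sub>R U k $ fst \<alpha> $ snd \<alpha>" and m=m]
      show ?thesis
      proof (rule centered_gaussian_cong)
        show "(\<Sum>k\<le>m. \<Sum>l\<le>m. ((w \<alpha> *\<^sub>R U k $ fst \<alpha> $ snd \<alpha>) \<bullet> (w \<alpha> *\<^sub>R U l $ fst \<alpha> $ snd \<alpha>)) * min (\<tau> k) (\<tau> l)) / 2 = v \<alpha>"
          using False by (simp add: v_def w_def sum_distrib_left sum_divide_distrib mult_ac)
      qed (simp only: ga)
    next
      case True
      obtain b where b: "std_real_BM b" and Xb: "\<And>t \<omega>. 0 \<le> t \<Longrightarrow> \<omega> \<in> space M \<Longrightarrow> X t \<omega> $ fst \<alpha> $ fst \<alpha> = complex_of_real (b t \<omega>)"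
        by (rule diagonal_entry[of "fst \<alpha>"]) blast
      have Im0: "Im (U k $ fst \<alpha> $ fst \<alpha>) = 0" for k using herm[of k "fst \<alpha>" "fst \<alpha>"] by (simp add: complex_eq_iff)
      from real_BM_linear_combination_gaussian[OF b \<tau>, where c="\<lambda>k. Re (U k $ fst \<alpha> $ fst \<alpha>)" and m=m]
      show ?thesis
      proof (rule centered_gaussian_cong)
        fix \<omega> assume "\<omega> \<in> space M"
        then show "(\<Sum>k\<le>m. Re (U k $ fst \<alpha> $ fst \<alpha>) * b (\<tau> k) \<omega>) = g \<alpha> (path_of (z \<alpha>) \<omega>)"
          unfolding ga using True Xb[OF nn] by (simp add: w_def z_def inner_complex_def)
      next
        show "(\<Sum>k\<le>m. \<Sum>l\<le>m. Re (U k $ fst \<alpha> $ fst \<alpha>) * Re (U l $ fst \<alpha> $ fst \<alpha>) * min (\<tau> k) (\<tau> l)) = v \<alpha>"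
          using True by (simp add: v_def w_def inner_complex_def Im0 flip: True)
      qed
    qed
  qed simp
  then show ?thesis
  proof (rule centered_gaussian_cong)
    fix \<omega> assume \<omega>: "\<omega> \<in> space M"
    have Xherm: "X (\<tau> k) \<omega> $ i $ j = cnj (X (\<tau> k) \<omega> $ j $ i)" for k i j
      using X_hermitian[OF nn \<omega>] unfolding hermitian_matrices_def by blast
    have "(\<Sum>\<alpha>\<in>I. g \<alpha> (path_of (z \<alpha>) \<omega>)) = (\<Sum>\<alpha>\<in>I. w \<alpha> * (\<Sum>k\<le>m. U k $ fst \<alpha> $ snd \<alpha> \<bullet> X (\<tau> k) \<omega> $ fst \<alpha> $ snd \<alpha>))"
      by (simp add: g_def z_def path_of_apply nn sum_distrib_left)
    also have "\<dots> = (\<Sum>i\<in>UNIV. \<Sum>j\<in>UNIV. \<Sum>k\<le>m. U k $ i $ j \<bullet> X (\<tau> k) \<omega> $ i $ j)"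
      unfolding I_def w_def Diff_empty
    proof (rule sum_upper_triangle)
      fix i j
      have "U k $ i $ j \<bullet> X (\<tau> k) \<omega> $ i $ j = U k $ j $ i \<bullet> X (\<tau> k) \<omega> $ j $ i" for k
        unfolding herm[of k i j] Xherm[of k i j] by (simp add: inner_complex_def)
      then show "(\<Sum>k\<le>m. U k $ i $ j \<bullet> X (\<tau> k) \<omega> $ i $ j) = (\<Sum>k\<le>m. U k $ j $ i \<bullet> X (\<tau> k) \<omega> $ j $ i)" by simp
    qed
    also have "\<dots> = (\<Sum>k\<le>m. U k \<bullet> X (\<tau> k) \<omega>)"
      unfolding inner_vec_def by (simp add: sum.swap[of _ _ "{..m}"])
    finally show "(\<Sum>\<alpha>\<in>I. g \<alpha> (path_of (z \<alpha>) \<omega>)) = (\<Sum>k\<le>m. U k \<bullet> X (\<tau> k) \<omega>)" .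
  next
    have "(\<Sum>\<alpha>\<in>I. v \<alpha>) = (\<Sum>i\<in>UNIV. \<Sum>j\<in>UNIV. \<Sum>k\<le>m. \<Sum>l\<le>m. (U k $ i $ j \<bullet> U l $ i $ j) * min (\<tau> k) (\<tau> l))"
      unfolding I_def w_def v_def Diff_empty
    proof (rule sum_upper_triangle)
      fix i j
      have "U k $ i $ j \<bullet> U l $ i $ j = U k $ j $ i \<bullet> U l $ j $ i" for k l
        unfolding herm[of k i j] herm[of l i j] by (simp add: inner_complex_def)
      then show "(\<Sum>k\<le>m. \<Sum>l\<le>m. (U k $ i $ j \<bullet> U l $ i $ j) * min (\<tau> k) (\<tau> l)) = (\<Sum>k\<le>m. \<Sum>l\<le>m. (U k $ j $ i \<bullet> U l $ j $ i) * min (\<tau> k) (\<tau> l))" by simp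
    qed
    also have "\<dots> = (\<Sum>k\<le>m. \<Sum>l\<le>m. \<Sum>i\<in>UNIV. \<Sum>j\<in>UNIV. (U k $ i $ j \<bullet> U l $ i $ j) * min (\<tau> k) (\<tau> l))"
      by (simp only: sum.swap[of _ "{..m}" UNIV])
    also have "\<dots> = (\<Sum>k\<le>m. \<Sum>l\<le>m. min (\<tau> k) (\<tau> l) * (U k \<bullet> U l))"
      unfolding inner_vec_def by (simp add: sum_distrib_left mult.commute)
    finally show "(\<Sum>\<alpha>\<in>I. v \<alpha>) = (\<Sum>k\<le>m. \<Sum>l\<le>m. min (\<tau> k) (\<tau> l) * (U k \<bullet> U l))" .
  qed
qed

end

section \<open>The normalized Laguerre process\<close>

context complex_BM_column
begin

lemma \<xi>_rv: "0 \<le> t \<Longrightarrow> random_variable borel (\<xi> t)"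
  using complex_BM_rv[OF BM] unfolding centered_square_entry by (intro borel_measurable_matrix) (simp add: centered_square_entry)

lemma \<xi>_start: "\<omega> \<in> space M \<Longrightarrow> \<xi> 0 \<omega> = 0"
  using complex_BM_path(2)[OF BM] by (simp add: vec_eq_iff centered_square_entry)

lemma \<xi>_continuous: "\<omega> \<in> space M \<Longrightarrow> continuous_on {0..} (\<lambda>t. \<xi> t \<omega>)"
  unfolding centered_square_def
  using complex_BM_path(1)[OF BM] by (intro continuous_on_matrix) (auto intro!: continuous_intros)

lemma \<xi>_fourth_moment:
  assumes "0 \<le> s" "s \<le> t" "t \<le> T"
  shows "integrable M (\<lambda>\<omega>. norm (\<xi> t \<omega> - \<xi> s \<omega>) ^ 4)"
    and "expectation (\<lambda>\<omega>. norm (\<xi> t \<omega> - \<xi> s \<omega>) ^ 4) \<le> column_moment_bound (real CARD('n)) T * (t - s)\<^sup>2"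
proof -
  have "integrable M (\<lambda>\<omega>. norm (\<xi> t \<omega> - \<xi> s \<omega>) ^ 4) \<and>
    expectation (\<lambda>\<omega>. norm (\<xi> t \<omega> - \<xi> s \<omega>) ^ 4) \<le> column_moment_bound (real CARD('n)) T * (t - s)\<^sup>2"
  proof (cases "s = t")
    case False
    then show ?thesis using column_increment_moment[of s T t] assms by auto
  qed simp
  then show "integrable M (\<lambda>\<omega>. norm (\<xi> t \<omega> - \<xi> s \<omega>) ^ 4)"
    and "expectation (\<lambda>\<omega>. norm (\<xi> t \<omega> - \<xi> s \<omega>) ^ 4) \<le> column_moment_bound (real CARD('n)) T * (t - s)\<^sup>2"
    by auto
qed

lemma \<xi>_fourth_moment_zero:
  assumes "0 \<le> t" "t \<le> T"
  shows "integrable M (\<lambda>\<omega>. norm (\<xi> t \<omega>) ^ 4)"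
    and "expectation (\<lambda>\<omega>. norm (\<xi> t \<omega>) ^ 4) \<le> column_moment_bound (real CARD('n)) T * t\<^sup>2"
proof -
  have eq: "norm (\<xi> t \<omega> - \<xi> 0 \<omega>) ^ 4 = norm (\<xi> t \<omega>) ^ 4" if "\<omega> \<in> space M" for \<omega>
    using \<xi>_start[OF that] by simp
  have "integrable M (\<lambda>\<omega>. norm (\<xi> t \<omega> - \<xi> 0 \<omega>) ^ 4) = integrable M (\<lambda>\<omega>. norm (\<xi> t \<omega>) ^ 4)"
    by (rule Bochner_Integration.integrable_cong[OF refl eq])
  moreover have "expectation (\<lambda>\<omega>. norm (\<xi> t \<omega> - \<xi> 0 \<omega>) ^ 4) = expectation (\<lambda>\<omega>. norm (\<xi> t \<omega>) ^ 4)"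
    by (rule Bochner_Integration.integral_cong[OF refl eq])
  ultimately show "integrable M (\<lambda>\<omega>. norm (\<xi> t \<omega>) ^ 4)"
    and "expectation (\<lambda>\<omega>. norm (\<xi> t \<omega>) ^ 4) \<le> column_moment_bound (real CARD('n)) T * t\<^sup>2"
    using \<xi>_fourth_moment[of 0 t T] assms by auto
qed

lemma inner_\<xi>_mean:
  assumes "0 \<le> t"
  shows "integrable M (\<lambda>\<omega>. U \<bullet> \<xi> t \<omega>)" "expectation (\<lambda>\<omega>. U \<bullet> \<xi> t \<omega>) = 0"
proof -
  have herm: "U \<bullet> \<xi> t \<omega> = hermitian_part U \<bullet> \<xi> t \<omega>" for \<omega>
    by (rule inner_hermitian_part[OF centered_square_hermitian, symmetric])
  have "integrable M (\<lambda>\<omega>. U \<bullet> \<xi> t \<omega>) \<and> expectation (\<lambda>\<omega>. U \<bullet> \<xi> t \<omega>) = 0"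
  proof (cases "t = 0")
    case True
    have z: "U \<bullet> \<xi> t \<omega> = 0" if "\<omega> \<in> space M" for \<omega> using \<xi>_start[OF that] True by simp
    have "integrable M (\<lambda>\<omega>. U \<bullet> \<xi> t \<omega>) = integrable M (\<lambda>\<omega>. 0::real)"
      by (rule Bochner_Integration.integrable_cong[OF refl z])
    moreover have "expectation (\<lambda>\<omega>. U \<bullet> \<xi> t \<omega>) = expectation (\<lambda>\<omega>. 0)"
      by (rule Bochner_Integration.integral_cong[OF refl z])
    ultimately show ?thesis by simp
  next
    case False
    define \<tau> where "\<tau> k = real k * t" for k
    have \<tau>: "strict_mono \<tau>" "\<tau> 0 = 0" using False assms by (auto simp: \<tau>_def strict_mono_def)
    have "\<tau> 1 = t" by (simp add: \<tau>_def)
    then show ?thesis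
      unfolding herm
      using inner_\<xi>_moments(1,2)[OF \<tau> hermitian_part_hermitian hermitian_part_hermitian, of U 1] by simp
  qed
  then show "integrable M (\<lambda>\<omega>. U \<bullet> \<xi> t \<omega>)" "expectation (\<lambda>\<omega>. U \<bullet> \<xi> t \<omega>) = 0" by auto
qed

end

text \<open>As a function of the whole path of a column, so that independence of functionals of different columns
follows from measurability on path space.\<close>

definition column_statistic ::
    "nat \<Rightarrow> (nat \<Rightarrow> complex^'n^'n) \<Rightarrow> (nat \<Rightarrow> real) \<Rightarrow> ('n \<Rightarrow> real \<Rightarrow> complex) \<Rightarrow> real" where
  "column_statistic m V t z = (\<Sum>k\<le>m. V k \<bullet> centered_square (\<lambda>i. z i (t k)) (t k))"

locale laguerre_columns = prob_space +
  fixes A :: "'n::finite \<Rightarrow> nat \<Rightarrow> real \<Rightarrow> 'a \<Rightarrow> complex" and m :: nat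
  assumes BM: "\<And>i j. j < m \<Longrightarrow> std_complex_BM (A i j)"
    and indep: "indep_vars (\<lambda>_. path_algebra) (\<lambda>(i, j). path_of (A i j)) (UNIV \<times> {..<m})"
begin

lemma column:
  assumes j: "j < m"
  shows "complex_BM_column M (\<lambda>i. A i j)"
proof
  show "std_complex_BM (A i j)" for i using BM[OF j] .
  have "indep_vars (\<lambda>i. PiM {(i, j)} (\<lambda>_. path_algebra))
     (\<lambda>i \<omega>. restrict (\<lambda>\<alpha>. (case \<alpha> of (i, j) \<Rightarrow> path_of (A i j)) \<omega>) {(i, j)}) UNIV"
    by (rule indep_vars_restrict[OF indep]) (use j in \<open>auto simp: disjoint_family_on_def\<close>)
  then have "indep_vars (\<lambda>i. path_algebra)
     (\<lambda>i \<omega>. restrict (\<lambda>\<alpha>. (case \<alpha> of (i, j) \<Rightarrow> path_of (A i j)) \<omega>) {(i, j)} (i, j)) UNIV"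
    by (rule indep_vars_compose2) (rule measurable_component_singleton, simp)
  then show "indep_vars (\<lambda>_. path_algebra) (\<lambda>i. path_of (A i j)) UNIV" by simp
qed

text \<open>Grouping the independent entries by columns and applying a measurable functional to each group
preserves independence.\<close>

lemma column_statistic_indep:
  fixes t :: "nat \<Rightarrow> real"
  assumes t: "\<And>k. 0 \<le> t k"
  shows "indep_vars (\<lambda>_. borel) (\<lambda>j \<omega>. \<Sum>k\<le>(n::nat). V k \<bullet> centered_square (\<lambda>i. A i j (t k) \<omega>) (t k)) {..<m}"
proof -
  have ind: "indep_vars (\<lambda>j. PiM (UNIV \<times> {j}) (\<lambda>_. path_algebra))
     (\<lambda>j \<omega>. restrict (\<lambda>\<alpha>. (case \<alpha> of (i, j) \<Rightarrow> path_of (A i j)) \<omega>) (UNIV \<times> {j})) {..<m}"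
    by (rule indep_vars_restrict[OF indep]) (auto simp: disjoint_family_on_def)
  have "indep_vars (\<lambda>_. borel)
     (\<lambda>j \<omega>. column_statistic n V t (\<lambda>i. restrict (\<lambda>\<alpha>. (case \<alpha> of (i, j) \<Rightarrow> path_of (A i j)) \<omega>) (UNIV \<times> {j}) (i, j))) {..<m}"
  proof (rule indep_vars_compose2[OF ind])
    fix j
    let ?N = "PiM (UNIV \<times> {j}) (\<lambda>_. path_algebra) :: (('n \<times> nat) \<Rightarrow> real \<Rightarrow> complex) measure"
    have [measurable]: "(\<lambda>f. f (i, j) (t k)) \<in> borel_measurable ?N" for i k
    proof -
      have "(\<lambda>f. f (i, j)) \<in> ?N \<rightarrow>\<^sub>M path_algebra" by (rule measurable_component_singleton) simp
      from measurable_compose[OF this measurable_path_eval[OF t]] show ?thesis .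
    qed
    have "(\<lambda>f. centered_square (\<lambda>i. f (i, j) (t k)) (t k)) \<in> borel_measurable ?N" for k
      by (rule borel_measurable_matrix) (simp add: centered_square_def)
    then show "(\<lambda>f. column_statistic n V t (\<lambda>i. f (i, j))) \<in> borel_measurable ?N"
      unfolding column_statistic_def by (intro borel_measurable_sum borel_measurable_inner) auto
  qed
  then show ?thesis by (simp add: column_statistic_def path_of_apply t)
qed

abbreviation \<xi> :: "nat \<Rightarrow> real \<Rightarrow> 'a \<Rightarrow> complex^'n^'n" where
  "\<xi> j t \<omega> \<equiv> centered_square (\<lambda>i. A i j t \<omega>) t"

definition Z :: "real \<Rightarrow> 'a \<Rightarrow> complex^'n^'n" where
  "Z t \<omega> = (1 / sqrt (real m)) *\<^sub>R (\<Sum>j<m. \<xi> j t \<omega>)"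

lemma Z_eq_normalized_laguerre:
  assumes "Y = (\<chi> i k. \<Sum>j<m. A i j t \<omega> * cnj (A k j t \<omega>))"
  shows "(1 / sqrt (real m)) *\<^sub>R (Y - (real m * t) *\<^sub>R mat 1) = Z t \<omega>"
proof -
  have "(\<Sum>j<m. \<xi> j t \<omega>) = Y - (real m * t) *\<^sub>R mat 1"
    by (simp add: vec_eq_iff centered_square_entry assms sum_subtractf mat_def scaleR_conv_of_real[where 'a=complex])
  then show ?thesis by (simp add: Z_def)
qed

lemma Z_rv: "0 \<le> t \<Longrightarrow> random_variable borel (Z t)"
  unfolding Z_def
  by (intro borel_measurable_scaleR borel_measurable_const borel_measurable_sum complex_BM_column.\<xi>_rv[OF column]) auto

lemma Z_start: "\<omega> \<in> space M \<Longrightarrow> Z 0 \<omega> = 0"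
  unfolding Z_def using complex_BM_column.\<xi>_start[OF column] by simp

lemma Z_continuous: "\<omega> \<in> space M \<Longrightarrow> continuous_on {0..} (\<lambda>t. Z t \<omega>)"
  unfolding Z_def
  by (intro continuous_on_scaleR continuous_on_const continuous_on_sum complex_BM_column.\<xi>_continuous[OF column]) auto

lemma Z_hermitian: "Z t \<omega> \<in> hermitian_matrices"
  unfolding Z_def by (intro hermitian_scale_sum centered_square_hermitian)

text \<open>The increment of a coordinate is a normalized sum of independent centered variables \<open>\<eta>\<^sub>j\<close> whose fourth
moments are of order \<open>(t-s)\<^sup>2\<close>; the factor \<open>m\<^sup>2\<close> from \<open>fourth_moment_indep_sum\<close> cancels against the
normalization.\<close>

lemma coordinate_increment_moment:
  assumes st: "0 \<le> s" "s \<le> t" "t \<le> T" and m: "0 < m" and b: "norm b = 1"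
  shows "integrable M (\<lambda>\<omega>. (b \<bullet> (Z t \<omega> - Z s \<omega>)) ^ 4)"
    and "expectation (\<lambda>\<omega>. (b \<bullet> (Z t \<omega> - Z s \<omega>)) ^ 4) \<le> 3 * (column_moment_bound (real CARD('n)) T * (t - s)\<^sup>2)"
proof -
  define C where "C = column_moment_bound (real CARD('n)) T * (t - s)\<^sup>2"
  define \<eta> where "\<eta> j \<omega> = b \<bullet> \<xi> j t \<omega> - b \<bullet> \<xi> j s \<omega>" for j \<omega>
  \<comment> \<open>The increment is the column functional with the two times \<open>t\<close>, \<open>s\<close> and coefficients \<open>b\<close>, \<open>- b\<close>.\<close>
  define \<tau> where "\<tau> k = (if k = 0 then t else s)" for k :: nat
  define V where "V k = (if k = 0 then b else - b)" for k :: nat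
  have "indep_vars (\<lambda>_. borel) (\<lambda>j \<omega>. \<Sum>k\<le>1. V k \<bullet> centered_square (\<lambda>i. A i j (\<tau> k) \<omega>) (\<tau> k)) {..<m}"
    by (rule column_statistic_indep) (use st in \<open>simp add: \<tau>_def\<close>)
  then have ind: "indep_vars (\<lambda>_. borel) \<eta> {..<m}"
    by (simp add: \<eta>_def[abs_def] V_def \<tau>_def)
  have \<eta>: "integrable M (\<lambda>\<omega>. \<eta> j \<omega> ^ 4)" "expectation (\<eta> j) = 0" "expectation (\<lambda>\<omega>. \<eta> j \<omega> ^ 4) \<le> C"
    if j: "j \<in> {..<m}" for j
  proof -
    interpret c: complex_BM_column M "\<lambda>i. A i j" using column j by simp
    have le: "\<eta> j \<omega> ^ 4 \<le> norm (\<xi> j t \<omega> - \<xi> j s \<omega>) ^ 4" for \<omega>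
    proof -
      have "\<bar>\<eta> j \<omega>\<bar> \<le> norm (\<xi> j t \<omega> - \<xi> j s \<omega>)"
        using Cauchy_Schwarz_ineq2[of b "\<xi> j t \<omega> - \<xi> j s \<omega>"] b by (simp add: \<eta>_def inner_diff_right)
      then have "\<bar>\<eta> j \<omega>\<bar> ^ 4 \<le> norm (\<xi> j t \<omega> - \<xi> j s \<omega>) ^ 4" by (intro power_mono) auto
      then show ?thesis by (simp add: power_even_abs)
    qed
    note m4 = c.\<xi>_fourth_moment[OF st]
    have rv[measurable]: "random_variable borel (\<eta> j)" using ind j by (auto simp: indep_vars_def)
    have "(\<lambda>\<omega>. \<eta> j \<omega> ^ 4) \<in> borel_measurable M" by measurable
    note dom = integral_dominated_nonneg[OF m4(1) this _ le]
    show "integrable M (\<lambda>\<omega>. \<eta> j \<omega> ^ 4)" by (rule dom(1)) simp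
    have "expectation (\<lambda>\<omega>. \<eta> j \<omega> ^ 4) \<le> expectation (\<lambda>\<omega>. norm (\<xi> j t \<omega> - \<xi> j s \<omega>) ^ 4)"
      by (rule dom(2)) simp
    then show "expectation (\<lambda>\<omega>. \<eta> j \<omega> ^ 4) \<le> C" using m4(2) unfolding C_def by linarith
    show "expectation (\<eta> j) = 0"
      unfolding \<eta>_def using c.inner_\<xi>_mean[of t b] c.inner_\<xi>_mean[of s b] st by simp
  qed
  note S = fourth_moment_indep_sum[OF finite_lessThan ind \<eta>]
  have eq: "(b \<bullet> (Z t \<omega> - Z s \<omega>)) ^ 4 = (\<Sum>j<m. \<eta> j \<omega>) ^ 4 / (real m)\<^sup>2" for \<omega>
  proof -
    have "b \<bullet> (Z t \<omega> - Z s \<omega>) = (\<Sum>j<m. \<eta> j \<omega>) / sqrt (real m)"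
      by (simp add: Z_def inner_diff_right inner_sum_right \<eta>_def sum_subtractf diff_divide_distrib)
    then have "(b \<bullet> (Z t \<omega> - Z s \<omega>)) ^ 4 = (\<Sum>j<m. \<eta> j \<omega>) ^ 4 / sqrt (real m) ^ 4" by (simp add: power_divide)
    also have "sqrt (real m) ^ 4 = (real m)\<^sup>2" using power_mult[of "sqrt (real m)" 2 2] by simp
    finally show ?thesis .
  qed
  show "integrable M (\<lambda>\<omega>. (b \<bullet> (Z t \<omega> - Z s \<omega>)) ^ 4)" unfolding eq using S by simp
  have "expectation (\<lambda>\<omega>. (b \<bullet> (Z t \<omega> - Z s \<omega>)) ^ 4) = expectation (\<lambda>\<omega>. (\<Sum>j<m. \<eta> j \<omega>) ^ 4) / (real m)\<^sup>2"
    unfolding eq by simp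
  also have "\<dots> \<le> 3 * (real m)\<^sup>2 * C / (real m)\<^sup>2"
    by (rule divide_right_mono) (use S in auto)
  also have "\<dots> = 3 * C" using m by simp
  finally show "expectation (\<lambda>\<omega>. (b \<bullet> (Z t \<omega> - Z s \<omega>)) ^ 4) \<le> 3 * (column_moment_bound (real CARD('n)) T * (t - s)\<^sup>2)"
    by (simp add: C_def)
qed

lemma Z_increment_moment:
  assumes st: "0 \<le> s" "s \<le> t" "t \<le> T" and m: "0 < m"
  shows "integrable M (\<lambda>\<omega>. norm (Z t \<omega> - Z s \<omega>) ^ 4)"
    "expectation (\<lambda>\<omega>. norm (Z t \<omega> - Z s \<omega>) ^ 4)
      \<le> real (card (Basis :: (complex^'n^'n) set)) ^ 5 * 3 * column_moment_bound (real CARD('n)) T * (t - s)\<^sup>2"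
proof -
  let ?B = "Basis :: (complex^'n^'n) set"
  let ?d = "real (card ?B)"
  note c = coordinate_increment_moment[OF st m norm_Basis]
  have le: "norm (Z t \<omega> - Z s \<omega>) ^ 4 \<le> ?d ^ 4 * (\<Sum>b\<in>?B. (b \<bullet> (Z t \<omega> - Z s \<omega>)) ^ 4)" for \<omega>
  proof -
    have "norm (Z t \<omega> - Z s \<omega>) ^ 4 \<le> (\<Sum>b\<in>?B. \<bar>(Z t \<omega> - Z s \<omega>) \<bullet> b\<bar>) ^ 4"
      by (intro power_mono norm_le_l1) simp
    also have "\<dots> \<le> ?d ^ 4 * (\<Sum>b\<in>?B. \<bar>(Z t \<omega> - Z s \<omega>) \<bullet> b\<bar> ^ 4)"
      by (rule sum_power_le) auto
    also have "\<dots> = ?d ^ 4 * (\<Sum>b\<in>?B. (b \<bullet> (Z t \<omega> - Z s \<omega>)) ^ 4)"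
      by (simp only: power_even_abs[of 4] even_numeral inner_commute)
    finally show ?thesis .
  qed
  have intR: "integrable M (\<lambda>\<omega>. ?d ^ 4 * (\<Sum>b\<in>?B. (b \<bullet> (Z t \<omega> - Z s \<omega>)) ^ 4))" using c(1) by simp
  have [measurable]: "random_variable borel (Z t)" "random_variable borel (Z s)" using Z_rv st by auto
  have "(\<lambda>\<omega>. norm (Z t \<omega> - Z s \<omega>) ^ 4) \<in> borel_measurable M" by measurable
  note dom = integral_dominated_nonneg[OF intR this _ le]
  show "integrable M (\<lambda>\<omega>. norm (Z t \<omega> - Z s \<omega>) ^ 4)" by (rule dom(1)) simp
  have "expectation (\<lambda>\<omega>. norm (Z t \<omega> - Z s \<omega>) ^ 4) \<le> expectation (\<lambda>\<omega>. ?d ^ 4 * (\<Sum>b\<in>?B. (b \<bullet> (Z t \<omega> - Z s \<omega>)) ^ 4))"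
    by (rule dom(2)) simp
  also have "\<dots> = ?d ^ 4 * (\<Sum>b\<in>?B. expectation (\<lambda>\<omega>. (b \<bullet> (Z t \<omega> - Z s \<omega>)) ^ 4))"
    using c(1) by simp
  also have "\<dots> \<le> ?d ^ 4 * (\<Sum>b\<in>?B. 3 * (column_moment_bound (real CARD('n)) T * (t - s)\<^sup>2))"
    using c(2) by (intro mult_left_mono sum_mono) auto
  also have "\<dots> = ?d ^ 5 * 3 * column_moment_bound (real CARD('n)) T * (t - s)\<^sup>2"
    by (simp add: eval_nat_numeral)
  finally show "expectation (\<lambda>\<omega>. norm (Z t \<omega> - Z s \<omega>) ^ 4)
      \<le> ?d ^ 5 * 3 * column_moment_bound (real CARD('n)) T * (t - s)\<^sup>2" .
qed

definition column_sum_term :: "nat \<Rightarrow> (nat \<Rightarrow> complex^'n^'n) \<Rightarrow> real \<Rightarrow> nat \<Rightarrow> 'a \<Rightarrow> real" where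
  "column_sum_term n U h j \<omega> = (\<Sum>k\<le>n. U k \<bullet> \<xi> j (real k * h) \<omega>)"

lemma inner_Z_eq:
  "(\<Sum>k\<le>n. U k \<bullet> Z (real k * h) \<omega>) = (\<Sum>j<m. column_sum_term n U h j \<omega>) / sqrt (real m)"
proof -
  have "(\<Sum>k\<le>n. U k \<bullet> Z (real k * h) \<omega>) = (\<Sum>k\<le>n. \<Sum>j<m. U k \<bullet> \<xi> j (real k * h) \<omega>) / sqrt (real m)"
    by (simp add: Z_def inner_sum_right sum_divide_distrib)
  also have "(\<Sum>k\<le>n. \<Sum>j<m. U k \<bullet> \<xi> j (real k * h) \<omega>) = (\<Sum>j<m. column_sum_term n U h j \<omega>)"
    unfolding column_sum_term_def by (rule sum.swap)
  finally show ?thesis .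
qed

lemma column_sum_term_indep:
  "0 \<le> h \<Longrightarrow> indep_vars (\<lambda>_. borel) (column_sum_term n U h) {..<m}"
  unfolding column_sum_term_def[abs_def] by (rule column_statistic_indep) simp

lemma column_sum_term_moments:
  assumes h: "0 < h" and j: "j < m" and U: "\<And>k. U k \<in> hermitian_matrices"
  shows "integrable M (\<lambda>\<omega>. column_sum_term n U h j \<omega> ^ 4)"
    "expectation (column_sum_term n U h j) = 0"
    "expectation (\<lambda>\<omega>. column_sum_term n U h j \<omega> ^ 2)
       = (\<Sum>k\<le>n. \<Sum>l\<le>n. min ((real k * h)\<^sup>2) ((real l * h)\<^sup>2) * (U k \<bullet> U l))"
    "expectation (\<lambda>\<omega>. column_sum_term n U h j \<omega> ^ 4)
       \<le> real (n + 1) ^ 4 * (\<Sum>k\<le>n. norm (U k) ^ 4 * (column_moment_bound (real CARD('n)) (real n * h) * (real k * h)\<^sup>2))"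
proof -
  interpret c: complex_BM_column M "\<lambda>i. A i j" by (rule column[OF j])
  define \<tau> where "\<tau> k = real k * h" for k
  have \<tau>: "strict_mono \<tau>" "\<tau> 0 = 0" using h by (auto simp: \<tau>_def strict_mono_def)
  note m = c.inner_\<xi>_moments[OF \<tau> U U]
  have T: "column_sum_term n U h j \<omega> = (\<Sum>k\<le>n. U k \<bullet> \<xi> j (\<tau> k) \<omega>)" for \<omega>
    by (simp add: column_sum_term_def \<tau>_def)
  show "expectation (column_sum_term n U h j) = 0"
    unfolding T using m(1,2) by simp
  have "expectation (\<lambda>\<omega>. column_sum_term n U h j \<omega> ^ 2)
     = expectation (\<lambda>\<omega>. \<Sum>k\<le>n. \<Sum>l\<le>n. (U k \<bullet> \<xi> j (\<tau> k) \<omega>) * (U l \<bullet> \<xi> j (\<tau> l) \<omega>))"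
    unfolding T power2_eq_square sum_product ..
  also have "\<dots> = (\<Sum>k\<le>n. \<Sum>l\<le>n. (min (\<tau> k) (\<tau> l))\<^sup>2 * (U k \<bullet> U l))"
    using m(3,4) by simp
  also have "\<dots> = (\<Sum>k\<le>n. \<Sum>l\<le>n. min ((real k * h)\<^sup>2) ((real l * h)\<^sup>2) * (U k \<bullet> U l))"
  proof (intro sum.cong refl)
    fix k l
    have "\<tau> k \<le> \<tau> l \<longleftrightarrow> (\<tau> k)\<^sup>2 \<le> (\<tau> l)\<^sup>2"
      using h by (simp add: \<tau>_def abs_le_square_iff[symmetric] abs_mult)
    then show "(min (\<tau> k) (\<tau> l))\<^sup>2 * (U k \<bullet> U l) = min ((real k * h)\<^sup>2) ((real l * h)\<^sup>2) * (U k \<bullet> U l)"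
      by (simp add: min_def \<tau>_def)
  qed
  finally show "expectation (\<lambda>\<omega>. column_sum_term n U h j \<omega> ^ 2)
       = (\<Sum>k\<le>n. \<Sum>l\<le>n. min ((real k * h)\<^sup>2) ((real l * h)\<^sup>2) * (U k \<bullet> U l))" .
  have \<tau>n: "0 \<le> \<tau> k" "k \<le> n \<Longrightarrow> \<tau> k \<le> real n * h" for k using h by (auto simp: \<tau>_def)
  note f = c.\<xi>_fourth_moment_zero[OF \<tau>n]
  define R where "R \<omega> = real (n + 1) ^ 4 * (\<Sum>k\<le>n. norm (U k) ^ 4 * norm (\<xi> j (\<tau> k) \<omega>) ^ 4)" for \<omega>
  have le: "column_sum_term n U h j \<omega> ^ 4 \<le> R \<omega>" for \<omega>
  proof -
    have "\<bar>column_sum_term n U h j \<omega>\<bar> \<le> (\<Sum>k\<le>n. norm (U k) * norm (\<xi> j (\<tau> k) \<omega>))"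
      unfolding T by (intro order_trans[OF sum_abs] sum_mono Cauchy_Schwarz_ineq2)
    then have "\<bar>column_sum_term n U h j \<omega>\<bar> ^ 4 \<le> (\<Sum>k\<le>n. norm (U k) * norm (\<xi> j (\<tau> k) \<omega>)) ^ 4"
      by (intro power_mono) auto
    also have "\<dots> \<le> real (card {..n}) ^ 4 * (\<Sum>k\<le>n. (norm (U k) * norm (\<xi> j (\<tau> k) \<omega>)) ^ 4)"
      by (rule sum_power_le) auto
    also have "\<dots> = R \<omega>" by (simp add: R_def power_mult_distrib add.commute)
    finally show ?thesis by (simp add: power_even_abs)
  qed
  have intR: "integrable M R"
    unfolding R_def by (intro integrable_mult_right Bochner_Integration.integrable_sum f(1)) simp
  have [measurable]: "random_variable borel (column_sum_term n U h j)"
    using column_sum_term_indep[of h n U] h j by (auto simp: indep_vars_def)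
  have "(\<lambda>\<omega>. column_sum_term n U h j \<omega> ^ 4) \<in> borel_measurable M" by measurable
  note dom = integral_dominated_nonneg[OF intR this _ le]
  show "integrable M (\<lambda>\<omega>. column_sum_term n U h j \<omega> ^ 4)" by (rule dom(1)) simp
  have "expectation (\<lambda>\<omega>. column_sum_term n U h j \<omega> ^ 4) \<le> expectation R"
    by (rule dom(2)) simp
  also have "\<dots> = real (n + 1) ^ 4 * (\<Sum>k\<le>n. norm (U k) ^ 4 * expectation (\<lambda>\<omega>. norm (\<xi> j (\<tau> k) \<omega>) ^ 4))"
    unfolding R_def using f(1) by simp
  also have "\<dots> \<le> real (n + 1) ^ 4 * (\<Sum>k\<le>n. norm (U k) ^ 4 * (column_moment_bound (real CARD('n)) (real n * h) * (\<tau> k)\<^sup>2))"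
    using f(2) by (intro mult_left_mono sum_mono) auto
  finally show "expectation (\<lambda>\<omega>. column_sum_term n U h j \<omega> ^ 4)
       \<le> real (n + 1) ^ 4 * (\<Sum>k\<le>n. norm (U k) ^ 4 * (column_moment_bound (real CARD('n)) (real n * h) * (real k * h)\<^sup>2))"
    by (simp add: \<tau>_def)
qed

end

section \<open>The functional limit theorem\<close>

text \<open>Convergence in distribution ignores finitely many indices, which allows the index of the processes to start
where the hypotheses do.\<close>

lemma converges_in_distribution_offset:
  assumes "converges_in_distribution T (\<lambda>n. P (n + k)) (\<lambda>n. Z (n + k)) Q W"
  shows "converges_in_distribution T P Z Q W"
  using assms unfolding converges_in_distribution_def eventually_sequentially_seg[symmetric, of "\<lambda>n. Z n \<in> P n \<rightarrow>\<^sub>M borel_of T" k]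
  by (auto intro: LIMSEQ_offset[where k=k])

lemma symmetric_moment_bound:
  fixes f :: "'a \<Rightarrow> real \<Rightarrow> 'v::real_normed_vector"
  assumes *: "\<And>s t. 0 \<le> s \<Longrightarrow> s \<le> t \<Longrightarrow> t \<le> T \<Longrightarrow> integrable P (\<lambda>\<omega>. norm (f \<omega> t - f \<omega> s) ^ 4) \<and>
      (\<integral>\<omega>. norm (f \<omega> t - f \<omega> s) ^ 4 \<partial>P) \<le> C * (t - s)\<^sup>2"
    and s: "s \<in> {0..T}" and t: "t \<in> {0..T}"
  shows "(\<integral>\<^sup>+\<omega>. ennreal (dist (f \<omega> t) (f \<omega> s) ^ 4) \<partial>P) \<le> ennreal (C * (t - s)\<^sup>2)"
proof -
  have main: "(\<integral>\<^sup>+\<omega>. ennreal (dist (f \<omega> v) (f \<omega> u) ^ 4) \<partial>P) \<le> ennreal (C * (v - u)\<^sup>2)"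
    if "0 \<le> u" "u \<le> v" "v \<le> T" for u v
  proof -
    note m = *[OF that]
    have "(\<integral>\<^sup>+\<omega>. ennreal (norm (f \<omega> v - f \<omega> u) ^ 4) \<partial>P) = ennreal (\<integral>\<omega>. norm (f \<omega> v - f \<omega> u) ^ 4 \<partial>P)"
      using m by (intro nn_integral_eq_integral) auto
    also have "\<dots> \<le> ennreal (C * (v - u)\<^sup>2)" using m by (intro ennreal_leI) blast
    finally show ?thesis by (simp add: dist_norm)
  qed
  show ?thesis
  proof (cases "s \<le> t")
    case True
    then show ?thesis using main[of s t] s t by simp
  next
    case False
    then show ?thesis using main[of t s] s t by (simp add: dist_commute power2_commute)
  qed
qed

lemma converges_in_distribution_cong:
  assumes "converges_in_distribution T P Z Q W"
    and Z: "\<And>n \<omega>. \<omega> \<in> space (P n) \<Longrightarrow> Z n \<omega> = Z' n \<omega>"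
  shows "converges_in_distribution T P Z' Q W"
proof -
  have m: "Z n \<in> P n \<rightarrow>\<^sub>M borel_of T \<longleftrightarrow> Z' n \<in> P n \<rightarrow>\<^sub>M borel_of T" for n
    by (rule measurable_cong[OF Z])
  have i: "(\<integral>\<omega>. F (Z n \<omega>) \<partial>P n) = (\<integral>\<omega>. F (Z' n \<omega>) \<partial>P n)" for F :: "_ \<Rightarrow> real" and n
    by (rule Bochner_Integration.integral_cong[OF refl]) (simp add: Z)
  show ?thesis using assms(1) unfolding converges_in_distribution_def m i .
qed

lemma path_of_in_continuous_maps:
  assumes "\<And>t. 0 \<le> t \<Longrightarrow> Z t \<omega> \<in> H" "continuous_on {0..} (\<lambda>t. Z t \<omega>)"
  shows "path_of Z \<omega> \<in> continuous_maps {0..} H"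
proof -
  have "continuous_on {0..} (path_of Z \<omega>)"
    using assms(2) by (rule continuous_on_eq) (simp add: path_of_def)
  then show ?thesis using assms(1) by (auto simp: continuous_maps_def path_of_def)
qed

theorem theorem2p3:
  fixes P :: "nat \<Rightarrow> 'a measure"
    and Y :: "nat \<Rightarrow> real \<Rightarrow> 'a \<Rightarrow> complex^'n::{finite,linorder}^'n::{finite,linorder}"
    and Q :: "'b measure"
    and X :: "real \<Rightarrow> 'b \<Rightarrow> complex^'n::{finite,linorder}^'n::{finite,linorder}"
  assumes "\<And>M. M \<ge> CARD('n) \<Longrightarrow> prob_space (P M)"
    and "\<And>M. M \<ge> CARD('n) \<Longrightarrow> prob_space.laguerre_process (P M) M (Y M)"
    and "prob_space Q"
    and "prob_space.hermitian_BM Q X"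
  shows "converges_in_distribution
           (compact_convergence_topology {0..} hermitian_matrices)
           P (\<lambda>M. path_of (\<lambda>t \<omega>. (1 / sqrt (real M)) *\<^sub>R (Y M t \<omega> - (real M * t) *\<^sub>R mat 1)))
           Q (path_of (\<lambda>t. X (t^2)))"
proof -
  let ?N = "CARD('n::{finite,linorder})" and ?H = "hermitian_matrices :: (complex^'n::{finite,linorder}^'n::{finite,linorder}) set"
  \<comment> \<open>Re-indexed so that the hypotheses hold for every index.\<close>
  define P' where "P' n = P (n + ?N)" for n
  have prob: "prob_space (P' n)" for n unfolding P'_def by (rule assms(1)) simp
  interpret W: hermitian_BM_process Q X
    using assms(3,4) by (simp add: hermitian_BM_process_def hermitian_BM_process_axioms_def)
  have "\<exists>A. laguerre_columns (P' n) A (n + ?N) \<and>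
      (\<forall>t\<ge>0. \<forall>\<omega>\<in>space (P' n). Y (n + ?N) t \<omega> = (\<chi> i k. \<Sum>j<n + ?N. A i j t \<omega> * cnj (A k j t \<omega>)))" for n
  proof -
    have "prob_space.laguerre_process (P' n) (n + ?N) (Y (n + ?N))" unfolding P'_def by (rule assms(2)) simp
    then show ?thesis
      unfolding prob_space.laguerre_process_def[OF prob] laguerre_columns_def laguerre_columns_axioms_def
      using prob by blast
  qed
  then have "\<forall>n. \<exists>A. laguerre_columns (P' n) A (n + ?N) \<and>
      (\<forall>t\<ge>0. \<forall>\<omega>\<in>space (P' n). Y (n + ?N) t \<omega> = (\<chi> i k. \<Sum>j<n + ?N. A i j t \<omega> * cnj (A k j t \<omega>)))" ..
  from choice[OF this] obtain A where A: "\<forall>n. laguerre_columns (P' n) (A n) (n + ?N) \<and>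
      (\<forall>t\<ge>0. \<forall>\<omega>\<in>space (P' n). Y (n + ?N) t \<omega> = (\<chi> i k. \<Sum>j<n + ?N. A n i j t \<omega> * cnj (A n k j t \<omega>)))"
    by (elim exE)
  have col: "laguerre_columns (P' n) (A n) (n + ?N)" for n using A by simp
  have Y: "Y (n + ?N) t \<omega> = (\<chi> i k. \<Sum>j<n + ?N. A n i j t \<omega> * cnj (A n k j t \<omega>))"
    if "0 \<le> t" "\<omega> \<in> space (P' n)" for n t \<omega>
    using A that by simp
  define Z where "Z n = laguerre_columns.Z (A n) (n + ?N)" for n
  note Zd = laguerre_columns.Z_rv[OF col, folded Z_def] laguerre_columns.Z_start[OF col, folded Z_def]
    laguerre_columns.Z_continuous[OF col, folded Z_def] laguerre_columns.Z_hermitian[OF col, folded Z_def]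
  have pos: "0 < n + ?N" for n by simp
  note Zm = laguerre_columns.Z_increment_moment[OF col _ _ _ pos, folded Z_def]
  have conv: "converges_in_distribution (compact_convergence_topology {0..} ?H) P' (\<lambda>n. path_of (Z n)) Q (path_of (\<lambda>t. X (t^2)))"
  proof (rule converges_in_distribution_criterion[OF prob assms(3)])
    show "(\<lambda>\<omega>. path_of (Z n) \<omega> t) \<in> borel_measurable (P' n)" if "0 \<le> t" for n t
      using Zd(1)[OF that] by (simp add: path_of_apply that)
    show "(\<lambda>\<omega>. path_of (\<lambda>t. X (t^2)) \<omega> t) \<in> borel_measurable Q" if "0 \<le> t" for t
      using W.X_rv[of "t^2"] by (simp add: path_of_apply that)
    show "path_of (Z n) \<omega> \<in> continuous_maps {0..} ?H" if "\<omega> \<in> space (P' n)" for n \<omega>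
      by (intro path_of_in_continuous_maps Zd(4) Zd(3)[OF that])
    show "path_of (\<lambda>t. X (t^2)) \<omega> \<in> continuous_maps {0..} ?H" if "\<omega> \<in> space Q" for \<omega>
    proof (rule path_of_in_continuous_maps)
      show "X (t\<^sup>2) \<omega> \<in> ?H" for t using W.X_hermitian[OF _ that] by simp
      show "continuous_on {0..} (\<lambda>t. X (t\<^sup>2) \<omega>)"
        by (rule continuous_on_compose2[OF W.X_continuous[OF that]]) (auto intro!: continuous_intros)
    qed
    show "path_of (Z n) \<omega> 0 = 0" if "\<omega> \<in> space (P' n)" for n \<omega>
      using Zd(2)[OF that] by (simp add: path_of_apply)
    show "path_of (\<lambda>t. X (t^2)) \<omega> 0 = 0" if "\<omega> \<in> space Q" for \<omega>
      using W.X_start[OF that] by (simp add: path_of_apply)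
  next
    fix T :: real assume T: "0 < T"
    define C1 where "C1 = real (card (Basis :: (complex^'n::{finite,linorder}^'n::{finite,linorder}) set)) ^ 5 * 3 * column_moment_bound (real ?N) T"
    \<comment> \<open>From \<open>(t\<^sup>2 - s\<^sup>2)\<^sup>2 \<le> (2 T)\<^sup>2 (t - s)\<^sup>2\<close>: on bounded intervals the time change preserves the bound.\<close>
    define C2 where "C2 = 106 * real ?N ^ 10 * (4 * T\<^sup>2)"
    have C: "0 \<le> C1" "0 \<le> C2"
      by (auto simp: C1_def C2_def intro!: mult_nonneg_nonneg column_moment_bound_nonneg)
    have 1: "(\<integral>\<^sup>+\<omega>. ennreal (dist (Z n t \<omega>) (Z n s \<omega>) ^ 4) \<partial>P' n) \<le> ennreal (C1 * (t - s)\<^sup>2)"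
      if "s \<in> {0..T}" "t \<in> {0..T}" for n s t
      by (rule symmetric_moment_bound[where f="\<lambda>\<omega> t. Z n t \<omega>", OF _ that]) (use Zm in \<open>auto simp: C1_def\<close>)
    have 2: "(\<integral>\<^sup>+\<omega>. ennreal (dist (X (t^2) \<omega>) (X (s^2) \<omega>) ^ 4) \<partial>Q) \<le> ennreal (C2 * (t - s)\<^sup>2)"
      if "s \<in> {0..T}" "t \<in> {0..T}" for s t
    proof (rule symmetric_moment_bound[where f="\<lambda>\<omega> t. X (t^2) \<omega>", OF _ that])
      fix s t :: real assume st: "0 \<le> s" "s \<le> t" "t \<le> T"
      then have "s^2 \<le> t^2" by (intro power_mono) auto
      note m = W.X_increment_moment[OF zero_le_power2 this]
      have "(t^2 - s^2)\<^sup>2 = (t + s)\<^sup>2 * (t - s)\<^sup>2" by (simp add: power2_eq_square algebra_simps)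
      also have "\<dots> \<le> (2 * T)\<^sup>2 * (t - s)\<^sup>2" using st by (intro mult_right_mono power_mono) auto
      finally have "106 * real ?N ^ 10 * (t^2 - s^2)\<^sup>2 \<le> 106 * real ?N ^ 10 * ((2 * T)\<^sup>2 * (t - s)\<^sup>2)"
        by (intro mult_left_mono) auto
      also have "\<dots> = C2 * (t - s)\<^sup>2" by (simp add: C2_def power_mult_distrib)
      finally show "integrable Q (\<lambda>\<omega>. norm (X (t^2) \<omega> - X (s^2) \<omega>) ^ 4) \<and>
          (\<integral>\<omega>. norm (X (t^2) \<omega> - X (s^2) \<omega>) ^ 4 \<partial>Q) \<le> C2 * (t - s)\<^sup>2"
        using m by linarith
    qed
    have le: "ennreal (C1 * (t - s)\<^sup>2) \<le> ennreal ((C1 + C2) * (t - s)\<^sup>2)"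
      "ennreal (C2 * (t - s)\<^sup>2) \<le> ennreal ((C1 + C2) * (t - s)\<^sup>2)" for s t
      using C by (auto intro!: ennreal_leI mult_right_mono)
    show "\<exists>C\<ge>0. \<forall>s\<in>{0..T}. \<forall>t\<in>{0..T}.
          (\<forall>n. (\<integral>\<^sup>+\<omega>. ennreal (dist (path_of (Z n) \<omega> t) (path_of (Z n) \<omega> s) ^ 4) \<partial>P' n) \<le> ennreal (C * (t - s)\<^sup>2)) \<and>
          (\<integral>\<^sup>+\<omega>. ennreal (dist (path_of (\<lambda>t. X (t^2)) \<omega> t) (path_of (\<lambda>t. X (t^2)) \<omega> s) ^ 4) \<partial>Q) \<le> ennreal (C * (t - s)\<^sup>2)"
    proof (intro exI[of _ "C1 + C2"] conjI ballI allI)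
      fix s t n assume st: "s \<in> {0..T}" "t \<in> {0..T}"
      then have "0 \<le> s" "0 \<le> t" by auto
      then show "(\<integral>\<^sup>+\<omega>. ennreal (dist (path_of (Z n) \<omega> t) (path_of (Z n) \<omega> s) ^ 4) \<partial>P' n) \<le> ennreal ((C1 + C2) * (t - s)\<^sup>2)"
        "(\<integral>\<^sup>+\<omega>. ennreal (dist (path_of (\<lambda>t. X (t^2)) \<omega> t) (path_of (\<lambda>t. X (t^2)) \<omega> s) ^ 4) \<partial>Q) \<le> ennreal ((C1 + C2) * (t - s)\<^sup>2)"
        using order_trans[OF 1[OF st] le(1)] order_trans[OF 2[OF st] le(2)] by (simp_all only: path_of_apply)
    qed (use C in simp)
  next
    fix h \<theta> :: real and m and U :: "nat \<Rightarrow> complex^'n::{finite,linorder}^'n::{finite,linorder}" assume h: "0 < h"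
    let ?U = "\<lambda>k. hermitian_part (U k)"
    \<comment> \<open>The limit is sampled at the squared grid times.\<close>
    define \<tau> where "\<tau> k = (real k * h)\<^sup>2" for k
    have \<tau>: "strict_mono \<tau>" "\<tau> 0 = 0"
      using h by (auto simp: \<tau>_def strict_mono_def intro!: power_strict_mono)
    define x where "x n = laguerre_columns.column_sum_term (A n) m ?U h" for n
    have xZ: "(\<Sum>k\<le>m. U k \<bullet> path_of (Z n) \<omega> (real k * h)) = (\<Sum>j<n + ?N. x n j \<omega>) / sqrt (real (n + ?N))" for n \<omega>
      using laguerre_columns.inner_Z_eq[OF col[of n], where n=m and U="?U" and h=h and \<omega>=\<omega>] h
      by (simp add: path_of_apply inner_hermitian_part Zd(4) Z_def[symmetric] x_def)
    have xW: "(\<Sum>k\<le>m. U k \<bullet> path_of (\<lambda>t. X (t^2)) \<omega> (real k * h)) = (\<Sum>k\<le>m. ?U k \<bullet> X (\<tau> k) \<omega>)"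
      if "\<omega> \<in> space Q" for \<omega>
      using h by (simp add: path_of_apply inner_hermitian_part[OF W.X_hermitian[OF _ that]] \<tau>_def)
    note xm = laguerre_columns.column_sum_term_moments[OF col h _ hermitian_part_hermitian]
    have "(\<lambda>n. \<integral>\<omega>. cos ((\<Sum>j<n + ?N. x n j \<omega>) / sqrt (real (n + ?N)) + \<theta>) \<partial>P' n)
        \<longlonglongrightarrow> (\<integral>\<omega>. cos ((\<Sum>k\<le>m. ?U k \<bullet> X (\<tau> k) \<omega>) + \<theta>) \<partial>Q)"
    proof (rule triangular_array_cos_limit[OF prob assms(3)])
      show "filterlim (\<lambda>n. n + ?N) at_top sequentially" by (rule filterlim_add_const_nat_at_top)
      show "prob_space.indep_vars (P' n) (\<lambda>_. borel) (x n) {..<n + ?N}" for n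
        unfolding x_def by (rule laguerre_columns.column_sum_term_indep[OF col]) (use h in simp)
      show "prob_space.centered_gaussian Q (\<lambda>\<omega>. \<Sum>k\<le>m. ?U k \<bullet> X (\<tau> k) \<omega>)
          (\<Sum>k\<le>m. \<Sum>l\<le>m. min ((real k * h)\<^sup>2) ((real l * h)\<^sup>2) * (?U k \<bullet> ?U l))"
        using W.X_linear_combination_gaussian[OF \<tau>, where m=m and U="?U", OF hermitian_part_hermitian] by (simp add: \<tau>_def)
      fix n j assume j: "j < n + ?N"
      show "integrable (P' n) (\<lambda>\<omega>. x n j \<omega> ^ 4)" "(\<integral>\<omega>. x n j \<omega> \<partial>P' n) = 0"
        "(\<integral>\<omega>. x n j \<omega> ^ 2 \<partial>P' n) = (\<Sum>k\<le>m. \<Sum>l\<le>m. min ((real k * h)\<^sup>2) ((real l * h)\<^sup>2) * (?U k \<bullet> ?U l))"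
        "(\<integral>\<omega>. x n j \<omega> ^ 4 \<partial>P' n) \<le> real (m + 1) ^ 4 *
           (\<Sum>k\<le>m. norm (?U k) ^ 4 * (column_moment_bound (real ?N) (real m * h) * (real k * h)\<^sup>2))"
        unfolding x_def by (rule xm[OF j])+
    qed
    moreover have "(\<integral>\<omega>. cos ((\<Sum>k\<le>m. U k \<bullet> path_of (\<lambda>t. X (t^2)) \<omega> (real k * h)) + \<theta>) \<partial>Q)
        = (\<integral>\<omega>. cos ((\<Sum>k\<le>m. ?U k \<bullet> X (\<tau> k) \<omega>) + \<theta>) \<partial>Q)"
      by (rule Bochner_Integration.integral_cong[OF refl]) (simp only: xW)
    ultimately show "(\<lambda>n. \<integral>\<omega>. cos ((\<Sum>k\<le>m. U k \<bullet> path_of (Z n) \<omega> (real k * h)) + \<theta>) \<partial>P' n)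
        \<longlonglongrightarrow> (\<integral>\<omega>. cos ((\<Sum>k\<le>m. U k \<bullet> path_of (\<lambda>t. X (t^2)) \<omega> (real k * h)) + \<theta>) \<partial>Q)"
      by (simp only: xZ)
  qed
  let ?V = "\<lambda>M. path_of (\<lambda>t \<omega>. (1 / sqrt (real M)) *\<^sub>R (Y M t \<omega> - (real M * t) *\<^sub>R mat 1))"
  have "converges_in_distribution (compact_convergence_topology {0..} ?H) P' (\<lambda>n. ?V (n + ?N)) Q (path_of (\<lambda>t. X (t^2)))"
  proof (rule converges_in_distribution_cong[OF conv])
    fix n \<omega> assume \<omega>: "\<omega> \<in> space (P' n)"
    show "path_of (Z n) \<omega> = ?V (n + ?N) \<omega>"
      unfolding path_of_def
    proof (rule restrict_ext)
      fix t :: real assume "t \<in> {0..}"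
      then have "0 \<le> t" by simp
      from laguerre_columns.Z_eq_normalized_laguerre[OF col Y[OF this \<omega>]]
      show "Z n t \<omega> = (1 / sqrt (real (n + ?N))) *\<^sub>R (Y (n + ?N) t \<omega> - (real (n + ?N) * t) *\<^sub>R mat 1)"
        by (simp add: Z_def)
    qed
  qed
  then show ?thesis
    unfolding P'_def by (rule converges_in_distribution_offset[where k="?N" and Z="?V"])
qed

end
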